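(* For $n\geq 3$, the Brauer monoid $\mathcal B_n$ satisfies $$\deg'(\mathcal B_n)=\begin{cases}|P_1|+3|P_3|&\text{if $n$ is odd}\\ |P_0|+2|P_2|+3|P_4|&\text{if $n$ is even,}\end{cases}\qquad\text{and}\qquad \deg(\mathcal B_n)=1+\deg'(\mathcal B_n),$$ where $P_r=\{\varepsilon\in P(\mathcal B_n):\operatorname{rank}(\varepsilon)=r\}$ is the set of projections of $\mathcal B_n$ of rank $r$. If $n$ is odd, then moreover $\deg(\mathcal B_n)=\deg_{\mathrm{rc}}(\mathcal B_n)$.
   Context: Diagram monoids. For an integer $n\ge 0$ let $\mathbf n=\{1,\dots,n\}$ and $\mathbf n'=\{1',\dots,n'\}$. The partition monoid $\mathcal P_n$ is the set of all set partitions of $\mathbf n\cup\mathbf n'$. Product of $\alpha,\beta\in\mathcal P_n$: with $\mathbf n''=\{1'',\dots,n''\}$, rename each $x'$ in $\alpha$ as $x''$ and each (unprimed) $x$ in $\beta$ as $x''$; consider the equivalence on $\mathbf n\cup\mathbf n''\cup\mathbf n'$ generated by the blocks of these two renamed partitions; $x,y\in\mathbf n\cup\mathbf n'$ are in the same block of $\alpha\beta$ iff they are related by this equivalence. This is a monoid with identity the partition with blocks $\{x,x'\}$. $\alpha^*$ is obtained from $\alpha$ by interchanging $x$ and $x'$ for all $x$. A transversal of $\alpha$ is a block meeting both $\mathbf n$ and $\mathbf n'$; $\operatorname{rank}(\alpha)$ is the number of transversals. $\mathcal B_n$ is the submonoid of $\mathcal P_n$ of all partitions all of whose blocks have size exactly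 $2$. $P(\mathcal B_n)=\{\varepsilon\in \mathcal B_n:\varepsilon^2=\varepsilon=\varepsilon^*\}$ is its set of projections. Degrees. $\mathcal T_m$ (resp. $\mathcal{PT}_m$) is the monoid of all maps (resp. partial maps) from $\{1,\dots,m\}$ to itself, composed left to right. For a finite semigroup $S$: $\deg(S)=\min\{m\ge1: S\text{ embeds in }\mathcal T_m\}$ and $\deg'(S)=\min\{m\geq1:S\text{ embeds in }\mathcal{PT}_m\}$, embeddings being injective semigroup homomorphisms. A right congruence $\sigma$ on $S$ is an equivalence with $(a,b)\in\sigma\Rightarrow(as,bs)\in\sigma$ for all $s \in S$; it gives a right action of $S$ on $S/\sigma$ by $([x]_\sigma,a)\mapsto[xa]_\sigma$, of degree $|S/\sigma|$. An action of $S$ on $X$ is faithful if distinct elements of $S$ induce distinct maps $X\to X$. $\deg_{\mathrm{rc}}(S)$ is the minimum of $|S/\sigma|$ over right congruences $\sigma$ whose associated action is faithful. *)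

theory Defs
  imports "HOL-Algebra.Group" "HOL-Library.Disjoint_Sets" "HOL-Library.FuncSet"
begin

text \<open>\<open>Up i\<close>, \<open>Dn i\<close> and \<open>Mid i\<close> stand for \<open>i\<close>, \<open>i'\<close> and \<open>i''\<close>.
  The points \<open>Mid i\<close> occur only inside the definition of the product.\<close>

datatype vertex = Up nat | Dn nat | Mid nat

type_synonym diagram = "vertex set set"

definition verts :: "nat \<Rightarrow> vertex set" where
  "verts n = Up ` {1..n} \<union> Dn ` {1..n}"

definition rename_lower :: "diagram \<Rightarrow> diagram" where
  "rename_lower \<alpha> = (\<lambda>A. (\<lambda>v. case v of Dn i \<Rightarrow> Mid i | _ \<Rightarrow> v) ` A) ` \<alpha>"

definition rename_upper :: "diagram \<Rightarrow> diagram" where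
  "rename_upper \<beta> = (\<lambda>A. (\<lambda>v. case v of Up i \<Rightarrow> Mid i | _ \<Rightarrow> v) ` A) ` \<beta>"

definition same_block :: "diagram \<Rightarrow> vertex rel" where
  "same_block P = {(x, y). \<exists>A\<in>P. x \<in> A \<and> y \<in> A}"

definition generated_equiv :: "'a set \<Rightarrow> 'a rel \<Rightarrow> 'a rel" where
  "generated_equiv X r = \<Inter>{s. equiv X s \<and> r \<subseteq> s}"

definition diagram_equiv :: "nat \<Rightarrow> diagram \<Rightarrow> diagram \<Rightarrow> vertex rel" where
  "diagram_equiv n \<alpha> \<beta> =
     generated_equiv (verts n \<union> Mid ` {1..n})
       (same_block (rename_lower \<alpha>) \<union> same_block (rename_upper \<beta>))"

definition diagram_mult :: "nat \<Rightarrow> diagram \<Rightarrow> diagram \<Rightarrow> diagram" where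
  "diagram_mult n \<alpha> \<beta> = verts n // Restr (diagram_equiv n \<alpha> \<beta>) (verts n)"

definition partition_monoid :: "nat \<Rightarrow> diagram monoid" where
  "partition_monoid n =
     \<lparr>carrier = {\<alpha>. partition_on (verts n) \<alpha>},
      mult = diagram_mult n,
      one = (\<lambda>i. {Up i, Dn i}) ` {1..n}\<rparr>"

definition brauer_monoid :: "nat \<Rightarrow> diagram monoid" where
  "brauer_monoid n =
     (partition_monoid n)
       \<lparr>carrier := {\<alpha> \<in> carrier (partition_monoid n). \<forall>A\<in>\<alpha>. card A = 2}\<rparr>"

definition star :: "diagram \<Rightarrow> diagram" where
  "star \<alpha> = (\<lambda>A. (\<lambda>v. case v of Up i \<Rightarrow> Dn i | Dn i \<Rightarrow> Up i | Mid i \<Rightarrow> Mid i) ` A) ` \<alpha>"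

definition transversals :: "diagram \<Rightarrow> vertex set set" where
  "transversals \<alpha> = {A \<in> \<alpha>. A \<inter> range Up \<noteq> {} \<and> A \<inter> range Dn \<noteq> {}}"

definition rank :: "diagram \<Rightarrow> nat" where
  "rank \<alpha> = card (transversals \<alpha>)"

definition brauer_projections :: "nat \<Rightarrow> diagram set" where
  "brauer_projections n =
     {\<epsilon> \<in> carrier (brauer_monoid n). \<epsilon> \<otimes>\<^bsub>brauer_monoid n\<^esub> \<epsilon> = \<epsilon> \<and> star \<epsilon> = \<epsilon>}"

definition rank_projections :: "nat \<Rightarrow> nat \<Rightarrow> diagram set" where
  "rank_projections n r = {\<epsilon> \<in> brauer_projections n. rank \<epsilon> = r}"

definition full_transformation_monoid :: "nat \<Rightarrow> (nat \<Rightarrow> nat) monoid" where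
  "full_transformation_monoid m =
     \<lparr>carrier = {1..m} \<rightarrow>\<^sub>E {1..m},
      mult = (\<lambda>f g. compose {1..m} g f),
      one = restrict id {1..m}\<rparr>"

definition partial_transformation_monoid :: "nat \<Rightarrow> (nat \<rightharpoonup> nat) monoid" where
  "partial_transformation_monoid m =
     \<lparr>carrier = {f. dom f \<subseteq> {1..m} \<and> ran f \<subseteq> {1..m}},
      mult = (\<lambda>f g. g \<circ>\<^sub>m f),
      one = Some |` {1..m}\<rparr>"

text \<open>Semigroups are given as monoid records. Elements of \<^const>\<open>mon\<close> are injective
  and respect multiplication, but need not preserve the identity, so these are
  semigroup embeddings.\<close>

definition embeds :: "('a, 'c) monoid_scheme \<Rightarrow> ('b, 'd) monoid_scheme \<Rightarrow> bool" where
  "embeds S T \<longleftrightarrow> mon S T \<noteq> {}"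

text \<open>For finite \<open>S\<close> the minima below exist.\<close>

definition transformation_degree :: "('a, 'c) monoid_scheme \<Rightarrow> nat" where
  "transformation_degree S = (LEAST m. 1 \<le> m \<and> embeds S (full_transformation_monoid m))"

definition partial_transformation_degree :: "('a, 'c) monoid_scheme \<Rightarrow> nat" where
  "partial_transformation_degree S =
     (LEAST m. 1 \<le> m \<and> embeds S (partial_transformation_monoid m))"

definition right_congruence :: "('a, 'c) monoid_scheme \<Rightarrow> 'a rel \<Rightarrow> bool" where
  "right_congruence S \<sigma> \<longleftrightarrow>
     equiv (carrier S) \<sigma> \<and>
     (\<forall>(a, b) \<in> \<sigma>. \<forall>s \<in> carrier S. (a \<otimes>\<^bsub>S\<^esub> s, b \<otimes>\<^bsub>S\<^esub> s) \<in> \<sigma>)"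

text \<open>For a right congruence \<open>\<sigma>\<close>, all members of the union coincide, and the class
  of \<open>x\<close> is sent by \<open>a\<close> to the class of \<open>x \<otimes> a\<close>.\<close>

definition rc_action :: "('a, 'c) monoid_scheme \<Rightarrow> 'a rel \<Rightarrow> 'a set \<Rightarrow> 'a \<Rightarrow> 'a set" where
  "rc_action S \<sigma> C a = (\<Union>x\<in>C. \<sigma> `` {x \<otimes>\<^bsub>S\<^esub> a})"

definition faithful_action ::
    "('a, 'c) monoid_scheme \<Rightarrow> 'x set \<Rightarrow> ('x \<Rightarrow> 'a \<Rightarrow> 'x) \<Rightarrow> bool" where
  "faithful_action S X act \<longleftrightarrow>
     (\<forall>a \<in> carrier S. \<forall>b \<in> carrier S. a \<noteq> b \<longrightarrow> (\<exists>x\<in>X. act x a \<noteq> act x b))"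

text \<open>For a finite monoid the equality relation is a faithful right congruence, so the
  minimum below exists; a finite semigroup without identity need not have one.\<close>

definition rc_degree :: "('a, 'c) monoid_scheme \<Rightarrow> nat" where
  "rc_degree S =
     (LEAST k. \<exists>\<sigma>. right_congruence S \<sigma> \<and>
        faithful_action S (carrier S // \<sigma>) (rc_action S \<sigma>) \<and>
        k = card (carrier S // \<sigma>))"

end

theory Submission
  imports Defs
begin

text \<open>
  A diagram is determined by the 0/1-labelings of its vertices that are constant on blocks.
  Read as a relation between the labels of the upper and of the lower vertices, this turns the
  product of diagrams into relational composition, and two Brauer diagrams agree as soon as one
  relation contains the other.

  Upper bound: diagrams act by relational image on sets of labelings. The sets needed are the
  labelings compatible with a perfect matching (rank 0); those compatible with a matching with
  two defects and giving these the labels 1, 0 (rank 2); and those compatible with a matching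
  with four defects, paired up so that the labels agree within and differ between the two pairs
  (rank 4). An extra point 0 joined to itself reduces odd \<open>n\<close> to the even case: it must be one
  of the four defects, and rank 2 is not needed.

  Lower bound: consider a faithful partial action on a set. The images of the minimal ideal
  contain a copy of all perfect matchings, because a right congruence on these is trivial or
  universal. For every projection of rank 2 the swap of its two defects moves two of its fixed
  points. For every projection \<open>\<epsilon>\<close> of rank 4, two left factors in the minimal ideal below
  \<open>\<epsilon>\<close> are separated by some fixed point of \<open>\<epsilon>\<close>; rotating three defects yields three such
  points. In the last two cases \<open>\<epsilon>\<close> is recovered from the point as the set of all pairs
  whose hook (the projection of corank 2 joining them) fixes it, so these points are distinct for
  distinct projections. For a total action, the values separated by a point of the last kind
  cannot all lie in one orbit of the minimal ideal, which costs one additional point.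
\<close>

section \<open>Matchings and their compatible labelings\<close>

text \<open>The coefficients count choices at the defects: two defects can be ordered in 2 ways,
  four can be split into two pairs in 3 ways. Four is the least number of defects with several
  perfect completions. Two defects have only one, so the minimal ideal does not see their swap, and
  for even \<open>n\<close> this swap needs points of its own. For odd \<open>n\<close> all ranks
  are odd: the extra point \<open>0\<close> is a defect that no diagram moves, and the permutations
  of the other three defects act faithfully on the three pairings. For even \<open>n\<close> the
  permutations of four defects act on the pairings with a kernel of order 4, which the points for
  rank 2 make up for. In the lower bound the layers are told apart by the map that sends a left
  factor in the minimal ideal to the value of the point under it: nonconstant on the layer for rank
  4, constant on the other two. The upper bound counts states with possible repetitions; that they
  are distinct comes from the lower bound, applied to the action on them.\<close>

definition matching :: "'a set \<Rightarrow> ('a \<Rightarrow> 'a) \<Rightarrow> bool" where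
  "matching A p \<longleftrightarrow> (\<forall>x. p (p x) = x) \<and> (\<forall>x. p x \<noteq> x \<longleftrightarrow> x \<in> A)"

definition agrees :: "('a \<Rightarrow> 'a) \<Rightarrow> ('a \<Rightarrow> bool) \<Rightarrow> bool" where
  "agrees p s \<longleftrightarrow> (\<forall>x. s (p x) = s x)"

lemma matchingI:
  assumes "\<And>x. p (p x) = x" "\<And>x. x \<in> A \<Longrightarrow> p x \<noteq> x" "\<And>x. x \<notin> A \<Longrightarrow> p x = x"
  shows "matching A p"
  using assms unfolding matching_def by blast

lemma matching_inv [simp]: "matching A p \<Longrightarrow> p (p x) = x"
  by (simp add: matching_def)

lemma matching_fix_iff: "matching A p \<Longrightarrow> p x = x \<longleftrightarrow> x \<notin> A"
  unfolding matching_def by blast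

lemma matching_in_iff: "matching A p \<Longrightarrow> p x \<in> A \<longleftrightarrow> x \<in> A"
  by (metis matching_def)

lemma matching_eq_iff: "matching A p \<Longrightarrow> p x = p y \<longleftrightarrow> x = y"
  by (metis matching_def)

lemma matching_swap_eq: "matching A p \<Longrightarrow> p x = y \<longleftrightarrow> p y = x"
  by (metis matching_def)

lemma agreesD: "agrees p s \<Longrightarrow> s (p x) = s x"
  by (simp add: agrees_def)

lemma agrees_matchingI:
  assumes "matching A p" "\<And>x. x \<in> A \<Longrightarrow> s (p x) = s x"
  shows "agrees p s"
  using assms by (metis agrees_def matching_def)

text \<open>Outside \<open>A\<close> the involution is the identity and imposes no condition on
  labels.\<close>

lemma agrees_cong:
  assumes "matching A p" "\<And>x. x \<in> A \<Longrightarrow> s x = t x"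
  shows "agrees p s \<longleftrightarrow> agrees p t"
proof -
  have "s (p x) = s x \<longleftrightarrow> t (p x) = t x" for x
    using assms matching_in_iff[OF assms(1), of x] matching_fix_iff[OF assms(1), of x]
    by (cases "x \<in> A") auto
  then show ?thesis by (simp add: agrees_def)
qed

lemma agrees_pair: "matching A m \<Longrightarrow> agrees m (\<lambda>z. z = x \<or> z = m x)"
  unfolding agrees_def by (metis matching_def)

text \<open>The indicator of the pair of \<open>x\<close> under \<open>m\<close> is compatible with
  \<open>m\<close>, hence with \<open>m'\<close>; so \<open>m' x\<close> is \<open>x\<close> or
  \<open>m x\<close>, and it is not \<open>x\<close>, since both involutions move the same points.
  This is why one inclusion between sets of labelings is enough throughout.\<close>

lemma matching_eq_of_agrees:
  assumes m: "matching A m" and m': "matching A m'"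
    and le: "\<And>s. agrees m s \<Longrightarrow> agrees m' s"
  shows "m = m'"
proof
  fix x
  show "m x = m' x"
  proof (cases "x \<in> A")
    case True
    have "agrees m' (\<lambda>z. z = x \<or> z = m x)"
      by (rule le[OF agrees_pair[OF m]])
    from agreesD[OF this, of x] have "m' x = x \<or> m' x = m x" by simp
    with True m' show ?thesis by (auto simp: matching_def)
  qed (metis m m' matching_def)
qed

text \<open>Tested on the indicator of the pair of \<open>x\<close>. This is how single pairs of an
  unknown matching are read off from its labelings.\<close>

lemma matching_forced:
  assumes m: "matching A m" and le: "\<And>s. agrees m s \<Longrightarrow> s x = s y" and "x \<noteq> y"
  shows "m x = y"
  using le[OF agrees_pair[OF m, of x]] \<open>x \<noteq> y\<close> by auto

lemma matching_exists:
  assumes "finite A" "even (card A)"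
  shows "\<exists>p. matching A p"
  using assms
proof (induction "card A" arbitrary: A rule: less_induct)
  case less
  show ?case
  proof (cases "A = {}")
    case True
    then show ?thesis by (intro exI[of _ id]) (auto simp: matching_def)
  next
    case False
    then obtain x where x: "x \<in> A" by auto
    have "A \<noteq> {x}" using less.prems by auto
    with x obtain y where y: "y \<in> A" "y \<noteq> x" by auto
    let ?B = "A - {x} - {y}"
    have c: "card ?B + 2 = card A" using x y less.prems
      by (metis One_nat_def Suc_1 add_2_eq_Suc' card_Suc_Diff1 finite_Diff insertE insert_Diff)
    then have "even (card ?B)" using less.prems by (metis even_add even_numeral)
    with c less.hyps[of ?B] less.prems obtain p where p: "matching ?B p" by auto
    have "matching A (p(x := y, y := x))"
      using p x y by (intro matchingI) (auto simp: matching_def)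
    then show ?thesis by blast
  qed
qed

lemma matching_Un:
  assumes "matching A p" "matching B q" "A \<inter> B = {}"
  shows "matching (A \<union> B) (\<lambda>x. if x \<in> A then p x else q x)"
  using assms by (intro matchingI) (auto simp: matching_def)

lemma matching_switch:
  assumes m: "matching A m" and "a \<in> A" "c \<in> A" "a \<noteq> c"
  shows "matching A (m(m a := m c, m c := m a, a := c, c := a))" (is "matching A ?f")
proof (cases "m a = c")
  case True
  then have "m c = a" using m by auto
  then have "m(m a := m c, m c := m a, a := c, c := a) = m" using True by auto
  with m show ?thesis by simp
next
  case False
  show ?thesis
  proof (rule matchingI)
    fix x
    have d: "m a \<noteq> a" "m c \<noteq> c" "m a \<noteq> m c" "m c \<noteq> a" "m a \<noteq> c"
      using m False assms by (metis matching_def)+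
    consider "x = a" | "x = c" | "x = m a" | "x = m c" | "x \<notin> {a, c, m a, m c}" by blast
    then have "?f (?f x) = x \<and> (?f x = x \<longleftrightarrow> x \<notin> A)"
    proof cases
      case 5
      then have "m x \<notin> {a, c, m a, m c}" using m by (metis insert_iff empty_iff matching_inv)
      with 5 m show ?thesis by (simp add: matching_fix_iff)
    qed (use d m assms in \<open>auto simp: matching_in_iff\<close>)
    then show "?f (?f x) = x" "x \<in> A \<Longrightarrow> ?f x \<noteq> x" "x \<notin> A \<Longrightarrow> ?f x = x" by auto
  qed
qed

lemma matching_unpair:
  assumes m: "matching A m" and "m P = Q"
  shows "matching (A - {P, Q}) (m(P := P, Q := Q))"
proof -
  have "m Q = P" using assms by auto
  then have *: "m x = P \<longleftrightarrow> x = Q" "m x = Q \<longleftrightarrow> x = P" for x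
    using m \<open>m P = Q\<close> by (metis matching_inv)+
  show ?thesis
    using m * by (intro matchingI) (auto simp: matching_fix_iff)
qed

text \<open>If \<open>w\<close> sent \<open>a\<close> outside its pair under \<open>u\<close>, then
  \<open>u\<close> and \<open>w\<close> would agree at \<open>w a\<close>, and \<open>u\<close>
  would send \<open>w a\<close> back to \<open>a\<close>. So one pair never has to be checked; for
  \<open>perfect_eqI\<close> it is the pair of \<open>0\<close>.\<close>

lemma matching_eq_off_pair:
  assumes u: "matching A u" and w: "matching A w"
    and eq: "\<And>x. x \<notin> {a, u a} \<Longrightarrow> u x = w x"
  shows "u = w"
proof -
  have "w a \<in> {a, u a}"
  proof (rule ccontr)
    assume "w a \<notin> {a, u a}"
    moreover from this have "u (w a) = a" using eq w by simp
    then have "w a = u a" using u by (metis matching_inv)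
    ultimately show False by simp
  qed
  then have wa: "w a = u a" using u w by (metis insert_iff matching_fix_iff singletonD)
  then have "w (u a) = u (u a)" using u w by (metis matching_inv)
  then show ?thesis using wa eq by (intro ext) (metis insert_iff singletonD)
qed

text \<open>If \<open>p\<close> agreed with \<open>q\<close> on \<open>Q\<close>, then
  \<open>Q\<close> would lie in \<open>P\<close>, and by cardinality the supports and the
  involutions would be equal. It supplies a pair of \<open>q\<close> that is not a pair of
  \<open>p\<close>.\<close>

lemma matching_differ:
  assumes p: "matching P p" and q: "matching Q q" and "finite P" "card P = card Q" "p \<noteq> q"
  shows "\<exists>x\<in>Q. p x \<noteq> q x"
proof (rule ccontr)
  assume "\<not> ?thesis"
  then have eq: "p x = q x" if "x \<in> Q" for x using that by auto
  then have "Q \<subseteq> P" using matching_fix_iff[OF p] matching_fix_iff[OF q] by (metis subsetI)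
  then have "Q = P" using assms(3,4) by (metis card_subset_eq)
  then have "p = q" using eq matching_fix_iff[OF p] matching_fix_iff[OF q] by (metis ext)
  with \<open>p \<noteq> q\<close> show False by simp
qed

lemma matching_join:
  assumes "matching P p" "a \<noteq> b" "a \<notin> P" "b \<notin> P"
  shows "matching (P \<union> {a, b}) (p(a := b, b := a))"
proof (rule matchingI)
  fix x
  have ne: "p x \<notin> {a, b}" if "x \<in> P"
    using that assms matching_in_iff[OF assms(1), of x] by auto
  show "(p(a := b, b := a)) ((p(a := b, b := a)) x) = x"
    using assms ne matching_fix_iff[OF assms(1), of x] by (cases "x \<in> P") auto
  show "x \<in> P \<union> {a, b} \<Longrightarrow> (p(a := b, b := a)) x \<noteq> x" "x \<notin> P \<union> {a, b} \<Longrightarrow> (p(a := b, b := a)) x = x"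
    using assms matching_fix_iff[OF assms(1), of x] by auto
qed

lemma matching_even:
  assumes "matching P p" "finite P"
  shows "even (card P)"
  using assms(2,1)
proof (induction "card P" arbitrary: P p rule: less_induct)
  case less
  show ?case
  proof (cases "P = {}")
    case False
    then obtain x where x: "x \<in> P" by blast
    then have px: "p x \<in> P" "x \<noteq> p x"
      using matching_in_iff[OF less.prems(2)] matching_fix_iff[OF less.prems(2)] by metis+
    have m: "matching (P - {x, p x}) (p(x := x, p x := p x))" by (rule matching_unpair[OF less.prems(2) refl])
    have c: "card (P - {x, p x}) + 2 = card P"
      using x px less.prems(1) card_mono[of P "{x, p x}"] by (simp add: card_Diff_subset)
    then have "even (card (P - {x, p x}))" using less.prems(1) by (intro less.hyps[OF _ _ m]) auto
    then show ?thesis using c by (metis even_add even_numeral)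
  qed simp
qed

lemma matching_fix_pair:
  assumes "matching P p" "P \<subseteq> {x, y}"
  shows "p x = x \<or> p x = y"
  using assms matching_in_iff[OF assms(1), of x] matching_fix_iff[OF assms(1), of x] by blast

lemma agrees_indicator:
  assumes "\<And>x. x \<in> Z \<Longrightarrow> p x \<in> Z" "\<And>x. p (p x) = x"
  shows "agrees p (\<lambda>x. x \<in> Z)"
  unfolding agrees_def using assms by metis

lemma agrees_fixed_indicator:
  assumes "matching P p" "x \<notin> P"
  shows "agrees p (\<lambda>y. y = x)"
  unfolding agrees_def using assms by (metis matching_fix_iff matching_inv)

lemma even_card_neq:
  assumes "even (card A)"
  shows "A \<noteq> {a}" "distinct [a, b, c] \<Longrightarrow> A \<noteq> {a, b, c}"
  using assms by auto

lemma even_card_Diff_pair: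
  assumes "finite Z" "even (card Z)" "a \<in> Z" "b \<in> Z" "a \<noteq> b"
  shows "even (card (Z - {a, b}))"
proof -
  have "card (Z - {a, b}) = card Z - 2" using assms by (simp add: card_Diff_subset)
  then show ?thesis using assms(2) by simp
qed

text \<open>\<open>P\<close> and \<open>Q\<close> are glued, with common label \<open>c\<close>, and
  then forgotten. If they are partners, they form a closed component and the other pairs stay;
  otherwise their partners become partners of each other.\<close>

lemma contract_pair:
  assumes m: "matching Z m" and "P \<in> Z" "Q \<in> Z" "P \<noteq> Q"
  shows "\<exists>m'. matching (Z - {P, Q}) m' \<and>
    (\<forall>s. agrees m' s \<longleftrightarrow> (\<exists>c. agrees m (s(P := c, Q := c))))"
proof (cases "m P = Q")
  case True
  then have Q: "m Q = P" using m by (metis matching_def)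
  let ?m = "m(P := P, Q := Q)"
  have mm: "matching (Z - {P, Q}) ?m"
    using m True by (rule matching_unpair)
  have "agrees ?m s \<longleftrightarrow> (\<exists>c. agrees m (s(P := c, Q := c)))" for s
  proof -
    have *: "m x = P \<longleftrightarrow> x = Q" "m x = Q \<longleftrightarrow> x = P" for x
      using m True Q by (metis matching_inv)+
    have "(s(P := c, Q := c)) (m x) = (s(P := c, Q := c)) x \<longleftrightarrow> s (?m x) = s x" for c x
      using * True Q by auto
    then show ?thesis unfolding agrees_def by blast
  qed
  with mm show ?thesis by blast
next
  case False
  \<comment> \<open>The path \<open>m P\<close>, \<open>P\<close>, \<open>Q\<close>,
    \<open>m Q\<close> loses its two middle points.\<close>
  let ?m = "m(P := P, Q := Q, m P := m Q, m Q := m P)"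
  have d: "m P \<noteq> P" "m Q \<noteq> Q" "m P \<noteq> m Q" "m Q \<noteq> P" "m P \<noteq> Q"
    using m False assms unfolding matching_def by metis+
  have "matching Z (m(m P := m Q, m Q := m P, P := Q, Q := P))"
    using matching_switch[OF assms] .
  then have "matching (Z - {P, Q}) ((m(m P := m Q, m Q := m P, P := Q, Q := P))(P := P, Q := Q))"
    by (rule matching_unpair) (use d in auto)
  moreover have "(m(m P := m Q, m Q := m P, P := Q, Q := P))(P := P, Q := Q) = ?m"
    using d by auto
  ultimately have mm: "matching (Z - {P, Q}) ?m" by simp
  have "agrees ?m s \<longleftrightarrow> (\<exists>c. agrees m (s(P := c, Q := c)))" for s
  proof
    assume c: "agrees ?m s"
    from agreesD[OF c, of "m P"] d have e: "s (m Q) = s (m P)" by simp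
    have "agrees m (s(P := s (m P), Q := s (m P)))"
    proof (rule agrees_matchingI[OF m])
      fix x assume "x \<in> Z"
      consider "x = P" | "x = Q" | "x = m P" | "x = m Q" | "x \<notin> {P, Q, m P, m Q}" by blast
      then show "(s(P := s (m P), Q := s (m P))) (m x) = (s(P := s (m P), Q := s (m P))) x"
      proof cases
        case 5
        then have "m x \<noteq> P" "m x \<noteq> Q" using m by (auto simp: matching_def)
        with 5 agreesD[OF c, of x] show ?thesis by auto
      qed (use d e m \<open>P \<noteq> Q\<close> in \<open>auto simp: matching_def\<close>)
    qed
    then show "\<exists>c. agrees m (s(P := c, Q := c))" by blast
  next
    assume "\<exists>c. agrees m (s(P := c, Q := c))"
    then obtain c where c: "agrees m (s(P := c, Q := c))" by blast
    have P: "s (m P) = c" and Q: "s (m Q) = c"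
      using agreesD[OF c, of P] agreesD[OF c, of Q] d \<open>P \<noteq> Q\<close> by (auto split: if_splits)
    show "agrees ?m s"
    proof (rule agrees_matchingI[OF mm])
      fix x assume x: "x \<in> Z - {P, Q}"
      show "s (?m x) = s x"
      proof (cases "x = m P \<or> x = m Q")
        case True
        then show ?thesis using P Q x d by auto
      next
        case False
        then have "m x \<noteq> P" "m x \<noteq> Q" using m by (auto simp: matching_def)
        then show ?thesis using False x agreesD[OF c, of x] by auto
      qed
    qed
  qed
  with mm show ?thesis by blast
qed

text \<open>Gluing one pair at a time. The labels of \<open>t\<close> at the glued points will be
  the intermediate labeling of a composition.\<close>

lemma contract_pairs:
  assumes "finite I" and m: "matching Z m"
    and "inj_on P I" "inj_on Q I" "P ` I \<inter> Q ` I = {}" "P ` I \<subseteq> Z" "Q ` I \<subseteq> Z"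
  shows "\<exists>m'. matching (Z - P ` I - Q ` I) m' \<and>
    (\<forall>s. agrees m' s \<longleftrightarrow> (\<exists>t. (\<forall>x. x \<notin> P ` I \<union> Q ` I \<longrightarrow> t x = s x) \<and>
       (\<forall>i\<in>I. t (P i) = t (Q i)) \<and> agrees m t))"
  using assms(1,3-)
proof (induction I rule: finite_induct)
  case empty
  have "(\<exists>t. (\<forall>x. t x = s x) \<and> agrees m t) \<longleftrightarrow> agrees m s" for s
    by (auto simp flip: fun_eq_iff)
  then show ?case using m by (intro exI[of _ m]) auto
next
  case (insert i I)
  then obtain m' where m': "matching (Z - P ` I - Q ` I) m'"
    and c: "\<And>s. agrees m' s \<longleftrightarrow> (\<exists>t. (\<forall>x. x \<notin> P ` I \<union> Q ` I \<longrightarrow> t x = s x) \<and>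
       (\<forall>i\<in>I. t (P i) = t (Q i)) \<and> agrees m t)"
    by (auto simp: inj_on_insert)
  have PQ: "P i \<notin> P ` I" "Q i \<notin> Q ` I" "P i \<notin> Q ` I" "Q i \<notin> P ` I" "P i \<noteq> Q i"
    using insert by auto
  have "\<exists>m''. matching (Z - P ` I - Q ` I - {P i, Q i}) m'' \<and>
      (\<forall>s. agrees m'' s \<longleftrightarrow> (\<exists>c. agrees m' (s(P i := c, Q i := c))))"
    by (rule contract_pair[OF m']) (use insert PQ in auto)
  then obtain m'' where m'': "matching (Z - P ` I - Q ` I - {P i, Q i}) m''"
    and c2: "\<And>s. agrees m'' s \<longleftrightarrow> (\<exists>c. agrees m' (s(P i := c, Q i := c)))" by blast
  have "agrees m'' s \<longleftrightarrow> (\<exists>t. (\<forall>x. x \<notin> P ` insert i I \<union> Q ` insert i I \<longrightarrow> t x = s x) \<and>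
       (\<forall>j\<in>insert i I. t (P j) = t (Q j)) \<and> agrees m t)" (is "?l \<longleftrightarrow> ?r") for s
  proof
    assume ?l
    then obtain c0 where "agrees m' (s(P i := c0, Q i := c0))" unfolding c2 ..
    then obtain t where "\<forall>x. x \<notin> P ` I \<union> Q ` I \<longrightarrow> t x = (s(P i := c0, Q i := c0)) x"
      "\<forall>i\<in>I. t (P i) = t (Q i)" "agrees m t" unfolding c by auto
    then show ?r using PQ by (intro exI[of _ t]) simp
  next
    assume ?r
    then obtain t where t: "\<forall>x. x \<notin> P ` insert i I \<union> Q ` insert i I \<longrightarrow> t x = s x"
      "\<forall>j\<in>insert i I. t (P j) = t (Q j)" "agrees m t" by blast
    have "agrees m' (s(P i := t (P i), Q i := t (P i)))"
      unfolding c using t by (intro exI[of _ t]) simp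
    then show ?l unfolding c2 ..
  qed
  moreover have "Z - P ` I - Q ` I - {P i, Q i} = Z - P ` insert i I - Q ` insert i I" by auto
  ultimately show ?case using m'' by metis
qed

section \<open>Diagrams as relations between labelings\<close>

text \<open>The value at \<open>Mid\<close> points is a mere default: no matching of
  \<open>Up\<close> and \<open>Dn\<close> points moves them.\<close>

definition lab :: "(nat \<Rightarrow> bool) \<Rightarrow> (nat \<Rightarrow> bool) \<Rightarrow> vertex \<Rightarrow> bool" where
  "lab s r v = (case v of Up i \<Rightarrow> s i | Dn i \<Rightarrow> r i | Mid i \<Rightarrow> False)"

lemma lab_simps [simp]: "lab s r (Up i) = s i" "lab s r (Dn i) = r i" "lab s r (Mid i) = False"
  by (simp_all add: lab_def)

text \<open>The two rows may have different point sets. An empty upper row turns perfect matchings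
  into relations, and upper rows of two or four points describe the states of the upper bound, so
  that \<open>brauer_rel_comp\<close> computes the action on all of these.\<close>

definition brauer_rel :: "nat set \<Rightarrow> nat set \<Rightarrow> ((nat \<Rightarrow> bool) \<Rightarrow> (nat \<Rightarrow> bool) \<Rightarrow> bool) \<Rightarrow> bool" where
  "brauer_rel A B R \<longleftrightarrow>
     (\<exists>m. matching (Up ` A \<union> Dn ` B) m \<and> (\<forall>s r. R s r \<longleftrightarrow> agrees m (lab s r)))"

text \<open>Two diagrams side by side form one matching on a disjoint union. Gluing each lower point
  of the first to the upper point of the second and dropping both leaves the product; chains and
  loops in the middle row are taken care of by \<open>contract_pairs\<close>.\<close>

lemma brauer_rel_comp:
  assumes "brauer_rel A B R" "brauer_rel B C Q" "finite B"
  shows "brauer_rel A C (R OO Q)"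
proof -
  obtain m where m: "matching (Up ` A \<union> Dn ` B) m" and R: "\<And>s r. R s r \<longleftrightarrow> agrees m (lab s r)"
    using assms by (auto simp: brauer_rel_def)
  obtain m' where m': "matching (Up ` B \<union> Dn ` C) m'" and Q: "\<And>s r. Q s r \<longleftrightarrow> agrees m' (lab s r)"
    using assms by (auto simp: brauer_rel_def)
  let ?Z = "Inl ` (Up ` A \<union> Dn ` B) \<union> Inr ` (Up ` B \<union> Dn ` C)"
  let ?P = "\<lambda>i. Inl (Dn i)" and ?Q = "\<lambda>i. Inr (Up i)"
  let ?m = "map_sum m m'"
  have mm: "matching ?Z ?m"
  proof (rule matchingI)
    fix x :: "vertex + vertex"
    show "?m (?m x) = x" using m m' by (cases x) auto
    show "x \<in> ?Z \<Longrightarrow> ?m x \<noteq> x" using m m' by (cases x) (auto simp: matching_def)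
    show "x \<notin> ?Z \<Longrightarrow> ?m x = x" using m m'
      by (cases x) (auto simp: matching_def image_iff)
  qed
  obtain k where k: "matching (?Z - ?P ` B - ?Q ` B) k"
    and ck: "\<And>s. agrees k s \<longleftrightarrow> (\<exists>t. (\<forall>x. x \<notin> ?P ` B \<union> ?Q ` B \<longrightarrow> t x = s x) \<and>
       (\<forall>i\<in>B. t (?P i) = t (?Q i)) \<and> agrees ?m t)"
    using contract_pairs[OF \<open>finite B\<close> mm, of ?P ?Q] by (auto simp: inj_on_def)
  have Zeq: "?Z - ?P ` B - ?Q ` B = Inl ` Up ` A \<union> Inr ` Dn ` C" by auto
  \<comment> \<open>\<open>?e\<close> places the outer vertices into the disjoint union and
    \<open>?d\<close> forgets the side; they carry the contracted matching \<open>k\<close> back to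
    vertices.\<close>
  let ?e = "\<lambda>v. case v of Up i \<Rightarrow> Inl (Up i) | Dn i \<Rightarrow> Inr (Dn i) | Mid i \<Rightarrow> Inl (Mid i)"
  let ?d = "\<lambda>w. case w of Inl v \<Rightarrow> v | Inr v \<Rightarrow> v"
  let ?k = "\<lambda>v. ?d (k (?e v))"
  have de: "?d (?e v) = v" for v by (auto split: vertex.splits)
  have ein: "?e v \<in> Inl ` Up ` A \<union> Inr ` Dn ` C \<longleftrightarrow> v \<in> Up ` A \<union> Dn ` C" for v
    by (auto split: vertex.splits)
  have ed: "?e (?d w) = w" if "w \<in> Inl ` Up ` A \<union> Inr ` Dn ` C" for w using that by auto
  have k': "matching (Inl ` Up ` A \<union> Inr ` Dn ` C) k" using k Zeq by simp
  have kin: "?e (?k v) = k (?e v)" for v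
  proof (cases "v \<in> Up ` A \<union> Dn ` C")
    case True
    then have "k (?e v) \<in> Inl ` Up ` A \<union> Inr ` Dn ` C"
      unfolding matching_in_iff[OF k'] ein .
    then show ?thesis by (rule ed)
  next
    case False
    then have "k (?e v) = ?e v" unfolding matching_fix_iff[OF k'] ein .
    then show ?thesis using de by simp
  qed
  have km: "matching (Up ` A \<union> Dn ` C) ?k"
  proof (rule matchingI)
    fix v
    show "?k (?k v) = v" using kin de k' by simp
    show "v \<in> Up ` A \<union> Dn ` C \<Longrightarrow> ?k v \<noteq> v"
      by (metis (no_types, lifting) kin ein k' matching_fix_iff)
    show "v \<notin> Up ` A \<union> Dn ` C \<Longrightarrow> ?k v = v"
      by (metis (no_types, lifting) de ein k' matching_fix_iff)
  qed
  have "(R OO Q) s r \<longleftrightarrow> agrees ?k (lab s r)" for s r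
  proof -
    let ?S = "\<lambda>w. lab s r (?d w)"
    have "agrees ?k (lab s r) \<longleftrightarrow> agrees k ?S"
    proof
      assume c: "agrees ?k (lab s r)"
      show "agrees k ?S"
      proof (rule agrees_matchingI[OF k'])
        fix w assume "w \<in> Inl ` Up ` A \<union> Inr ` Dn ` C"
        from ed[OF this] show "?S (k w) = ?S w" using agreesD[OF c, of "?d w"] by simp
      qed
    next
      assume c: "agrees k ?S"
      then show "agrees ?k (lab s r)" unfolding agrees_def by (metis de)
    qed
    also have "\<dots> \<longleftrightarrow> (R OO Q) s r"
    proof
      assume "agrees k ?S"
      then obtain t where t: "\<And>x. x \<notin> ?P ` B \<union> ?Q ` B \<Longrightarrow> t x = ?S x"
        "\<And>i. i \<in> B \<Longrightarrow> t (?P i) = t (?Q i)" "agrees ?m t" unfolding ck by blast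
      have tU: "t (Inl (Up i)) = s i" and tD: "t (Inr (Dn i)) = r i" for i
        using t(1)[of "Inl (Up i)"] t(1)[of "Inr (Dn i)"] by auto
      define u where "u i = t (?P i)" for i
      have "agrees m (lab s u)"
      proof (rule agrees_matchingI[OF m])
        have *: "lab s u x = t (Inl x)" if "x \<in> Up ` A \<union> Dn ` B" for x
          using that by (elim UnE imageE) (simp_all add: u_def tU)
        fix x assume x: "x \<in> Up ` A \<union> Dn ` B"
        then have "m x \<in> Up ` A \<union> Dn ` B" unfolding matching_in_iff[OF m] .
        from *[OF this] *[OF x] show "lab s u (m x) = lab s u x"
          using agreesD[OF t(3), of "Inl x"] by (simp only: map_sum.simps)
      qed
      moreover have "agrees m' (lab u r)"
      proof (rule agrees_matchingI[OF m'])
        have *: "lab u r x = t (Inr x)" if "x \<in> Up ` B \<union> Dn ` C" for x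
          using that by (elim UnE imageE) (simp_all add: u_def tD t(2))
        fix x assume x: "x \<in> Up ` B \<union> Dn ` C"
        then have "m' x \<in> Up ` B \<union> Dn ` C" unfolding matching_in_iff[OF m'] .
        from *[OF this] *[OF x] show "lab u r (m' x) = lab u r x"
          using agreesD[OF t(3), of "Inr x"] by (simp only: map_sum.simps)
      qed
      ultimately show "(R OO Q) s r" using R Q by blast
    next
      assume "(R OO Q) s r"
      then obtain u where u: "agrees m (lab s u)" "agrees m' (lab u r)" using R Q by blast
      let ?t = "\<lambda>w. if w \<in> ?Z then case w of Inl v \<Rightarrow> lab s u v | Inr v \<Rightarrow> lab u r v else ?S w"
      have "agrees ?m ?t"
      proof (rule agrees_matchingI[OF mm])
        fix w assume w: "w \<in> ?Z"
        then have "?m w \<in> ?Z" unfolding matching_in_iff[OF mm] .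
        with w have "?t (?m w) = (case ?m w of Inl v \<Rightarrow> lab s u v | Inr v \<Rightarrow> lab u r v)"
          "?t w = (case w of Inl v \<Rightarrow> lab s u v | Inr v \<Rightarrow> lab u r v)" by auto
        then show "?t (?m w) = ?t w"
          using agreesD[OF u(1)] agreesD[OF u(2)] by (cases w) auto
      qed
      moreover have "\<forall>x. x \<notin> ?P ` B \<union> ?Q ` B \<longrightarrow> ?t x = ?S x" by auto
      moreover have "\<forall>i\<in>B. ?t (?P i) = ?t (?Q i)" by auto
      ultimately show "agrees k ?S" unfolding ck by (intro exI[of _ ?t] conjI)
    qed
    finally show ?thesis by simp
  qed
  with km show ?thesis unfolding brauer_rel_def by blast
qed

text \<open>From \<open>matching_eq_of_agrees\<close>. An arbitrary labeling of vertices is first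
  brought into the form \<open>lab\<close>, which changes it at \<open>Mid\<close> points
  only.\<close>

lemma brauer_rel_eq:
  assumes "brauer_rel A B R" "brauer_rel A B Q" "\<And>s r. R s r \<Longrightarrow> Q s r"
  shows "R = Q"
proof -
  obtain m where m: "matching (Up ` A \<union> Dn ` B) m" and R: "\<And>s r. R s r \<longleftrightarrow> agrees m (lab s r)"
    using assms by (auto simp: brauer_rel_def)
  obtain m' where m': "matching (Up ` A \<union> Dn ` B) m'" and Q: "\<And>s r. Q s r \<longleftrightarrow> agrees m' (lab s r)"
    using assms by (auto simp: brauer_rel_def)
  have *: "agrees k L \<longleftrightarrow> agrees k (lab (\<lambda>i. L (Up i)) (\<lambda>i. L (Dn i)))"
    if "matching (Up ` A \<union> Dn ` B) k" for k L
    by (rule agrees_cong[OF that]) auto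
  have "m = m'"
  proof (rule matching_eq_of_agrees[OF m m'])
    fix L assume "agrees m L"
    then show "agrees m' L" using assms(3) R Q *[OF m] *[OF m'] by metis
  qed
  then show ?thesis using R Q by (intro ext) simp
qed

lemma brauer_rel_cong:
  assumes "brauer_rel A B R" "\<And>x. x \<in> A \<Longrightarrow> s x = s' x" "\<And>x. x \<in> B \<Longrightarrow> r x = r' x"
  shows "R s r = R s' r'"
proof -
  obtain m where m: "matching (Up ` A \<union> Dn ` B) m" and R: "\<And>s r. R s r \<longleftrightarrow> agrees m (lab s r)"
    using assms by (auto simp: brauer_rel_def)
  show ?thesis unfolding R by (rule agrees_cong[OF m]) (use assms in auto)
qed

text \<open>With an empty upper row only lower pairs are left. Composing such a relation with a
  diagram gives the right action of diagrams on perfect matchings.\<close>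

lemma brauer_rel_source_empty: 
  "brauer_rel {} B (\<lambda>s r. P r) \<longleftrightarrow> (\<exists>u. matching B u \<and> (\<forall>r. P r \<longleftrightarrow> agrees u r))"
proof
  assume "brauer_rel {} B (\<lambda>s r. P r)"
  then obtain m where m: "matching (Dn ` B) m" and P: "\<And>s r. P r \<longleftrightarrow> agrees m (lab s r)"
    by (auto simp: brauer_rel_def)
  define u where "u x = (THE y. m (Dn x) = Dn y)" for x
  have u: "m (Dn x) = Dn (u x)" for x
  proof -
    have "\<exists>y. m (Dn x) = Dn y" using matching_in_iff[OF m, of "Dn x"] matching_fix_iff[OF m, of "Dn x"]
      by (cases "x \<in> B") (auto simp: image_iff)
    then show ?thesis unfolding u_def by (metis (mono_tags, lifting) the_equality vertex.inject(2))
  qed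
  have "matching B u"
  proof (rule matchingI)
    fix x
    have "Dn (u (u x)) = Dn x" using m by (simp flip: u)
    then show "u (u x) = x" by simp
    have "Dn (u x) = Dn x \<longleftrightarrow> x \<notin> B" using matching_fix_iff[OF m, of "Dn x"] by (auto simp flip: u)
    then show "x \<in> B \<Longrightarrow> u x \<noteq> x" "x \<notin> B \<Longrightarrow> u x = x" by auto
  qed
  moreover have "P r \<longleftrightarrow> agrees u r" for r
  proof -
    have "agrees m (lab r r) \<longleftrightarrow> agrees u r"
    proof
      assume "agrees m (lab r r)"
      then show "agrees u r" unfolding agrees_def by (metis u lab_simps(2))
    next
      assume "agrees u r"
      then show "agrees m (lab r r)"
        by (intro agrees_matchingI[OF m]) (auto simp: u agrees_def)
    qed
    then show ?thesis using P by simp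
  qed
  ultimately show "\<exists>u. matching B u \<and> (\<forall>r. P r \<longleftrightarrow> agrees u r)" by blast
next
  assume "\<exists>u. matching B u \<and> (\<forall>r. P r \<longleftrightarrow> agrees u r)"
  then obtain u where u: "matching B u" and P: "\<And>r. P r \<longleftrightarrow> agrees u r" by blast
  define m where "m v = (case v of Dn i \<Rightarrow> Dn (u i) | _ \<Rightarrow> v)" for v
  have m: "matching (Dn ` B) m"
  proof (rule matchingI)
    fix v
    show "m (m v) = v" "v \<in> Dn ` B \<Longrightarrow> m v \<noteq> v" "v \<notin> Dn ` B \<Longrightarrow> m v = v"
      using u by (auto simp: m_def matching_def split: vertex.splits)
  qed
  have "agrees m (lab s r) \<longleftrightarrow> agrees u r" for s r
  proof -
    have "agrees m (lab s r) \<longleftrightarrow> (\<forall>i. lab s r (m (Dn i)) = lab s r (Dn i))"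
      unfolding agrees_def m_def by (metis (no_types, lifting) vertex.exhaust vertex.simps(10,11,12))
    then show ?thesis by (simp add: m_def agrees_def)
  qed
  with m P show "brauer_rel {} B (\<lambda>s r. P r)" unfolding brauer_rel_def by auto
qed

lemma brauer_rel_converse: "brauer_rel A B R \<Longrightarrow> brauer_rel B A (R\<inverse>\<inverse>)"
proof -
  assume "brauer_rel A B R"
  then obtain m where m: "matching (Up ` A \<union> Dn ` B) m" and R: "\<And>s r. R s r \<longleftrightarrow> agrees m (lab s r)"
    by (auto simp: brauer_rel_def)
  define f where "f v = (case v of Up i \<Rightarrow> Dn i | Dn i \<Rightarrow> Up i | Mid i \<Rightarrow> Mid i)" for v
  have ff: "f (f v) = v" for v by (auto simp: f_def split: vertex.splits)
  have fin: "f v \<in> Up ` A \<union> Dn ` B \<longleftrightarrow> v \<in> Up ` B \<union> Dn ` A" for v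
    by (auto simp: f_def split: vertex.splits)
  have lf: "lab s r (f v) = lab r s v" for s r v by (auto simp: f_def split: vertex.splits)
  have "matching (Up ` B \<union> Dn ` A) (\<lambda>v. f (m (f v)))"
  proof (rule matchingI)
    fix v
    show "f (m (f (f (m (f v))))) = v" using ff m by simp
    show "v \<in> Up ` B \<union> Dn ` A \<Longrightarrow> f (m (f v)) \<noteq> v" by (metis ff fin m matching_fix_iff)
    show "v \<notin> Up ` B \<union> Dn ` A \<Longrightarrow> f (m (f v)) = v" by (metis ff fin m matching_fix_iff)
  qed
  moreover have "R\<inverse>\<inverse> s r \<longleftrightarrow> agrees (\<lambda>v. f (m (f v))) (lab s r)" for s r
    unfolding conversep_iff R agrees_def lf by (metis ff lf)
  ultimately show ?thesis unfolding brauer_rel_def by blast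
qed

section \<open>The relation of a diagram, and products as compositions\<close>

definition diagram_rel :: "diagram \<Rightarrow> (nat \<Rightarrow> bool) \<Rightarrow> (nat \<Rightarrow> bool) \<Rightarrow> bool" where
  "diagram_rel \<alpha> s r \<longleftrightarrow> (\<forall>A\<in>\<alpha>. \<forall>x\<in>A. \<forall>y\<in>A. lab s r x = lab s r y)"

text \<open>The hypothesis makes \<open>X \<times> X\<close> a member of the intersected family; the
  intersection of an empty family would be \<open>UNIV\<close>.\<close>

lemma equiv_generated_equiv:
  assumes "r \<subseteq> X \<times> X"
  shows "equiv X (generated_equiv X r)"
proof -
  have X: "equiv X (X \<times> X)"
    by (auto simp: equiv_def refl_on_def sym_def trans_def)
  show ?thesis unfolding generated_equiv_def
  proof (rule equivI)
    show "\<Inter> {s. equiv X s \<and> r \<subseteq> s} \<subseteq> X \<times> X" using X assms by blast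
    show "refl_on X (\<Inter> {s. equiv X s \<and> r \<subseteq> s})"
      by (auto simp: equiv_def refl_on_def)
    show "sym (\<Inter> {s. equiv X s \<and> r \<subseteq> s})"
      by (auto simp: equiv_def sym_def)
    show "trans (\<Inter> {s. equiv X s \<and> r \<subseteq> s})"
      unfolding trans_def equiv_def by blast
  qed
qed

lemma generated_equiv_incl: "r \<subseteq> generated_equiv X r"
  by (auto simp: generated_equiv_def)

lemma generated_equiv_least: "equiv X s \<Longrightarrow> r \<subseteq> s \<Longrightarrow> generated_equiv X r \<subseteq> s"
  by (auto simp: generated_equiv_def)

lemma same_block_image: "same_block ((\<lambda>A. f ` A) ` \<alpha>) = (\<lambda>(x, y). (f x, f y)) ` same_block \<alpha>"
  unfolding same_block_def by force

lemma equiv_diagram_equiv: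
  assumes "partition_on (verts n) \<alpha>" "partition_on (verts n) \<beta>"
  shows "equiv (verts n \<union> Mid ` {1..n}) (diagram_equiv n \<alpha> \<beta>)"
proof -
  have "same_block \<alpha> \<subseteq> verts n \<times> verts n" "same_block \<beta> \<subseteq> verts n \<times> verts n"
    using assms by (auto simp: same_block_def partition_on_def)
  moreover have "(case v of Dn i \<Rightarrow> Mid i | _ \<Rightarrow> v) \<in> verts n \<union> Mid ` {1..n}"
    "(case v of Up i \<Rightarrow> Mid i | _ \<Rightarrow> v) \<in> verts n \<union> Mid ` {1..n}" if "v \<in> verts n" for v
    using that by (auto simp: verts_def)
  moreover have "(\<lambda>(x, y). (f x, f y)) ` S \<subseteq> X \<times> X"
    if "S \<subseteq> Y \<times> Y" "\<And>v. v \<in> Y \<Longrightarrow> f v \<in> X" for f :: "vertex \<Rightarrow> vertex" and S X Y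
    using that by auto
  ultimately show ?thesis
    unfolding diagram_equiv_def rename_lower_def rename_upper_def same_block_image
    by (intro equiv_generated_equiv Un_least) simp_all
qed

lemma partition_on_diagram_mult:
  assumes "partition_on (verts n) \<alpha>" "partition_on (verts n) \<beta>"
  shows "partition_on (verts n) (diagram_mult n \<alpha> \<beta>)"
proof -
  have E: "equiv (verts n \<union> Mid ` {1..n}) (diagram_equiv n \<alpha> \<beta>)"
    by (rule equiv_diagram_equiv[OF assms])
  have "equiv (verts n) (Restr (diagram_equiv n \<alpha> \<beta>) (verts n))"
  proof (rule equivI)
    show "refl_on (verts n) (Restr (diagram_equiv n \<alpha> \<beta>) (verts n))"
      using E by (auto simp: equiv_def refl_on_def)
    show "sym (Restr (diagram_equiv n \<alpha> \<beta>) (verts n))"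
      using E unfolding equiv_def sym_def by blast
    show "trans (Restr (diagram_equiv n \<alpha> \<beta>) (verts n))"
      using E unfolding equiv_def by (intro trans_Restr) blast
  qed auto
  then show ?thesis unfolding diagram_mult_def by (rule partition_on_quotient)
qed

text \<open>A labeling of the outer rows is constant on the blocks of the product iff it extends to
  all three rows with constant value on the classes of the generated equivalence. The middle row of
  the extension is the intermediate labeling of the composition.\<close>

lemma diagram_rel_mult:
  assumes \<alpha>: "partition_on (verts n) \<alpha>" and \<beta>: "partition_on (verts n) \<beta>"
  shows "diagram_rel (diagram_mult n \<alpha> \<beta>) = diagram_rel \<alpha> OO diagram_rel \<beta>"
proof (intro ext)
  fix s r
  let ?X = "verts n \<union> Mid ` {1..n}"
  let ?E = "diagram_equiv n \<alpha> \<beta>"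
  let ?f = "\<lambda>v. case v of Dn i \<Rightarrow> Mid i | _ \<Rightarrow> v"
  let ?g = "\<lambda>v. case v of Up i \<Rightarrow> Mid i | _ \<Rightarrow> v"
  have E: "equiv ?X ?E" by (rule equiv_diagram_equiv[OF assms])
  have gen: "same_block (rename_lower \<alpha>) \<union> same_block (rename_upper \<beta>) \<subseteq> ?E"
    unfolding diagram_equiv_def by (rule generated_equiv_incl)
  have gen1: "(?f x, ?f y) \<in> ?E" if "A \<in> \<alpha>" "x \<in> A" "y \<in> A" for A x y
  proof -
    have "(x, y) \<in> same_block \<alpha>" using that by (auto simp: same_block_def)
    then have "(?f x, ?f y) \<in> same_block (rename_lower \<alpha>)"
      unfolding rename_lower_def same_block_image by force
    then show ?thesis using gen by blast
  qed
  have gen2: "(?g x, ?g y) \<in> ?E" if "A \<in> \<beta>" "x \<in> A" "y \<in> A" for A x y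
  proof -
    have "(x, y) \<in> same_block \<beta>" using that by (auto simp: same_block_def)
    then have "(?g x, ?g y) \<in> same_block (rename_upper \<beta>)"
      unfolding rename_upper_def same_block_image by force
    then show ?thesis using gen by blast
  qed
  have sub: "A \<subseteq> verts n" if "A \<in> \<alpha> \<or> A \<in> \<beta>" for A
    using that assms by (auto simp: partition_on_def)
  have "diagram_rel (diagram_mult n \<alpha> \<beta>) s r \<longleftrightarrow>
      (\<forall>x y. (x, y) \<in> ?E \<longrightarrow> x \<in> verts n \<longrightarrow> y \<in> verts n \<longrightarrow> lab s r x = lab s r y)"
  proof
    assume d: "diagram_rel (diagram_mult n \<alpha> \<beta>) s r"
    show "\<forall>x y. (x, y) \<in> ?E \<longrightarrow> x \<in> verts n \<longrightarrow> y \<in> verts n \<longrightarrow> lab s r x = lab s r y"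
    proof (intro allI impI)
      fix x y assume xy: "(x, y) \<in> ?E" "x \<in> verts n" "y \<in> verts n"
      then have "(x, x) \<in> ?E" using E by (auto simp: equiv_def refl_on_def)
      then have "Restr ?E (verts n) `` {x} \<in> diagram_mult n \<alpha> \<beta>"
        "x \<in> Restr ?E (verts n) `` {x}" "y \<in> Restr ?E (verts n) `` {x}"
        unfolding diagram_mult_def using xy by (auto intro: quotientI)
      then obtain A where "A \<in> diagram_mult n \<alpha> \<beta>" "x \<in> A" "y \<in> A" ..
      then show "lab s r x = lab s r y" using d unfolding diagram_rel_def by blast
    qed
  next
    assume d: "\<forall>x y. (x, y) \<in> ?E \<longrightarrow> x \<in> verts n \<longrightarrow> y \<in> verts n \<longrightarrow> lab s r x = lab s r y"
    show "diagram_rel (diagram_mult n \<alpha> \<beta>) s r"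
      unfolding diagram_rel_def diagram_mult_def
    proof (intro ballI)
      fix A x y assume "A \<in> verts n // Restr ?E (verts n)" "x \<in> A" "y \<in> A"
      then obtain z where "z \<in> verts n" "(z, x) \<in> ?E" "(z, y) \<in> ?E" "x \<in> verts n" "y \<in> verts n"
        by (auto elim!: quotientE)
      then show "lab s r x = lab s r y" using d by metis
    qed
  qed
  also have "\<dots> \<longleftrightarrow> (diagram_rel \<alpha> OO diagram_rel \<beta>) s r"
  proof
    assume d: "\<forall>x y. (x, y) \<in> ?E \<longrightarrow> x \<in> verts n \<longrightarrow> y \<in> verts n \<longrightarrow> lab s r x = lab s r y"
    \<comment> \<open>The extension: a class gets the common label of its outer vertices, and False
      if it lies entirely in the middle row.\<close>
    define L where "L v = (\<exists>w\<in>verts n. (w, v) \<in> ?E \<and> lab s r w)" for v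
    define t where "t i = L (Mid i)" for i
    have Lv: "L v = lab s r v" if "v \<in> verts n" for v
    proof -
      have "(v, v) \<in> ?E" using that E by (auto simp: equiv_def refl_on_def)
      then show ?thesis using d that unfolding L_def by blast
    qed
    have LE: "L v = L w" if "(v, w) \<in> ?E" for v w
      using that E unfolding L_def equiv_def by (meson symE transE)
    have "diagram_rel \<alpha> s t" unfolding diagram_rel_def
    proof (intro ballI)
      fix A x y assume A: "A \<in> \<alpha>" "x \<in> A" "y \<in> A"
      have "lab s t z = L (?f z)" if "z \<in> A" for z
        using Lv[of z] that A sub[of A] by (auto simp: t_def verts_def)
      then show "lab s t x = lab s t y" using A LE[OF gen1[OF A]] by metis
    qed
    moreover have "diagram_rel \<beta> t r" unfolding diagram_rel_def
    proof (intro ballI)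
      fix A x y assume A: "A \<in> \<beta>" "x \<in> A" "y \<in> A"
      have "lab t r z = L (?g z)" if "z \<in> A" for z
        using Lv[of z] that A sub[of A] by (auto simp: t_def verts_def)
      then show "lab t r x = lab t r y" using A LE[OF gen2[OF A]] by metis
    qed
    ultimately show "(diagram_rel \<alpha> OO diagram_rel \<beta>) s r" by blast
  next
    assume "(diagram_rel \<alpha> OO diagram_rel \<beta>) s r"
    then obtain t where t: "diagram_rel \<alpha> s t" "diagram_rel \<beta> t r" by blast
    define L where "L v = (case v of Up i \<Rightarrow> s i | Mid i \<Rightarrow> t i | Dn i \<Rightarrow> r i)" for v
    \<comment> \<open>The kernel of the joint labeling \<open>L\<close> is an equivalence that
      contains the generating pairs, hence the generated equivalence.\<close>
    let ?K = "{(x, y). x \<in> ?X \<and> y \<in> ?X \<and> L x = L y}"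
    have "?E \<subseteq> ?K"
      unfolding diagram_equiv_def
    proof (rule generated_equiv_least)
      show "equiv ?X ?K" by (rule equivI) (auto simp: refl_on_def sym_def trans_def)
      have fL: "L (?f x) = lab s t x" "L (?g x) = lab t r x" "?f x \<in> ?X" "?g x \<in> ?X"
        if "x \<in> verts n" for x
        using that by (auto simp: L_def verts_def)
      have "(?f x, ?f y) \<in> ?K" if xy: "(x, y) \<in> same_block \<alpha>" for x y
      proof -
        obtain A where A: "A \<in> \<alpha>" "x \<in> A" "y \<in> A" using xy by (auto simp: same_block_def)
        then have "x \<in> verts n" "y \<in> verts n" using sub by blast+
        moreover have "lab s t x = lab s t y" using t(1) A unfolding diagram_rel_def by blast
        ultimately show ?thesis using fL by simp
      qed
      moreover have "(?g x, ?g y) \<in> ?K" if xy: "(x, y) \<in> same_block \<beta>" for x y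
      proof -
        obtain A where A: "A \<in> \<beta>" "x \<in> A" "y \<in> A" using xy by (auto simp: same_block_def)
        then have "x \<in> verts n" "y \<in> verts n" using sub by blast+
        moreover have "lab t r x = lab t r y" using t(2) A unfolding diagram_rel_def by blast
        ultimately show ?thesis using fL by simp
      qed
      ultimately show "same_block (rename_lower \<alpha>) \<union> same_block (rename_upper \<beta>) \<subseteq> ?K"
        unfolding rename_lower_def rename_upper_def same_block_image
        by (intro Un_least subrelI; elim imageE) (simp_all only: split_paired_all prod.case prod.inject)
    qed
    moreover have "lab s r x = L x" if "x \<in> verts n" for x
      using that by (auto simp: L_def verts_def)
    ultimately show "\<forall>x y. (x, y) \<in> ?E \<longrightarrow> x \<in> verts n \<longrightarrow> y \<in> verts n \<longrightarrow> lab s r x = lab s r y"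
      by blast
  qed
  finally show "diagram_rel (diagram_mult n \<alpha> \<beta>) s r = (diagram_rel \<alpha> OO diagram_rel \<beta>) s r" .
qed

text \<open>Indicators of blocks recover a diagram from its relation. This is done for all
  partitions, because a product of Brauer diagrams is at first only known to be a partition.\<close>

lemma diagram_rel_indicator:
  assumes "partition_on (verts n) \<alpha>" "A \<in> \<alpha>"
  shows "diagram_rel \<alpha> (\<lambda>i. Up i \<in> A) (\<lambda>i. Dn i \<in> A)"
    and "x \<in> verts n \<Longrightarrow> lab (\<lambda>i. Up i \<in> A) (\<lambda>i. Dn i \<in> A) x \<longleftrightarrow> x \<in> A"
proof -
  show *: "lab (\<lambda>i. Up i \<in> A) (\<lambda>i. Dn i \<in> A) x \<longleftrightarrow> x \<in> A" if "x \<in> verts n" for x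
    using that by (auto simp: verts_def)
  show "diagram_rel \<alpha> (\<lambda>i. Up i \<in> A) (\<lambda>i. Dn i \<in> A)"
    unfolding diagram_rel_def
  proof (intro ballI)
    fix B x y assume "B \<in> \<alpha>" "x \<in> B" "y \<in> B"
    moreover from this have "x \<in> verts n" "y \<in> verts n" using assms by (auto simp: partition_on_def)
    moreover have "x \<in> A \<longleftrightarrow> y \<in> A" using calculation assms unfolding partition_on_def disjoint_def by blast
    ultimately show "lab (\<lambda>i. Up i \<in> A) (\<lambda>i. Dn i \<in> A) x = lab (\<lambda>i. Up i \<in> A) (\<lambda>i. Dn i \<in> A) y"
      using * by simp
  qed
qed

lemma diagram_rel_refines:
  assumes \<alpha>: "partition_on (verts n) \<alpha>" and \<beta>: "partition_on (verts n) \<beta>"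
    and eq: "diagram_rel \<alpha> = diagram_rel \<beta>" and A: "A \<in> \<alpha>" and B: "B \<in> \<beta>" "x \<in> A" "x \<in> B"
  shows "B \<subseteq> A"
proof
  fix y assume "y \<in> B"
  moreover have "x \<in> verts n" "y \<in> verts n" using assms \<open>y \<in> B\<close> by (auto simp: partition_on_def)
  ultimately show "y \<in> A"
    using diagram_rel_indicator[OF \<alpha> A] B unfolding eq diagram_rel_def by blast
qed

lemma diagram_rel_inj:
  assumes \<alpha>: "partition_on (verts n) \<alpha>" and \<beta>: "partition_on (verts n) \<beta>"
    and eq: "diagram_rel \<alpha> = diagram_rel \<beta>"
  shows "\<alpha> = \<beta>"
proof -
  have "\<alpha> \<subseteq> \<beta>" if \<alpha>: "partition_on (verts n) \<alpha>" and \<beta>: "partition_on (verts n) \<beta>"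
    and eq: "diagram_rel \<alpha> = diagram_rel \<beta>" for \<alpha> \<beta>
  proof
    fix A assume A: "A \<in> \<alpha>"
    then have "A \<noteq> {}" using \<alpha> by (auto simp: partition_on_def)
    then obtain x where x: "x \<in> A" by blast
    then have "x \<in> verts n" using A \<alpha> by (auto simp: partition_on_def)
    then obtain B where B: "B \<in> \<beta>" "x \<in> B" using \<beta> by (auto simp: partition_on_def)
    have "B \<subseteq> A" by (rule diagram_rel_refines[OF \<alpha> \<beta> eq A B(1) x B(2)])
    moreover have "A \<subseteq> B" by (rule diagram_rel_refines[OF \<beta> \<alpha> eq[symmetric] B(1) A B(2) x])
    ultimately show "A \<in> \<beta>" using B by simp
  qed
  from this[OF \<alpha> \<beta> eq] this[OF \<beta> \<alpha> eq[symmetric]] show ?thesis by simp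
qed

section \<open>Brauer diagrams as perfect matchings of the vertices\<close>

abbreviation brauer_elements :: "nat \<Rightarrow> diagram set" where
  "brauer_elements n \<equiv> carrier (brauer_monoid n)"

lemma brauer_elements_iff:
  "\<alpha> \<in> brauer_elements n \<longleftrightarrow> partition_on (verts n) \<alpha> \<and> (\<forall>A\<in>\<alpha>. card A = 2)"
  by (simp add: brauer_monoid_def partition_monoid_def)

lemma mult_brauer_monoid [simp]: "\<alpha> \<otimes>\<^bsub>brauer_monoid n\<^esub> \<beta> = diagram_mult n \<alpha> \<beta>"
  by (simp add: brauer_monoid_def partition_monoid_def)

definition matching_diagram :: "nat \<Rightarrow> (vertex \<Rightarrow> vertex) \<Rightarrow> diagram" where
  "matching_diagram n m = (\<lambda>v. {v, m v}) ` verts n"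

lemma matching_diagram_in:
  assumes m: "matching (verts n) m"
  shows "matching_diagram n m \<in> brauer_elements n"
    and "diagram_rel (matching_diagram n m) s r \<longleftrightarrow> agrees m (lab s r)"
proof -
  have "partition_on (verts n) (matching_diagram n m)"
    unfolding matching_diagram_def
  proof (rule partition_onI)
    show "(\<Union>v\<in>verts n. {v, m v}) = verts n" using matching_in_iff[OF m] by auto
    fix A B assume "A \<in> (\<lambda>v. {v, m v}) ` verts n" "B \<in> (\<lambda>v. {v, m v}) ` verts n" "A \<noteq> B"
    then obtain v w where vw: "A = {v, m v}" "B = {w, m w}" "{v, m v} \<noteq> {w, m w}" by auto
    then have "w \<noteq> v" "w \<noteq> m v" using matching_inv[OF m] by auto
    moreover from this have "m w \<noteq> v" "m w \<noteq> m v" using matching_inv[OF m] by metis+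
    ultimately show "disjnt A B" by (auto simp: disjnt_def vw)
  qed auto
  moreover have "card {v, m v} = 2" if "v \<in> verts n" for v
    using that m by (metis card_2_iff matching_fix_iff)
  ultimately show "matching_diagram n m \<in> brauer_elements n"
    unfolding brauer_elements_iff matching_diagram_def by auto
  show "diagram_rel (matching_diagram n m) s r \<longleftrightarrow> agrees m (lab s r)"
    using agrees_matchingI[OF m, of "lab s r"] agreesD[of m "lab s r"]
    unfolding diagram_rel_def matching_diagram_def by auto
qed

lemma brauer_element_matching:
  assumes "\<alpha> \<in> brauer_elements n"
  obtains m where "matching (verts n) m" "\<alpha> = matching_diagram n m"
proof -
  have \<alpha>: "partition_on (verts n) \<alpha>" and c: "\<And>A. A \<in> \<alpha> \<Longrightarrow> card A = 2"
    using assms by (auto simp: brauer_elements_iff)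
  have "\<exists>!w. w \<noteq> v \<and> {v, w} \<in> \<alpha>" if v: "v \<in> verts n" for v
  proof -
    obtain A where A: "A \<in> \<alpha>" "v \<in> A" using v \<alpha> by (auto simp: partition_on_def)
    obtain w where w: "A = {v, w}" "w \<noteq> v" using c[OF A(1)] A(2) by (auto simp: card_2_iff)
    show ?thesis
    proof (rule ex1I[of _ w])
      fix w' assume "w' \<noteq> v \<and> {v, w'} \<in> \<alpha>"
      then have "{v, w'} = A" using A disjointD[OF partition_onD2[OF \<alpha>], of "{v, w'}" A] by blast
      with w \<open>w' \<noteq> v \<and> _\<close> show "w' = w" by auto
    qed (use A w in auto)
  qed
  then obtain f where f: "\<And>v. v \<in> verts n \<Longrightarrow> f v \<noteq> v \<and> {v, f v} \<in> \<alpha>"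
    and fu: "\<And>v w. v \<in> verts n \<Longrightarrow> w \<noteq> v \<Longrightarrow> {v, w} \<in> \<alpha> \<Longrightarrow> w = f v" by metis
  define m where "m v = (if v \<in> verts n then f v else v)" for v
  have sub: "f v \<in> verts n" if "v \<in> verts n" for v
    using f[OF that] \<alpha> by (auto simp: partition_on_def)
  have ff: "f (f v) = v" if "v \<in> verts n" for v
    using fu[OF sub[OF that], of v] f[OF that] by (metis insert_commute)
  have m: "matching (verts n) m"
    using f sub ff by (intro matchingI) (auto simp: m_def)
  have "\<alpha> = matching_diagram n m"
  proof
    show "matching_diagram n m \<subseteq> \<alpha>" using f by (auto simp: matching_diagram_def m_def)
    show "\<alpha> \<subseteq> matching_diagram n m"
    proof
      fix A assume A: "A \<in> \<alpha>"
      obtain v w where vw: "A = {v, w}" "w \<noteq> v" using c[OF A] by (metis card_2_iff)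
      then have v: "v \<in> verts n" using A \<alpha> by (auto simp: partition_on_def)
      then have "w = f v" using fu vw A by blast
      then show "A \<in> matching_diagram n m" using vw v by (auto simp: matching_diagram_def m_def)
    qed
  qed
  with m that show ?thesis by blast
qed

lemma brauer_rel_diagram_rel:
  assumes "\<alpha> \<in> brauer_elements n"
  shows "brauer_rel {1..n} {1..n} (diagram_rel \<alpha>)"
proof -
  obtain m where m: "matching (verts n) m" "\<alpha> = matching_diagram n m"
    using assms by (rule brauer_element_matching)
  then show ?thesis using matching_diagram_in(2)[OF m(1)]
    unfolding brauer_rel_def verts_def by blast
qed

lemma diagram_rel_surj:
  assumes "brauer_rel {1..n} {1..n} R"
  obtains \<alpha> where "\<alpha> \<in> brauer_elements n" "diagram_rel \<alpha> = R"
proof -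
  obtain m where m: "matching (verts n) m" "\<And>s r. R s r \<longleftrightarrow> agrees m (lab s r)"
    using assms by (auto simp: brauer_rel_def verts_def)
  have "diagram_rel (matching_diagram n m) = R"
    by (intro ext) (simp add: m matching_diagram_in(2)[OF m(1)])
  with matching_diagram_in(1)[OF m(1)] that show ?thesis by blast
qed

lemma inj_on_diagram_rel: "inj_on diagram_rel (brauer_elements n)"
  by (intro inj_onI diagram_rel_inj) (auto simp: brauer_elements_iff)

lemma diagram_rel_brauer_mult:
  "\<alpha> \<in> brauer_elements n \<Longrightarrow> \<beta> \<in> brauer_elements n \<Longrightarrow>
    diagram_rel (diagram_mult n \<alpha> \<beta>) = diagram_rel \<alpha> OO diagram_rel \<beta>"
  by (rule diagram_rel_mult) (auto simp: brauer_elements_iff)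

text \<open>The composed relation belongs to some Brauer diagram; the product is a partition with
  the same relation and therefore equals it. Block sizes are never counted.\<close>

lemma diagram_mult_closed:
  assumes "\<alpha> \<in> brauer_elements n" "\<beta> \<in> brauer_elements n"
  shows "diagram_mult n \<alpha> \<beta> \<in> brauer_elements n"
proof -
  have "brauer_rel {1..n} {1..n} (diagram_rel \<alpha> OO diagram_rel \<beta>)"
    by (rule brauer_rel_comp) (use assms brauer_rel_diagram_rel in auto)
  then obtain \<gamma> where \<gamma>: "\<gamma> \<in> brauer_elements n" "diagram_rel \<gamma> = diagram_rel \<alpha> OO diagram_rel \<beta>"
    by (rule diagram_rel_surj)
  have "diagram_mult n \<alpha> \<beta> = \<gamma>"
    by (rule diagram_rel_inj[of n])
      (use assms \<gamma> partition_on_diagram_mult diagram_rel_brauer_mult in \<open>auto simp: brauer_elements_iff\<close>)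
  with \<gamma> show ?thesis by simp
qed

section \<open>Projections and partial matchings\<close>

text \<open>Normal form of a diagram: upper pairs \<open>p\<close>, lower pairs \<open>q\<close>,
  and transversals from \<open>x\<close> to \<open>f x\<close>. The converse is
  \<open>brauer_rel_decompose\<close>.\<close>

lemma brauer_rel_link:
  assumes p: "matching P p" and q: "matching Q q" and sub: "P \<subseteq> A" "Q \<subseteq> B"
    and f: "bij_betw f (A - P) (B - Q)"
  shows "brauer_rel A B (\<lambda>s r. agrees p s \<and> agrees q r \<and> (\<forall>x\<in>A - P. s x = r (f x)))"
proof -
  define g where "g = inv_into (A - P) f"
  have fg: "g (f x) = x" "f x \<in> B - Q" if "x \<in> A - P" for x
    using f that bij_betw_apply[OF f that] by (auto simp: g_def bij_betw_inv_into_left)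
  have gf: "f (g y) = y" "g y \<in> A - P" if "y \<in> B - Q" for y
    using f that bij_betw_apply[OF bij_betw_inv_into[OF f]]
    by (auto simp: g_def bij_betw_inv_into_right)
  define m where "m v = (case v of
      Up x \<Rightarrow> if x \<in> P then Up (p x) else if x \<in> A then Dn (f x) else Up x
    | Dn y \<Rightarrow> if y \<in> Q then Dn (q y) else if y \<in> B then Up (g y) else Dn y
    | Mid x \<Rightarrow> Mid x)" for v
  have m: "matching (Up ` A \<union> Dn ` B) m"
  proof (rule matchingI)
    fix v
    show "m (m v) = v"
      using fg gf p q matching_in_iff[OF p] matching_in_iff[OF q]
      by (cases v) (auto simp: m_def)
    show "v \<in> Up ` A \<union> Dn ` B \<Longrightarrow> m v \<noteq> v"
      using p q by (auto simp: m_def matching_fix_iff split: if_splits)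
    show "v \<notin> Up ` A \<union> Dn ` B \<Longrightarrow> m v = v"
      using sub by (cases v) (auto simp: m_def)
  qed
  have "(agrees p s \<and> agrees q r \<and> (\<forall>x\<in>A - P. s x = r (f x))) \<longleftrightarrow> agrees m (lab s r)" (is "?l \<longleftrightarrow> ?r")
    for s r
  proof
    assume l: ?l
    show ?r
    proof (rule agrees_matchingI[OF m])
      fix v
      show "lab s r (m v) = lab s r v"
      proof (cases v)
        case (Up x)
        then show ?thesis using l by (simp add: m_def agrees_def)
      next
        case (Dn y)
        have "s (g y) = r y" if "y \<in> B" "y \<notin> Q" using l gf[of y] that by auto
        then show ?thesis using l Dn by (simp add: m_def agrees_def)
      qed (simp add: m_def)
    qed
  next
    assume r: ?r
    have "s (p x) = s x" if "x \<in> P" for x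
      using agreesD[OF r, of "Up x"] that by (simp add: m_def)
    then have "agrees p s" by (rule agrees_matchingI[OF p])
    moreover have "r (q x) = r x" if "x \<in> Q" for x
      using agreesD[OF r, of "Dn x"] that by (simp add: m_def)
    then have "agrees q r" by (rule agrees_matchingI[OF q])
    moreover have "s x = r (f x)" if "x \<in> A - P" for x
      using agreesD[OF r, of "Up x"] that by (simp add: m_def)
    ultimately show ?l by blast
  qed
  with m show ?thesis unfolding brauer_rel_def by blast
qed

text \<open>\<open>r\<close> is the number of unmatched points, which are the places of the
  transversals of a projection; the sum avoids truncated subtraction.\<close>

definition partial_matchings :: "nat \<Rightarrow> nat \<Rightarrow> (nat \<Rightarrow> nat) set" where
  "partial_matchings n r = {p. \<exists>P\<subseteq>{1..n}. card P + r = n \<and> matching P p}"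

definition projection_partner :: "nat \<Rightarrow> (nat \<Rightarrow> nat) \<Rightarrow> vertex \<Rightarrow> vertex" where
  "projection_partner n p v = (case v of
      Up x \<Rightarrow> if p x = x \<and> x \<in> {1..n} then Dn x else Up (p x)
    | Dn x \<Rightarrow> if p x = x \<and> x \<in> {1..n} then Up x else Dn (p x)
    | Mid x \<Rightarrow> Mid x)"

lemma matching_projection_partner:
  assumes p: "matching P p" and P: "P \<subseteq> {1..n}"
  shows "matching (verts n) (projection_partner n p)"
proof (rule matchingI)
  fix v
  show "projection_partner n p (projection_partner n p v) = v"
    using p by (cases v) (auto simp: projection_partner_def dest: matching_inv)
  show "v \<in> verts n \<Longrightarrow> projection_partner n p v \<noteq> v"
    by (auto simp: projection_partner_def verts_def split: if_splits)
  show "v \<notin> verts n \<Longrightarrow> projection_partner n p v = v"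
    using P matching_fix_iff[OF p] by (cases v) (auto simp: projection_partner_def verts_def)
qed

lemma diagram_rel_star: "diagram_rel (star \<alpha>) s r \<longleftrightarrow> diagram_rel \<alpha> r s"
proof -
  have "lab s r (case v of Up i \<Rightarrow> Dn i | Dn i \<Rightarrow> Up i | Mid i \<Rightarrow> Mid i) = lab r s v" for v
    by (cases v) auto
  then show ?thesis unfolding diagram_rel_def star_def by simp
qed

lemma partition_on_star:
  assumes "partition_on (verts n) \<alpha>"
  shows "partition_on (verts n) (star \<alpha>)"
proof -
  let ?f = "\<lambda>v. case v of Up i \<Rightarrow> Dn i | Dn i \<Rightarrow> Up i | Mid i \<Rightarrow> Mid i"
  have ff: "?f (?f v) = v" for v by (cases v) auto
  have fv: "?f v \<in> verts n \<longleftrightarrow> v \<in> verts n" for v by (cases v) (auto simp: verts_def)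
  show ?thesis
  proof (rule partition_onI)
    show "\<Union> (star \<alpha>) = verts n"
    proof -
      have "\<Union> (star \<alpha>) = ?f ` (\<Union> \<alpha>)" by (auto simp: star_def)
      also have "\<dots> = ?f ` verts n" using assms by (simp add: partition_on_def)
      also have "\<dots> = verts n" using ff fv by (metis (no_types, lifting) image_iff set_eq_iff)
      finally show ?thesis .
    qed
    show "{} \<notin> star \<alpha>" using assms by (auto simp: star_def partition_on_def)
    fix A B assume "A \<in> star \<alpha>" "B \<in> star \<alpha>" "A \<noteq> B"
    then obtain A' B' where AB: "A' \<in> \<alpha>" "B' \<in> \<alpha>" "A' \<noteq> B'" "A = ?f ` A'" "B = ?f ` B'"
      by (auto simp: star_def)
    then have "A' \<inter> B' = {}" using assms by (auto simp: partition_on_def disjoint_def)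
    moreover have "inj ?f" using ff by (rule inj_on_inverseI)
    ultimately show "disjnt A B" unfolding disjnt_def AB by (simp flip: image_Int)
  qed
qed

lemma projection_diagram:
  assumes p: "matching P p" and P: "P \<subseteq> {1..n}"
  shows "matching_diagram n (projection_partner n p) \<in> brauer_projections n"
    and "rank (matching_diagram n (projection_partner n p)) + card P = n"
    and "diagram_rel (matching_diagram n (projection_partner n p)) s r \<longleftrightarrow>
      agrees p s \<and> agrees p r \<and> (\<forall>x\<in>{1..n} - P. s x = r x)"
proof -
  let ?m = "projection_partner n p"
  let ?\<epsilon> = "matching_diagram n ?m"
  have m: "matching (verts n) ?m" by (rule matching_projection_partner[OF p P])
  have \<epsilon>: "?\<epsilon> \<in> brauer_elements n" by (rule matching_diagram_in(1)[OF m])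
  then have part: "partition_on (verts n) ?\<epsilon>" by (simp add: brauer_elements_iff)
  show rel: "diagram_rel ?\<epsilon> s r \<longleftrightarrow> agrees p s \<and> agrees p r \<and> (\<forall>x\<in>{1..n} - P. s x = r x)" for s r
    unfolding matching_diagram_in(2)[OF m]
  proof
    assume a: "agrees ?m (lab s r)"
    have "s (p x) = s x" "r (p x) = r x" if "x \<in> P" for x
      using agreesD[OF a, of "Up x"] agreesD[OF a, of "Dn x"] matching_fix_iff[OF p] that
      by (simp_all add: projection_partner_def)
    then have "agrees p s" "agrees p r" by (auto intro: agrees_matchingI[OF p])
    moreover have "s x = r x" if "x \<in> {1..n} - P" for x
      using agreesD[OF a, of "Up x"] that matching_fix_iff[OF p, of x] by (simp add: projection_partner_def)
    ultimately show "agrees p s \<and> agrees p r \<and> (\<forall>x\<in>{1..n} - P. s x = r x)" by blast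
  next
    assume a: "agrees p s \<and> agrees p r \<and> (\<forall>x\<in>{1..n} - P. s x = r x)"
    then show "agrees ?m (lab s r)"
      using matching_fix_iff[OF p]
      by (intro agrees_matchingI[OF m]) (auto simp: projection_partner_def verts_def agrees_def split: if_splits)
  qed
  have "diagram_rel ?\<epsilon> OO diagram_rel ?\<epsilon> = diagram_rel ?\<epsilon>"
    by (auto simp: fun_eq_iff rel relcompp_apply)
  then have "diagram_mult n ?\<epsilon> ?\<epsilon> = ?\<epsilon>"
    using diagram_rel_brauer_mult[OF \<epsilon> \<epsilon>] diagram_rel_inj[OF partition_on_diagram_mult[OF part part] part]
    by simp
  moreover have "star ?\<epsilon> = ?\<epsilon>"
    by (rule diagram_rel_inj[OF partition_on_star[OF part] part])
      (auto simp: fun_eq_iff diagram_rel_star rel)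
  ultimately show "?\<epsilon> \<in> brauer_projections n"
    using \<epsilon> by (simp add: brauer_projections_def)
  have "transversals ?\<epsilon> = (\<lambda>x. {Up x, Dn x}) ` ({1..n} - P)"
  proof
    show "transversals ?\<epsilon> \<subseteq> (\<lambda>x. {Up x, Dn x}) ` ({1..n} - P)"
      using matching_fix_iff[OF p]
      by (auto simp: transversals_def matching_diagram_def projection_partner_def verts_def split: if_splits)
    show "(\<lambda>x. {Up x, Dn x}) ` ({1..n} - P) \<subseteq> transversals ?\<epsilon>"
    proof
      fix A assume "A \<in> (\<lambda>x. {Up x, Dn x}) ` ({1..n} - P)"
      then obtain x where x: "x \<in> {1..n}" "x \<notin> P" "A = {Up x, Dn x}" by auto
      then have "A = {Up x, ?m (Up x)}" using matching_fix_iff[OF p, of x] by (simp add: projection_partner_def)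
      moreover have "Up x \<in> verts n" using x by (simp add: verts_def)
      ultimately have "A \<in> ?\<epsilon>" unfolding matching_diagram_def by blast
      then show "A \<in> transversals ?\<epsilon>" using x by (auto simp: transversals_def)
    qed
  qed
  moreover have "inj_on (\<lambda>x. {Up x, Dn x}) ({1..n} - P)" by (auto simp: inj_on_def doubleton_eq_iff)
  ultimately have "rank ?\<epsilon> = card ({1..n} - P)" by (simp add: rank_def card_image)
  also have "\<dots> + card P = n" using P
    by (metis add_diff_inverse_nat add.commute card_Diff_subset card_atLeastAtMost card_mono diff_Suc_1
        finite_atLeastAtMost finite_subset not_less)
  finally show "rank ?\<epsilon> + card P = n" .
qed

text \<open>Invariance under \<open>star\<close> makes the lower pairs copies of the upper ones;
  together with idempotence it makes every transversal vertical.\<close>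

lemma projection_matching:
  assumes \<epsilon>: "\<epsilon> \<in> brauer_projections n"
  obtains P p where "matching P p" "P \<subseteq> {1..n}" "\<epsilon> = matching_diagram n (projection_partner n p)"
proof -
  have mem: "\<epsilon> \<in> brauer_elements n" and idem: "diagram_mult n \<epsilon> \<epsilon> = \<epsilon>" and st: "star \<epsilon> = \<epsilon>"
    using \<epsilon> by (auto simp: brauer_projections_def)
  obtain m where m: "matching (verts n) m" and em: "\<epsilon> = matching_diagram n m"
    using mem by (rule brauer_element_matching)
  have rel: "diagram_rel \<epsilon> s r \<longleftrightarrow> agrees m (lab s r)" for s r
    unfolding em by (rule matching_diagram_in(2)[OF m])
  have symr: "diagram_rel \<epsilon> s r \<longleftrightarrow> diagram_rel \<epsilon> r s" for s r
    using diagram_rel_star[of \<epsilon>] st by simp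
  have trans: "\<exists>t. diagram_rel \<epsilon> s t \<and> diagram_rel \<epsilon> t r" if "diagram_rel \<epsilon> s r" for s r
    using that diagram_rel_brauer_mult[OF mem mem] idem by (metis relcomppE)
  have force: "m x = y" if "\<And>s r. diagram_rel \<epsilon> s r \<Longrightarrow> lab s r x = lab s r y" "x \<noteq> y" "x \<in> verts n" "y \<in> verts n" for x y
  proof (rule matching_forced[OF m _ \<open>x \<noteq> y\<close>])
    fix L assume L: "agrees m L"
    have *: "lab (\<lambda>i. L (Up i)) (\<lambda>i. L (Dn i)) v = L v" if "v \<in> verts n" for v
      using that by (auto simp: verts_def)
    have "agrees m (lab (\<lambda>i. L (Up i)) (\<lambda>i. L (Dn i)))"
      using L agrees_cong[OF m *] by simp
    then show "L x = L y" using that(1) rel * that(3,4) by metis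
  qed
  have UU: "m (Dn x) = Dn y" if "m (Up x) = Up y" "x \<in> {1..n}" for x y
  proof (rule force)
    show xy: "Dn x \<noteq> Dn y" using that matching_fix_iff[OF m, of "Up x"] by (auto simp: verts_def)
    show "Dn x \<in> verts n" using that by (auto simp: verts_def)
    have "Up y \<in> verts n" using that matching_in_iff[OF m, of "Up x"] by (auto simp: verts_def)
    then show "Dn y \<in> verts n" by (auto simp: verts_def)
    fix s r assume "diagram_rel \<epsilon> s r"
    then have "agrees m (lab r s)" using symr rel by simp
    from agreesD[OF this, of "Up x"] that show "lab s r (Dn x) = lab s r (Dn y)" by simp
  qed
  \<comment> \<open>Related labelings \<open>s\<close> and \<open>r\<close> are both related to a
    common \<open>t\<close>, by idempotence and symmetry. A transversal from \<open>x\<close> to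
    \<open>y\<close> then gives \<open>s x = t y = r x\<close>.\<close>
  have UD: "m (Up x) = Dn x" if "m (Up x) = Dn y" "x \<in> {1..n}" for x y
  proof (rule force)
    fix s r assume "diagram_rel \<epsilon> s r"
    then obtain t where "diagram_rel \<epsilon> s t" "diagram_rel \<epsilon> r t" using trans symr by blast
    then have "agrees m (lab s t)" "agrees m (lab r t)" using rel by auto
    from agreesD[OF this(1), of "Up x"] agreesD[OF this(2), of "Up x"] that
    show "lab s r (Up x) = lab s r (Dn x)" by simp
  qed (use that in \<open>auto simp: verts_def\<close>)
  have noMid: "m (Up x) \<noteq> Mid y" for x y
  proof
    assume a: "m (Up x) = Mid y"
    then have "m (Up x) \<notin> verts n" by (auto simp: verts_def)
    then have "m (Up x) = Up x" using matching_in_iff[OF m] matching_fix_iff[OF m] by blast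
    with a show False by simp
  qed
  define p where "p x = (case m (Up x) of Up y \<Rightarrow> y | _ \<Rightarrow> x)" for x
  define P where "P = {x. p x \<noteq> x}"
  have P: "P \<subseteq> {1..n}"
  proof
    fix x assume "x \<in> P"
    then have "m (Up x) \<noteq> Up x" by (auto simp: P_def p_def)
    then have "Up x \<in> verts n" using matching_fix_iff[OF m] by blast
    then show "x \<in> {1..n}" by (auto simp: verts_def)
  qed
  have pp: "p (p x) = x" for x
  proof (cases "m (Up x)")
    case (Up y)
    then have "m (Up y) = Up x" using m by (metis matching_inv)
    then show ?thesis using Up by (simp add: p_def)
  qed (simp_all add: p_def)
  have p: "matching P p" using pp by (auto simp: matching_def P_def)
  have "m = projection_partner n p"
  proof
    have U: "m (Up x) = projection_partner n p (Up x)" if "x \<in> {1..n}" for x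
    proof (cases "m (Up x)")
      case (Up y)
      then have "y \<noteq> x" using matching_fix_iff[OF m, of "Up x"] that by (auto simp: verts_def)
      then show ?thesis using Up by (simp add: projection_partner_def p_def)
    next
      case (Dn y)
      then show ?thesis using UD[OF Dn that] that by (simp add: projection_partner_def p_def)
    qed (use noMid in auto)
    fix v
    show "m v = projection_partner n p v"
    proof (cases "v \<in> verts n")
      case True
      then consider x where "v = Up x" "x \<in> {1..n}" | x where "v = Dn x" "x \<in> {1..n}"
        by (auto simp: verts_def)
      then show ?thesis
      proof cases
        case 1
        with U show ?thesis by simp
      next
        case 2
        show ?thesis
        proof (cases "m (Up x)")
          case (Up y)
          then have "y \<noteq> x" using matching_fix_iff[OF m, of "Up x"] 2 by (auto simp: verts_def)
          then show ?thesis using UU[OF Up 2(2)] Up 2 by (simp add: projection_partner_def p_def)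
        next
          case (Dn y)
          then have "m (Up x) = Dn x" using UD 2 by blast
          moreover from this have "m (Dn x) = Up x" using m by (metis matching_inv)
          ultimately show ?thesis using 2 by (simp add: projection_partner_def p_def)
        qed (use noMid in auto)
      qed
    next
      case False
      then show ?thesis
        using matching_fix_iff[OF m, of v] matching_fix_iff[OF matching_projection_partner[OF p P], of v]
        by simp
    qed
  qed
  with that p P em show ?thesis by blast
qed

lemma card_rank_projections: "card (rank_projections n r) = card (partial_matchings n r)"
proof -
  let ?D = "\<lambda>p. matching_diagram n (projection_partner n p)"
  have "bij_betw ?D (partial_matchings n r) (rank_projections n r)"
  proof (rule bij_betw_imageI)
    show "inj_on ?D (partial_matchings n r)"
    proof (rule inj_onI)
      fix p q assume "p \<in> partial_matchings n r" "q \<in> partial_matchings n r" and eq: "?D p = ?D q"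
      then obtain P Q where p: "matching P p" "P \<subseteq> {1..n}" and q: "matching Q q" "Q \<subseteq> {1..n}"
        by (auto simp: partial_matchings_def)
      have "projection_partner n p = projection_partner n q"
      proof (rule matching_eq_of_agrees[OF matching_projection_partner[OF p] matching_projection_partner[OF q]])
        fix L assume L: "agrees (projection_partner n p) L"
        have *: "lab (\<lambda>i. L (Up i)) (\<lambda>i. L (Dn i)) v = L v" if "v \<in> verts n" for v
          using that by (auto simp: verts_def)
        have "agrees (projection_partner n p) (lab (\<lambda>i. L (Up i)) (\<lambda>i. L (Dn i)))"
          using L agrees_cong[OF matching_projection_partner[OF p] *] by simp
        then have "agrees (projection_partner n q) (lab (\<lambda>i. L (Up i)) (\<lambda>i. L (Dn i)))"
          using matching_diagram_in(2)[OF matching_projection_partner[OF p]]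
            matching_diagram_in(2)[OF matching_projection_partner[OF q]] eq by metis
        then show "agrees (projection_partner n q) L"
          using agrees_cong[OF matching_projection_partner[OF q] *] by simp
      qed
      then have "projection_partner n p (Up x) = projection_partner n q (Up x)" for x by simp
      then show "p = q" by (intro ext) (fastforce simp: projection_partner_def split: if_splits)
    qed
    show "?D ` partial_matchings n r = rank_projections n r"
    proof
      show "?D ` partial_matchings n r \<subseteq> rank_projections n r"
        using projection_diagram(1,2) by (fastforce simp: partial_matchings_def rank_projections_def)
      show "rank_projections n r \<subseteq> ?D ` partial_matchings n r"
      proof
        fix \<epsilon> assume "\<epsilon> \<in> rank_projections n r"
        then have \<epsilon>: "\<epsilon> \<in> brauer_projections n" "rank \<epsilon> = r" by (auto simp: rank_projections_def)
        from \<epsilon>(1) obtain P p where p: "matching P p" "P \<subseteq> {1..n}" "\<epsilon> = ?D p" by (rule projection_matching)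
        then have "p \<in> partial_matchings n r"
          using projection_diagram(2)[OF p(1,2)] \<epsilon>(2) by (auto simp: partial_matchings_def)
        then show "\<epsilon> \<in> ?D ` partial_matchings n r" using p(3) by blast
      qed
    qed
  qed
  then show ?thesis by (metis bij_betw_same_card)
qed

section \<open>The action on perfect matchings\<close>

text \<open>For odd \<open>n\<close> the extra point \<open>0\<close> is matched with the unique unmatched point of a
  lower pattern of rank 1, so that both parities are treated through perfect matchings.\<close>

definition points :: "nat \<Rightarrow> nat set" where
  "points n = (if odd n then {0..n} else {1..n})"

definition perfect :: "nat \<Rightarrow> (nat \<Rightarrow> nat) set" where
  "perfect n = {u. matching (points n) u}"

abbreviation brauer :: "nat \<Rightarrow> ((nat \<Rightarrow> bool) \<Rightarrow> (nat \<Rightarrow> bool) \<Rightarrow> bool) \<Rightarrow> bool" where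
  "brauer n \<equiv> brauer_rel {1..n} {1..n}"

text \<open>\<open>R\<close> ignores the label of \<open>0\<close>, as \<open>brauer_upd_0\<close>
  shows, so the condition at \<open>0\<close> is independent of it.\<close>

definition extend_rel :: "nat \<Rightarrow> ((nat \<Rightarrow> bool) \<Rightarrow> (nat \<Rightarrow> bool) \<Rightarrow> bool) \<Rightarrow> (nat \<Rightarrow> bool) \<Rightarrow> (nat \<Rightarrow> bool) \<Rightarrow> bool" where
  "extend_rel n R s r \<longleftrightarrow> R s r \<and> (odd n \<longrightarrow> s 0 = r 0)"

lemma perfectD: "u \<in> perfect n \<Longrightarrow> matching (points n) u"
  by (simp add: perfect_def)

lemma finite_points [simp]: "finite (points n)"
  by (simp add: points_def)

lemma even_card_points: "even (card (points n))"
  by (simp add: points_def)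

lemma points_subset: "{1..n} \<subseteq> points n"
  by (auto simp: points_def)

lemma points_cases: "x \<in> points n \<longleftrightarrow> x \<in> {1..n} \<or> odd n \<and> x = 0"
  by (auto simp: points_def)

lemma brauer_comp: "brauer n R \<Longrightarrow> brauer n Q \<Longrightarrow> brauer n (R OO Q)"
  by (rule brauer_rel_comp) auto

lemma brauer_upd_0: "brauer n R \<Longrightarrow> R (s(0 := c)) (r(0 := d)) = R s r"
  by (rule brauer_rel_cong[of "{1..n}" "{1..n}"]) auto

lemma extend_OO:
  assumes "brauer n R" "brauer n Q"
  shows "extend_rel n (R OO Q) = extend_rel n R OO extend_rel n Q"
proof (intro ext iffI)
  fix s r assume "extend_rel n (R OO Q) s r"
  then obtain t where t: "R s t" "Q t r" "odd n \<longrightarrow> s 0 = r 0" by (auto simp: extend_rel_def)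
  \<comment> \<open>The intermediate labeling may be changed at \<open>0\<close>, so that it carries
    the label of \<open>0\<close> through.\<close>
  have "R s (t(0 := s 0))" "Q (t(0 := s 0)) r"
    using t brauer_upd_0[OF assms(1), of s "s 0" t "s 0"] brauer_upd_0[OF assms(2), of t "s 0" r "r 0"] by auto
  with t(3) show "(extend_rel n R OO extend_rel n Q) s r"
    by (intro relcomppI[of _ _ "t(0 := s 0)"]) (auto simp: extend_rel_def)
qed (auto simp: extend_rel_def)

lemma brauer_rel_extend:
  assumes "brauer n R"
  shows "brauer_rel (points n) (points n) (extend_rel n R)"
proof (cases "odd n")
  case True
  obtain m where m: "matching (Up ` {1..n} \<union> Dn ` {1..n}) m" and R: "\<And>s r. R s r \<longleftrightarrow> agrees m (lab s r)"
    using assms by (auto simp: brauer_rel_def)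
  let ?m = "m(Up 0 := Dn 0, Dn 0 := Up 0)"
  have fix0: "m (Up 0) = Up 0" "m (Dn 0) = Dn 0"
    using matching_fix_iff[OF m] by auto
  have ne: "m x \<noteq> Up 0" "m x \<noteq> Dn 0" if "x \<noteq> Up 0" "x \<noteq> Dn 0" for x
    using that fix0 m by (metis matching_inv)+
  have mm: "matching (Up ` points n \<union> Dn ` points n) ?m"
  proof (rule matchingI)
    fix x
    show "?m (?m x) = x" using ne m by auto
    show "x \<in> Up ` points n \<union> Dn ` points n \<Longrightarrow> ?m x \<noteq> x"
      using matching_fix_iff[OF m, of x] True by (auto simp: points_cases)
    show "x \<notin> Up ` points n \<union> Dn ` points n \<Longrightarrow> ?m x = x"
      using matching_fix_iff[OF m, of x] True by (auto simp: points_def image_iff)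
  qed
  have "extend_rel n R s r \<longleftrightarrow> agrees ?m (lab s r)" for s r
  proof
    assume "extend_rel n R s r"
    then have "agrees m (lab s r)" "s 0 = r 0" using R True by (auto simp: extend_rel_def)
    then show "agrees ?m (lab s r)" by (auto simp: agrees_def)
  next
    assume a: "agrees ?m (lab s r)"
    have "s 0 = r 0" using agreesD[OF a, of "Up 0"] by simp
    moreover have "agrees m (lab s r)" unfolding agrees_def
    proof
      fix x show "lab s r (m x) = lab s r x"
        using agreesD[OF a, of x] fix0 by (cases "x = Up 0 \<or> x = Dn 0") auto
    qed
    ultimately show "extend_rel n R s r" using R by (simp add: extend_rel_def)
  qed
  with mm show ?thesis unfolding brauer_rel_def by blast
next
  case False
  then have "extend_rel n R = R" by (auto simp: extend_rel_def fun_eq_iff)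
  then show ?thesis using assms False by (simp add: points_def)
qed

text \<open>The matching \<open>v\<close>, read as a relation with empty upper row, is composed with
  the diagram.\<close>

lemma perfect_image:
  assumes "brauer n R" "v \<in> perfect n"
  obtains w where "w \<in> perfect n" "\<And>r. agrees w r \<longleftrightarrow> (\<exists>t. agrees v t \<and> extend_rel n R t r)"
proof -
  have "brauer_rel {} (points n) (\<lambda>s. agrees v)"
    using perfectD[OF assms(2)] by (auto simp: brauer_rel_source_empty)
  from brauer_rel_comp[OF this brauer_rel_extend[OF assms(1)] finite_points]
  have "brauer_rel {} (points n) (\<lambda>s r. \<exists>t. agrees v t \<and> extend_rel n R t r)"
    by (simp add: relcompp_apply[abs_def])
  then show ?thesis using that unfolding brauer_rel_source_empty perfect_def by auto
qed

lemma perfect_preimage: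
  assumes "brauer n R" "v \<in> perfect n"
  obtains w where "w \<in> perfect n" "\<And>s. agrees w s \<longleftrightarrow> (\<exists>t. extend_rel n R s t \<and> agrees v t)"
proof -
  have "brauer n (R\<inverse>\<inverse>)" using assms(1) by (rule brauer_rel_converse)
  then obtain w where w: "w \<in> perfect n" "\<And>r. agrees w r \<longleftrightarrow> (\<exists>t. agrees v t \<and> extend_rel n (R\<inverse>\<inverse>) t r)"
    using perfect_image[OF _ assms(2)] by metis
  have "extend_rel n (R\<inverse>\<inverse>) t r \<longleftrightarrow> extend_rel n R r t" for t r by (auto simp: extend_rel_def)
  then have "agrees w s \<longleftrightarrow> (\<exists>t. extend_rel n R s t \<and> agrees v t)" for s using w(2) by metis
  with w(1) show ?thesis by (rule that)
qed

lemma perfect_exists: "\<exists>u. u \<in> perfect n"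
  using matching_exists[OF finite_points even_card_points] by (auto simp: perfect_def)

text \<open>For odd \<open>n\<close> the value \<open>c\<close> is the common label of the two ends of the unique transversal;
  for even \<open>n\<close> it is irrelevant.\<close>

definition min_rel :: "(nat \<Rightarrow> nat) \<Rightarrow> (nat \<Rightarrow> nat) \<Rightarrow> (nat \<Rightarrow> bool) \<Rightarrow> (nat \<Rightarrow> bool) \<Rightarrow> bool" where
  "min_rel u v s r \<longleftrightarrow> (\<exists>c. agrees u (s(0 := c)) \<and> agrees v (r(0 := c)))"

lemma agrees_perfect_even:
  assumes "u \<in> perfect n" "even n"
  shows "agrees u (s(0 := c)) \<longleftrightarrow> agrees u s"
  by (rule agrees_cong[OF perfectD[OF assms(1)]]) (use assms in \<open>auto simp: points_def\<close>)

text \<open>Without \<open>0\<close>, its partner is the only unmatched point and hence the end of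
  the transversal: the dictionary between perfect matchings of \<open>points n\<close> and patterns
  of rank 1.\<close>

lemma perfect_odd_cut:
  assumes u: "u \<in> perfect n" and "odd n"
  shows "matching ({1..n} - {u 0}) (u(0 := 0, u 0 := u 0))"
    and "u 0 \<in> {1..n}"
    and "agrees u (s(0 := c)) \<longleftrightarrow> agrees (u(0 := 0, u 0 := u 0)) s \<and> s (u 0) = c"
proof -
  note m = perfectD[OF u]
  have "0 \<in> points n" using \<open>odd n\<close> by (simp add: points_def)
  then have u0: "u 0 \<noteq> 0" "u 0 \<in> points n"
    using matching_fix_iff[OF m] matching_in_iff[OF m] by auto
  then show "u 0 \<in> {1..n}" using \<open>odd n\<close> by (auto simp: points_def)
  have "points n - {0, u 0} = {1..n} - {u 0}" using \<open>odd n\<close> by (auto simp: points_def)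
  with matching_unpair[OF m refl, of 0]
  show m': "matching ({1..n} - {u 0}) (u(0 := 0, u 0 := u 0))" by simp
  show "agrees u (s(0 := c)) \<longleftrightarrow> agrees (u(0 := 0, u 0 := u 0)) s \<and> s (u 0) = c"
  proof
    assume a: "agrees u (s(0 := c))"
    have "s (u 0) = c" using agreesD[OF a, of 0] u0 by simp
    moreover have "agrees (u(0 := 0, u 0 := u 0)) s"
    proof (rule agrees_matchingI[OF m'])
      fix x assume x: "x \<in> {1..n} - {u 0}"
      then have "u x \<noteq> 0" using m by (metis DiffE insert_iff matching_inv)
      then show "s ((u(0 := 0, u 0 := u 0)) x) = s x" using agreesD[OF a, of x] x by auto
    qed
    ultimately show "agrees (u(0 := 0, u 0 := u 0)) s \<and> s (u 0) = c" by simp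
  next
    assume a: "agrees (u(0 := 0, u 0 := u 0)) s \<and> s (u 0) = c"
    show "agrees u (s(0 := c))" unfolding agrees_def
    proof
      fix x
      show "(s(0 := c)) (u x) = (s(0 := c)) x"
      proof (cases "x = 0 \<or> x = u 0")
        case False
        then have "u x \<noteq> 0" using m by (metis matching_inv)
        then show ?thesis using agreesD[of _ s x] a False by fastforce
      qed (use a u0 m in auto)
    qed
  qed
qed

lemma brauer_min_rel:
  assumes u: "u \<in> perfect n" and v: "v \<in> perfect n"
  shows "brauer n (min_rel u v)"
proof (cases "odd n")
  case True
  note U = perfect_odd_cut[OF u True] and V = perfect_odd_cut[OF v True]
  have "{1..n} - ({1..n} - {u 0}) = {u 0}" "{1..n} - ({1..n} - {v 0}) = {v 0}"
    using U(2) V(2) by auto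
  moreover have "bij_betw (\<lambda>_. v 0) {u 0} {v 0}" by (auto simp: bij_betw_def)
  ultimately have "brauer n (\<lambda>s r. agrees (u(0 := 0, u 0 := u 0)) s \<and> agrees (v(0 := 0, v 0 := v 0)) r \<and>
      (\<forall>x\<in>{u 0}. s x = r (v 0)))"
    using brauer_rel_link[OF U(1) V(1), of "{1..n}" "{1..n}" "\<lambda>_. v 0"] by simp
  moreover have "min_rel u v = (\<lambda>s r. agrees (u(0 := 0, u 0 := u 0)) s \<and>
      agrees (v(0 := 0, v 0 := v 0)) r \<and> (\<forall>x\<in>{u 0}. s x = r (v 0)))"
    unfolding min_rel_def U(3) V(3) by (intro ext) auto
  ultimately show ?thesis by simp
next
  case False
  then have P: "points n = {1..n}" by (simp add: points_def)
  have "min_rel u v = (\<lambda>s r. agrees u s \<and> agrees v r \<and> (\<forall>x\<in>{1..n} - {1..n}. s x = r (id x)))"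
    using False agrees_perfect_even[OF u] agrees_perfect_even[OF v] by (intro ext) (simp add: min_rel_def)
  moreover have "brauer n \<dots>"
    by (rule brauer_rel_link) (use perfectD[OF u] perfectD[OF v] P in \<open>auto simp: bij_betw_def\<close>)
  ultimately show ?thesis by simp
qed

text \<open>\<open>R\<close> pulls \<open>u\<close> back to \<open>w\<close>. The full preimage of
  the labelings of \<open>u\<close> is itself given by a perfect matching, see
  \<open>perfect_preimage\<close>, so this inclusion determines \<open>w\<close>.\<close>

definition forced :: "nat \<Rightarrow> ((nat \<Rightarrow> bool) \<Rightarrow> (nat \<Rightarrow> bool) \<Rightarrow> bool) \<Rightarrow> (nat \<Rightarrow> nat) \<Rightarrow> (nat \<Rightarrow> nat) \<Rightarrow> bool" where
  "forced n R u w \<longleftrightarrow> (\<forall>s t. extend_rel n R s t \<longrightarrow> agrees u t \<longrightarrow> agrees w s)"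

text \<open>Two diagrams coincide as soon as one relation contains the other, so products
  only have to be computed up to inclusion.\<close>

lemma min_rel_left:
  assumes R: "brauer n R" and u: "u \<in> perfect n" and v: "v \<in> perfect n" and w: "w \<in> perfect n"
    and f: "forced n R u w"
  shows "R OO min_rel u v = min_rel w v"
proof (rule brauer_rel_eq)
  show "brauer n (R OO min_rel u v)" using R brauer_min_rel[OF u v] by (rule brauer_comp)
  show "brauer n (min_rel w v)" using w v by (rule brauer_min_rel)
  fix s r assume "(R OO min_rel u v) s r"
  then obtain t c where t: "R s t" "agrees u (t(0 := c))" "agrees v (r(0 := c))"
    by (auto simp: min_rel_def)
  then have "extend_rel n R (s(0 := c)) (t(0 := c))"
    using brauer_upd_0[OF R] by (simp add: extend_rel_def)
  with t f show "min_rel w v s r" unfolding forced_def min_rel_def by blast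
qed

lemma min_rel_right:
  assumes R: "brauer n R" and u: "u \<in> perfect n" and v: "v \<in> perfect n" and w: "w \<in> perfect n"
    and f: "\<And>t r. extend_rel n R t r \<Longrightarrow> agrees v t \<Longrightarrow> agrees w r"
  shows "min_rel u v OO R = min_rel u w"
proof (rule brauer_rel_eq)
  show "brauer n (min_rel u v OO R)" using R brauer_min_rel[OF u v] by (intro brauer_comp)
  show "brauer n (min_rel u w)" using u w by (rule brauer_min_rel)
  fix s r assume "(min_rel u v OO R) s r"
  then obtain t c where t: "R t r" "agrees u (s(0 := c))" "agrees v (t(0 := c))"
    by (auto simp: min_rel_def)
  then have "extend_rel n R (t(0 := c)) (r(0 := c))"
    using brauer_upd_0[OF R] by (simp add: extend_rel_def)
  with t f show "min_rel u w s r" unfolding min_rel_def by blast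
qed

text \<open>Pairs that contain \<open>0\<close> are left out, because a matching is determined off
  one pair. This fits \<open>min_rel\<close>, which hides the label of \<open>0\<close> behind a
  quantifier.\<close>

lemma perfect_eqI:
  assumes u: "u \<in> perfect n" and w: "w \<in> perfect n"
    and f: "\<And>s x. agrees w s \<Longrightarrow> x \<noteq> 0 \<Longrightarrow> u x \<noteq> 0 \<Longrightarrow> s (u x) = s x"
  shows "u = w"
proof (rule matching_eq_off_pair[OF perfectD[OF u] perfectD[OF w], of 0])
  fix x assume x: "x \<notin> {0, u 0}"
  then have "u x \<noteq> 0" using perfectD[OF u] by (metis insertCI matching_inv)
  show "u x = w x"
  proof (cases "u x = x")
    case True
    then show ?thesis using matching_fix_iff[OF perfectD[OF u]] matching_fix_iff[OF perfectD[OF w]] by metis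
  next
    case False
    then have "w x = u x"
      using f x \<open>u x \<noteq> 0\<close> by (intro matching_forced[OF perfectD[OF w]]) auto
    then show ?thesis ..
  qed
qed

lemma min_rel_source: "min_rel u v s r \<Longrightarrow> x \<noteq> 0 \<Longrightarrow> u x \<noteq> 0 \<Longrightarrow> s (u x) = s x"
  unfolding min_rel_def using agreesD by (metis fun_upd_other)

lemma min_rel_target: "min_rel u v s r \<Longrightarrow> x \<noteq> 0 \<Longrightarrow> v x \<noteq> 0 \<Longrightarrow> r (v x) = r x"
  unfolding min_rel_def using agreesD by (metis fun_upd_other)

lemma agrees_const: "agrees u (\<lambda>_. c)"
  by (simp add: agrees_def)

text \<open>A constant labeling is compatible with every matching. It allows one factor of
  \<open>min_rel\<close> to be tested independently of the other.\<close>

lemma min_rel_const: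
  assumes "agrees u s"
  shows "min_rel u v s (\<lambda>_. s 0)" "min_rel v u (\<lambda>_. s 0) s"
proof -
  have "(\<lambda>_. s 0)(0 := s 0) = (\<lambda>_. s 0)" by auto
  then show "min_rel u v s (\<lambda>_. s 0)" "min_rel v u (\<lambda>_. s 0) s"
    unfolding min_rel_def using assms agrees_const[of v "s 0"] by (metis fun_upd_triv)+
qed

lemma min_rel_inj:
  assumes "u \<in> perfect n" "u' \<in> perfect n" "v \<in> perfect n" "v' \<in> perfect n"
    and eq: "min_rel u v = min_rel u' v'"
  shows "u = u' \<and> v = v'"
proof
  show "u = u'"
    by (rule perfect_eqI[OF assms(1,2)]) (metis eq min_rel_const(1) min_rel_source)
  show "v = v'"
    by (rule perfect_eqI[OF assms(3,4)]) (metis eq min_rel_const(2) min_rel_target)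
qed

text \<open>The minimal ideal is a rectangular band. The left factor of the product is the preimage
  \<open>w\<close> of \<open>u'\<close>; labelings of \<open>w\<close> occur as upper labelings of
  \<open>min_rel u v\<close> and so respect the pairs of \<open>u\<close>.\<close>

lemma min_rel_comp:
  assumes u: "u \<in> perfect n" and v: "v \<in> perfect n" and u': "u' \<in> perfect n" and v': "v' \<in> perfect n"
  shows "min_rel u v OO min_rel u' v' = min_rel u v'"
proof -
  note R = brauer_min_rel[OF u v]
  obtain w where w: "w \<in> perfect n" "\<And>s. agrees w s \<longleftrightarrow> (\<exists>t. extend_rel n (min_rel u v) s t \<and> agrees u' t)"
    using perfect_preimage[OF R u'] by blast
  then have "min_rel u v OO min_rel u' v' = min_rel w v'"
    by (intro min_rel_left[OF R u' v']) (auto simp: forced_def)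
  moreover have "u = w"
  proof (rule perfect_eqI[OF u w(1)])
    fix s x assume s: "agrees w s" and x: "x \<noteq> 0" "u x \<noteq> 0"
    then obtain t where "min_rel u v s t" using w(2) by (auto simp: extend_rel_def)
    then show "s (u x) = s x" using x by (rule min_rel_source)
  qed
  ultimately show ?thesis by simp
qed

section \<open>Projections, hooks and the completions of four defects\<close>

definition link_rel :: "nat \<Rightarrow> (nat \<Rightarrow> nat) \<Rightarrow> (nat \<Rightarrow> nat) \<Rightarrow> (nat \<Rightarrow> nat) \<Rightarrow> (nat \<Rightarrow> bool) \<Rightarrow> (nat \<Rightarrow> bool) \<Rightarrow> bool" where
  "link_rel n p f q s r \<longleftrightarrow> agrees p s \<and> agrees q r \<and> (\<forall>x\<in>{1..n}. p x = x \<longrightarrow> s x = r (f x))"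

lemma brauer_link_rel:
  assumes p: "matching P p" and q: "matching Q q" and sub: "P \<subseteq> {1..n}" "Q \<subseteq> {1..n}"
    and f: "bij_betw f ({1..n} - P) ({1..n} - Q)"
  shows "brauer n (link_rel n p f q)"
proof -
  have "link_rel n p f q = (\<lambda>s r. agrees p s \<and> agrees q r \<and> (\<forall>x\<in>{1..n} - P. s x = r (f x)))"
    using matching_fix_iff[OF p] by (intro ext) (auto simp: link_rel_def)
  then show ?thesis using brauer_rel_link[OF assms] by simp
qed

abbreviation proj_rel :: "nat \<Rightarrow> (nat \<Rightarrow> nat) \<Rightarrow> (nat \<Rightarrow> bool) \<Rightarrow> (nat \<Rightarrow> bool) \<Rightarrow> bool" where
  "proj_rel n p \<equiv> link_rel n p id p"

lemma brauer_proj_rel: "matching P p \<Longrightarrow> P \<subseteq> {1..n} \<Longrightarrow> brauer n (proj_rel n p)"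
  by (rule brauer_link_rel) auto

definition hook :: "nat \<Rightarrow> nat \<Rightarrow> nat \<Rightarrow> (nat \<Rightarrow> bool) \<Rightarrow> (nat \<Rightarrow> bool) \<Rightarrow> bool" where
  "hook n x y s r \<longleftrightarrow> s x = s y \<and> r x = r y \<and> (\<forall>z\<in>{1..n}. z \<noteq> x \<longrightarrow> z \<noteq> y \<longrightarrow> s z = r z)"

lemma hook_commute: "hook n x y = hook n y x"
  by (intro ext) (auto simp: hook_def)

lemma hook_other: "hook n x y s r \<Longrightarrow> k \<in> {1..n} \<Longrightarrow> k \<noteq> x \<Longrightarrow> k \<noteq> y \<Longrightarrow> s k = r k"
  by (simp add: hook_def)

lemma brauer_hook:
  assumes "x \<in> {1..n}" "y \<in> {1..n}" "x \<noteq> y"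
  shows "brauer n (hook n x y)"
proof -
  let ?p = "id(x := y, y := x)"
  have p: "matching {x, y} ?p" using assms by (intro matchingI) auto
  have "agrees ?p s \<longleftrightarrow> s x = s y" for s using assms by (auto simp: agrees_def)
  then have "hook n x y = proj_rel n ?p"
    using assms by (intro ext) (auto simp: hook_def link_rel_def)
  with brauer_proj_rel[OF p] assms show ?thesis by simp
qed

lemma link_rel_proj:
  assumes "matching P p" "matching Q q" "P \<subseteq> {1..n}" "Q \<subseteq> {1..n}" "bij_betw f ({1..n} - P) ({1..n} - Q)"
  shows "link_rel n p f q OO proj_rel n q = link_rel n p f q"
proof (rule brauer_rel_eq)
  note B = brauer_link_rel[OF assms]
  show "brauer n (link_rel n p f q)" by (rule B)
  show "brauer n (link_rel n p f q OO proj_rel n q)"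
    using B brauer_proj_rel[OF assms(2,4)] by (rule brauer_comp)
  fix s r assume "(link_rel n p f q OO proj_rel n q) s r"
  then obtain t where t: "link_rel n p f q s t" "proj_rel n q t r" by blast
  have "s x = r (f x)" if "x \<in> {1..n}" "p x = x" for x
  proof -
    have "f x \<in> {1..n} - Q" using that assms by (intro bij_betw_apply[OF assms(5)]) (auto simp: matching_fix_iff)
    then show ?thesis using t that assms by (auto simp: link_rel_def matching_fix_iff)
  qed
  with t show "link_rel n p f q s r" by (auto simp: link_rel_def)
qed

text \<open>A labeling compatible with \<open>q\<close> is related to itself by the hook on any pair
  of \<open>q\<close>, so a diagram absorbs the hooks of its lower pairs.\<close>

lemma link_rel_hook:
  assumes "matching P p" "matching Q q" "P \<subseteq> {1..n}" "Q \<subseteq> {1..n}" "bij_betw f ({1..n} - P) ({1..n} - Q)"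
    and x: "x \<in> Q"
  shows "link_rel n p f q OO hook n x (q x) = link_rel n p f q"
proof (rule brauer_rel_eq[symmetric])
  note B = brauer_link_rel[OF assms(1-5)]
  have qx: "q x \<noteq> x" "q x \<in> Q" using x assms(2) by (auto simp: matching_fix_iff matching_in_iff)
  show "brauer n (link_rel n p f q)" by (rule B)
  show "brauer n (link_rel n p f q OO hook n x (q x))"
  proof (rule brauer_comp[OF B brauer_hook])
    show "x \<in> {1..n}" "q x \<in> {1..n}" using qx x assms(4) by blast+
  qed (use qx in simp)
  fix s r assume "link_rel n p f q s r"
  moreover from this have "hook n x (q x) r r" by (simp add: link_rel_def hook_def agreesD)
  ultimately show "(link_rel n p f q OO hook n x (q x)) s r" by blast
qed

definition join2 :: "(nat \<Rightarrow> nat) \<Rightarrow> nat \<Rightarrow> nat \<Rightarrow> nat \<Rightarrow> nat \<Rightarrow> nat \<Rightarrow> nat" where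
  "join2 p a b c d = p(a := b, b := a, c := d, d := c)"

lemma matching_join2:
  assumes "matching P p" "distinct [a, b, c, d]" "a \<notin> P" "b \<notin> P" "c \<notin> P" "d \<notin> P" "A = P \<union> {a, b, c, d}"
  shows "matching A (join2 p a b c d)"
proof -
  have "matching (P \<union> {a, b} \<union> {c, d}) (p(a := b, b := a, c := d, d := c))"
    by (intro matching_join) (use assms in auto)
  moreover have "P \<union> {a, b} \<union> {c, d} = A" using assms(7) by auto
  ultimately show ?thesis by (simp add: join2_def)
qed

lemma agrees_join2I: "agrees p s \<Longrightarrow> s a = s b \<Longrightarrow> s c = s d \<Longrightarrow> agrees (join2 p a b c d) s"
  by (auto simp: agrees_def join2_def)

lemma agrees_join2D:
  assumes "agrees (join2 p a b c d) s" "distinct [a, b, c, d]"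
  shows "s a = s b" "s c = s d"
  using agreesD[OF assms(1), of a] agreesD[OF assms(1), of c] assms(2) by (auto simp: join2_def)

text \<open>\<open>w\<close> maps the complement of \<open>P\<close> to itself and so pairs the four
  defects among themselves; the partner of \<open>a\<close> decides the rest.\<close>

lemma join2_cases:
  assumes p: "matching P p" and w: "matching (P \<union> {a, b, c, d}) w" and d: "distinct [a, b, c, d]"
    and nP: "a \<notin> P" "b \<notin> P" "c \<notin> P" "d \<notin> P" and ext: "\<And>x. x \<in> P \<Longrightarrow> w x = p x"
  shows "w = join2 p a b c d \<or> w = join2 p a c b d \<or> w = join2 p a d b c"
proof -
  have wP: "w x \<notin> P" if "x \<notin> P" for x
  proof
    assume "w x \<in> P"
    then have "p (w x) = x" using ext w by (metis matching_inv)
    with \<open>w x \<in> P\<close> that show False using matching_in_iff[OF p] by metis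
  qed
  have *: "w = join2 p a x y z" if xyz: "w a = x" "{x, y, z} = {b, c, d}" "distinct [x, y, z]" for x y z
  proof (rule sym, rule matching_eq_off_pair[OF _ w, of _ y])
    have yz: "y \<noteq> a" "z \<noteq> a" "x \<noteq> a" "x \<notin> P" "y \<notin> P" "z \<notin> P"
    proof -
      have "x \<in> {b, c, d}" "y \<in> {b, c, d}" "z \<in> {b, c, d}" using xyz(2) by blast+
      then show "y \<noteq> a" "z \<noteq> a" "x \<noteq> a" "x \<notin> P" "y \<notin> P" "z \<notin> P" using d nP by auto
    qed
    have "P \<union> {a, b, c, d} = P \<union> {a, x, y, z}" using xyz(2) by simp
    then show "matching (P \<union> {a, b, c, d}) (join2 p a x y z)"
      by (intro matching_join2[OF p]) (use xyz(3) yz nP(1) in simp_all)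
    fix v assume "v \<notin> {y, join2 p a x y z y}"
    moreover have "join2 p a x y z y = z" using xyz yz by (auto simp: join2_def)
    ultimately have v: "v \<noteq> y" "v \<noteq> z" by auto
    show "join2 p a x y z v = w v"
    proof (cases "v \<in> P \<union> {a, b, c, d}")
      case True
      have "w x = a" using xyz(1) w by (metis matching_inv)
      moreover have "v \<in> P \<or> v = a \<or> v = x" using True v xyz(2) by auto
      ultimately show ?thesis using v yz xyz(1,3) by (auto simp: join2_def ext)
    next
      case False
      moreover from this have "v \<noteq> x" using xyz(2) by auto
      ultimately show ?thesis using v matching_fix_iff[OF w, of v] matching_fix_iff[OF p, of v]
        by (auto simp: join2_def)
    qed
  qed
  have "w a \<in> P \<union> {a, b, c, d}" "w a \<noteq> a"
    using matching_in_iff[OF w, of a] matching_fix_iff[OF w, of a] by auto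
  with wP[OF nP(1)] have "w a = b \<or> w a = c \<or> w a = d" by auto
  then show ?thesis using *[of b c d] *[of c b d] *[of d b c] d by auto
qed

section \<open>The lower bound\<close>

lemma card_4_obtain:
  assumes "card F = 4" "x \<in> F"
  obtains b c d where "F = {x, b, c, d}" "distinct [x, b, c, d]"
proof -
  have "card (F - {x}) = 3" using assms by simp
  then obtain b c d where "F - {x} = {b, c, d}" "b \<noteq> c" "c \<noteq> d" "b \<noteq> d" by (auto simp: card_3_iff)
  then show ?thesis using that[of b c d] assms(2) by auto
qed

lemma card_4_obtain2:
  assumes "card F = 4" "x \<in> F" "y \<in> F" "x \<noteq> y"
  obtains c d where "F = {x, y, c, d}" "distinct [x, y, c, d]"
proof -
  have "card (F - {x} - {y}) = 2" using assms by simp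
  then obtain c d where "F - {x} - {y} = {c, d}" "c \<noteq> d" by (auto simp: card_2_iff)
  then show ?thesis using that[of c d] assms(2-4) by auto
qed

lemma join2_sym:
  assumes "distinct [a, b, c, d]"
  shows "join2 p a b d c = join2 p a b c d" "join2 p b a c d = join2 p a b c d"
    "join2 p c d a b = join2 p a b c d"
  using assms by (auto simp: join2_def)

text \<open>A partial action is encoded as a total one on \<open>insert z X\<close>, with the fixed
  point \<open>z\<close> for undefined values; for total actions it is assumed later that
  \<open>z\<close> is not reached from \<open>X\<close>. Both degrees thus share this locale. It
  acts by relations, so that products are compositions.\<close>

locale brauer_action =
  fixes n :: nat and X :: "'x set" and z :: 'x
    and act :: "'x \<Rightarrow> ((nat \<Rightarrow> bool) \<Rightarrow> (nat \<Rightarrow> bool) \<Rightarrow> bool) \<Rightarrow> 'x"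
  assumes n3: "n \<ge> 3"
    and fin: "finite X"
    and zX: "z \<notin> X"
    and act_z: "\<And>R. brauer n R \<Longrightarrow> act z R = z"
    and act_in: "\<And>x R. x \<in> X \<Longrightarrow> brauer n R \<Longrightarrow> act x R \<in> insert z X"
    and act_comp: "\<And>x R Q. brauer n R \<Longrightarrow> brauer n Q \<Longrightarrow> x \<in> X \<Longrightarrow> act (act x R) Q = act x (R OO Q)"
    and faithful: "\<And>R Q. brauer n R \<Longrightarrow> brauer n Q \<Longrightarrow> (\<And>x. x \<in> X \<Longrightarrow> act x R = act x Q) \<Longrightarrow> R = Q"
begin

definition base :: "nat \<Rightarrow> nat" where
  "base = (SOME u. u \<in> perfect n)"

lemma base: "base \<in> perfect n"
  unfolding base_def using perfect_exists by (rule someI_ex)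

text \<open>The values of \<open>y\<close> under the minimal ideal as a function of the left factor.
  One right factor is enough: by \<open>min_rel_comp\<close>, acting by
  \<open>min_rel base v\<close> on \<open>profile y u\<close> gives
  \<open>act y (min_rel u v)\<close>.\<close>

definition profile :: "'x \<Rightarrow> (nat \<Rightarrow> nat) \<Rightarrow> 'x" where
  "profile y u = act y (min_rel u base)"

lemma brauer_base: "u \<in> perfect n \<Longrightarrow> brauer n (min_rel u base)"
  by (rule brauer_min_rel[OF _ base])

lemma profile_z: "u \<in> perfect n \<Longrightarrow> profile z u = z"
  unfolding profile_def by (rule act_z) (rule brauer_base)

text \<open>If \<open>R\<close> fixes \<open>y\<close>, then \<open>y\<close> cannot distinguish
  \<open>u\<close> from its pullback along \<open>R\<close>. This turns fixing projections and hooks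
  into coincidences of profile values.\<close>

lemma profile_forced:
  assumes "y \<in> X" "brauer n R" "act y R = y" "u \<in> perfect n" "w \<in> perfect n" "forced n R u w"
  shows "profile y u = profile y w"
proof -
  have "profile y u = act (act y R) (min_rel u base)" using assms(3) by (simp add: profile_def)
  also have "\<dots> = act y (R OO min_rel u base)"
    by (rule act_comp) (use assms brauer_base in auto)
  also have "R OO min_rel u base = min_rel w base"
    using assms base by (intro min_rel_left)
  finally show ?thesis by (simp add: profile_def)
qed

lemma act_fix_comp:
  assumes "y \<in> X" "brauer n R" "brauer n Q" "act y R = y" "act y Q = y"
  shows "act y (R OO Q) = y"
  using assms act_comp by metis

lemma forced_proj:
  assumes P: "P \<subseteq> {1..n}"
    and "\<And>s t. agrees p s \<Longrightarrow> agrees p t \<Longrightarrow> (\<And>v. v \<in> points n \<Longrightarrow> p v = v \<Longrightarrow> s v = t v) \<Longrightarrow>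
      agrees u t \<Longrightarrow> agrees w s"
  shows "forced n (proj_rel n p) u w"
  unfolding forced_def
proof (intro allI impI)
  fix s t assume "extend_rel n (proj_rel n p) s t" "agrees u t"
  then show "agrees w s"
    by (intro assms(2)[of s t]) (auto simp: extend_rel_def link_rel_def points_cases)
qed

lemma forced_proj_hook:
  assumes p: "matching P p" "P \<subseteq> {1..n}" and x: "x \<in> {1..n}" "x' \<in> {1..n}" "x \<noteq> x'"
    and "\<And>s t' t. agrees p s \<Longrightarrow> agrees p t' \<Longrightarrow> (\<And>v. v \<in> points n \<Longrightarrow> p v = v \<Longrightarrow> s v = t' v) \<Longrightarrow>
      t' x = t' x' \<Longrightarrow> t x = t x' \<Longrightarrow> (\<And>v. v \<in> points n \<Longrightarrow> v \<noteq> x \<Longrightarrow> v \<noteq> x' \<Longrightarrow> t' v = t v) \<Longrightarrow>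
      agrees u t \<Longrightarrow> agrees w s"
  shows "forced n (proj_rel n p OO hook n x x') u w"
  unfolding forced_def extend_OO[OF brauer_proj_rel[OF p] brauer_hook[OF x]]
proof (intro allI impI)
  fix s t assume "(extend_rel n (proj_rel n p) OO extend_rel n (hook n x x')) s t" and u: "agrees u t"
  then obtain t' where t': "extend_rel n (proj_rel n p) s t'" "extend_rel n (hook n x x') t' t" by blast
  then have "agrees p s" "agrees p t'" "\<And>v. v \<in> points n \<Longrightarrow> p v = v \<Longrightarrow> s v = t' v"
    by (auto simp: extend_rel_def link_rel_def points_cases)
  moreover have "t' x = t' x'" "t x = t x'" "\<And>v. v \<in> points n \<Longrightarrow> v \<noteq> x \<Longrightarrow> v \<noteq> x' \<Longrightarrow> t' v = t v"
    using t'(2) unfolding extend_rel_def points_cases hook_def by blast+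
  ultimately show "agrees w s" using u by (rule assms(6))
qed

text \<open>Pull \<open>u\<close> back along the projection: only labelings compatible with
  \<open>p\<close> occur on its upper side, so the pullback contains all pairs of
  \<open>p\<close>.\<close>

lemma perfect_restrict:
  assumes y: "y \<in> X" and p: "matching P p" "P \<subseteq> {1..n}" and fixp: "act y (proj_rel n p) = y"
    and u: "u \<in> perfect n"
  obtains w where "w \<in> perfect n" "profile y u = profile y w" "\<And>x. x \<in> P \<Longrightarrow> w x = p x"
proof -
  note B = brauer_proj_rel[OF p]
  obtain w where w: "w \<in> perfect n" "\<And>s. agrees w s \<longleftrightarrow> (\<exists>t. extend_rel n (proj_rel n p) s t \<and> agrees u t)"
    using perfect_preimage[OF B u] by blast
  have eq: "profile y u = profile y w"
    by (rule profile_forced[OF y B fixp u w(1)]) (use w(2) in \<open>auto simp: forced_def\<close>)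
  have "w x = p x" if "x \<in> P" for x
  proof (rule matching_forced[OF perfectD[OF w(1)]])
    fix s assume "agrees w s"
    then have "agrees p s" using w(2) by (auto simp: extend_rel_def link_rel_def)
    then show "s x = s (p x)" by (simp add: agreesD)
  qed (use that matching_fix_iff[OF p(1), of x] in auto)
  with w(1) eq show ?thesis by (rule that)
qed

text \<open>By \<open>perfect_restrict\<close> only completions of \<open>p\<close> matter, and with
  four defects there are three of them.\<close>

lemma profile_const3:
  assumes y: "y \<in> X" and p: "matching P p" "P \<subseteq> {1..n}" and fixp: "act y (proj_rel n p) = y"
    and F: "points n - P = {a, b, c, d}" "distinct [a, b, c, d]"
    and eq: "profile y (join2 p a b c d) = profile y (join2 p a c b d)"
      "profile y (join2 p a b c d) = profile y (join2 p a d b c)"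
    and u: "u \<in> perfect n"
  shows "profile y u = profile y (join2 p a b c d)"
proof -
  obtain w where w: "w \<in> perfect n" "profile y u = profile y w" "\<And>x. x \<in> P \<Longrightarrow> w x = p x"
    using perfect_restrict[OF y p fixp u] by metis
  have "points n = P \<union> {a, b, c, d}" using F(1) p(2) points_subset[of n] by blast
  moreover have "a \<notin> P" "b \<notin> P" "c \<notin> P" "d \<notin> P" using F(1) by blast+
  ultimately have "w = join2 p a b c d \<or> w = join2 p a c b d \<or> w = join2 p a d b c"
    using perfectD[OF w(1)] w(3) F(2) by (intro join2_cases[OF p(1)]) auto
  then show ?thesis using w(2) eq by auto
qed

text \<open>A point fixed by a projection with four defects recovers that projection: its pairs are
  exactly those whose hook fixes the point, unless the point does not separate perfect
  matchings at all.\<close>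

lemma merge_classes:
  assumes y: "y \<in> X" and p: "matching P p" "P \<subseteq> {1..n}" and card: "card (points n - P) = 4"
    and fixp: "act y (proj_rel n p) = y"
    and x: "x \<in> {1..n}" "x' \<in> {1..n}" "x \<noteq> x'" "p x \<noteq> x'" and fixh: "act y (hook n x x') = y"
    and u: "u \<in> perfect n" and w: "w \<in> perfect n"
  shows "profile y u = profile y w"
proof -
  note B = brauer_proj_rel[OF p]
  have forced: "profile y u = profile y w"
    if "forced n (proj_rel n p) u w" "u \<in> perfect n" "w \<in> perfect n" for u w
    using that by (intro profile_forced[OF y B fixp])
  have forced_hook: "profile y u = profile y w"
    if "forced n (proj_rel n p OO hook n x x') u w" "u \<in> perfect n" "w \<in> perfect n"
      "act y (hook n x x') = y" "x \<in> {1..n}" "x' \<in> {1..n}" "x \<noteq> x'" for u w x x'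
    using that B brauer_hook[of x n x'] fixp
    by (intro profile_forced[OF y brauer_comp[OF B brauer_hook] act_fix_comp[OF y]])
  let ?F = "points n - P"
  have pP: "p v = v \<longleftrightarrow> v \<notin> P" "p v \<in> P \<longleftrightarrow> v \<in> P" for v
    using matching_fix_iff[OF p(1)] matching_in_iff[OF p(1)] by auto
  have ptsP: "v \<in> P \<Longrightarrow> v \<in> points n" for v using p(2) points_subset by blast
  have perf: "join2 p a b c d \<in> perfect n" if "?F = {a, b, c, d}" "distinct [a, b, c, d]" for a b c d
  proof -
    have "points n = P \<union> {a, b, c, d}" using that(1) ptsP by blast
    moreover have "a \<notin> P" "b \<notin> P" "c \<notin> P" "d \<notin> P" using that(1) by blast+
    ultimately show ?thesis unfolding perfect_def using that(2) by (auto intro!: matching_join2[OF p(1)])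
  qed
  have main: "profile y u = profile y w"
    if "?F = {a, b, c, d}" "distinct [a, b, c, d]"
      "profile y (join2 p a b c d) = profile y (join2 p a c b d)"
      "profile y (join2 p a b c d) = profile y (join2 p a d b c)" for a b c d
    using profile_const3[OF y p fixp that] u w by simp
  have one: "profile y u = profile y w"
    if h: "x \<in> {1..n}" "x' \<in> {1..n}" "act y (hook n x x') = y" "x \<in> ?F" "x' \<in> P" for x x'
  proof -
    obtain b c d where F: "?F = {x, b, c, d}" "distinct [x, b, c, d]"
      using card_4_obtain[OF card h(4)] by blast
    have step: "profile y (join2 p x b c d) = profile y (join2 p x d b c)"
      if F: "?F = {x, b, c, d}" "distinct [x, b, c, d]" for b c d
    proof -
      have inF: "v \<in> points n" "p v = v" if "v \<in> {x, b, c, d}" for v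
        using that F(1) pP by blast+
      have ne: "x' \<notin> {x, b, c, d}" "p x' \<notin> {x, b, c, d}" "p x' \<noteq> x'"
        using h(5) F(1) pP by blast+
      let ?p = "p(x' := x', p x' := p x')"
      have p': "matching (P - {x', p x'}) ?p" by (rule matching_unpair[OF p(1) refl])
      let ?q = "?p(x := b, b := x)"
      have q: "matching (P - {x', p x'} \<union> {x, b}) ?q"
        by (rule matching_join[OF p']) (use F pP in auto)
      \<comment> \<open>Pulled back along the projection, \<open>?u\<close> joins \<open>x\<close>
        to \<open>b\<close> directly and \<open>c\<close> to \<open>d\<close> along the path
        \<open>c\<close>, \<open>x'\<close>, \<open>p x'\<close>, \<open>d\<close>. With the hook on
        \<open>x\<close>, \<open>x'\<close> in between, the path from \<open>b\<close> runs below
        through \<open>x\<close> and \<open>x'\<close> to \<open>c\<close>, and above it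
        \<open>x\<close> continues through \<open>x'\<close> and \<open>p x'\<close> to
        \<open>d\<close>.\<close>
      let ?u = "join2 ?q c x' (p x') d"
      have u: "?u \<in> perfect n" unfolding perfect_def mem_Collect_eq
      proof (rule matching_join2[OF q])
        have "points n = P \<union> {x, b, c, d}" using F(1) ptsP by blast
        then show "points n = P - {x', p x'} \<union> {x, b} \<union> {c, x', p x', d}"
          using h(5) pP(2)[of x'] by auto
        show "distinct [c, x', p x', d]" using ne F(2) by auto
        show "c \<notin> P - {x', p x'} \<union> {x, b}" "d \<notin> P - {x', p x'} \<union> {x, b}" using F by auto
        show "x' \<notin> P - {x', p x'} \<union> {x, b}" "p x' \<notin> P - {x', p x'} \<union> {x, b}" using ne by auto
      qed
      have D: "t x = t b" "t c = t x'" "t (p x') = t d" if "agrees ?u t" for t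
      proof -
        show "t c = t x'" "t (p x') = t d"
          using agrees_join2D[OF that] F(2) ne by auto
        show "t x = t b" using agreesD[OF that, of x] F(2) ne by (auto simp: join2_def)
      qed
      have "profile y ?u = profile y (join2 p x b c d)"
      proof (rule forced[OF forced_proj[OF p(2)] u perf[OF F]])
        fix s t assume st: "agrees p s" "agrees p t" "\<And>v. v \<in> points n \<Longrightarrow> p v = v \<Longrightarrow> s v = t v" "agrees ?u t"
        show "agrees (join2 p x b c d) s"
          using D[OF st(4)] st(3)[OF inF] agreesD[OF st(2), of x'] by (intro agrees_join2I[OF st(1)]) auto
      qed
      moreover have "profile y ?u = profile y (join2 p x d b c)"
      proof (rule forced_hook[OF forced_proj_hook[OF p] u perf h(3)])
        fix s t' t assume st: "agrees p s" "agrees p t'"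
          "\<And>v. v \<in> points n \<Longrightarrow> p v = v \<Longrightarrow> s v = t' v" "t' x = t' x'" "t x = t x'"
          "\<And>v. v \<in> points n \<Longrightarrow> v \<noteq> x \<Longrightarrow> v \<noteq> x' \<Longrightarrow> t' v = t v" "agrees ?u t"
        have "s b = t b" "s c = t c" "s d = t d" "s x = t' x" "t' (p x') = t (p x')"
          using st(3)[OF inF] st(6) inF F(2) ne pP h(5) ptsP by auto
        then show "agrees (join2 p x d b c) s"
          using D[OF st(7)] agreesD[OF st(2), of x'] st(4,5) by (intro agrees_join2I[OF st(1)]) auto
      qed (use h F in auto)
      ultimately show ?thesis by simp
    qed
    have "profile y (join2 p x b c d) = profile y (join2 p x d b c)" by (rule step[OF F])
    \<comment> \<open>With \<open>b\<close> and \<open>c\<close> exchanged, the same step links the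
      remaining completion to the same third one.\<close>
    moreover have "profile y (join2 p x c b d) = profile y (join2 p x d c b)"
      by (rule step) (use F in auto)
    moreover have "join2 p x d c b = join2 p x d b c" by (rule join2_sym) (use F in auto)
    ultimately show ?thesis by (intro main[OF F]) auto
  qed
  consider "x \<in> ?F" "x' \<in> ?F" | "x \<in> ?F" "x' \<in> P" | "x \<in> P" "x' \<in> ?F" | "x \<in> P" "x' \<in> P"
    using x points_subset by blast
  then show ?thesis
  proof cases
    case 1
    then obtain c d where F: "?F = {x, x', c, d}" "distinct [x, x', c, d]"
      using card_4_obtain2[OF card] x by metis
    \<comment> \<open>Above, the hook joins \<open>x\<close> to \<open>x'\<close>; below, it closes
      the path \<open>c\<close>, \<open>x\<close>, \<open>x'\<close>, \<open>d\<close>. So this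
      completion is pulled back to the one that contains \<open>{x, x'}\<close>.\<close>
    have step: "profile y (join2 p x c x' d) = profile y (join2 p x x' c d)"
      if F: "?F = {x, x', c, d}" "distinct [x, x', c, d]" for c d
    proof (rule forced_hook[OF forced_proj_hook[OF p x(1-3)] perf perf[OF F] fixh x(1-3)])
      have inF: "v \<in> points n" "p v = v" if "v \<in> {x, x', c, d}" for v
        using that F(1) pP by blast+
      fix s t' t assume st: "agrees p s" "agrees p t'"
        "\<And>v. v \<in> points n \<Longrightarrow> p v = v \<Longrightarrow> s v = t' v" "t' x = t' x'" "t x = t x'"
        "\<And>v. v \<in> points n \<Longrightarrow> v \<noteq> x \<Longrightarrow> v \<noteq> x' \<Longrightarrow> t' v = t v" "agrees (join2 p x c x' d) t"
      have "s x = t' x" "s x' = t' x'" "s c = t c" "s d = t d"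
        using st(3)[OF inF] st(6) inF F(2) by auto
      then show "agrees (join2 p x x' c d) s"
        using agrees_join2D[OF st(7)] F(2) st(4,5) by (intro agrees_join2I[OF st(1)]) auto
    qed (use F in auto)
    have "profile y (join2 p x d x' c) = profile y (join2 p x x' d c)"
      by (rule step) (use F in auto)
    moreover have "join2 p x x' d c = join2 p x x' c d" by (rule join2_sym[OF F(2)])
    ultimately show ?thesis using step[OF F] by (intro main[OF F]) auto
  next
    case 2
    then show ?thesis using x fixh by (intro one[of x x'])
  next
    case 3
    then show ?thesis using x fixh by (intro one[of x' x]) (auto simp: hook_commute)
  next
    case 4
    have "?F \<noteq> {}" using card by (metis card.empty zero_neq_numeral)
    then obtain a where "a \<in> ?F" by blast
    then obtain b c d where F: "?F = {a, b, c, d}" "distinct [a, b, c, d]"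
      using card_4_obtain[OF card] by blast
    have step: "profile y (join2 p a b c d) = profile y (join2 p a c b d)"
      if F: "?F = {a, b, c, d}" "distinct [a, b, c, d]" for a b c d
    proof -
      have inF: "v \<in> points n" "p v = v" if "v \<in> {a, b, c, d}" for v
        using that F(1) pP by blast+
      have ne: "p x \<noteq> x" "p x' \<noteq> x'" "p x' \<noteq> x" "p x \<noteq> p x'"
        using 4 pP x matching_eq_iff[OF p(1)] matching_inv[OF p(1), of x'] by (blast, blast, metis, metis)
      have neF: "x \<notin> {a, b, c, d}" "x' \<notin> {a, b, c, d}" "p x \<notin> {a, b, c, d}" "p x' \<notin> {a, b, c, d}"
        using 4 F(1) pP by blast+
      let ?p = "p(x := x, p x := p x)"
      have p': "matching (P - {x, p x}) ?p" by (rule matching_unpair[OF p(1) refl])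
      have px': "?p x' = p x'" using ne x by auto
      let ?q = "?p(x' := x', p x' := p x')"
      have q: "matching (P - {x, p x} - {x', p x'}) ?q" by (rule matching_unpair[OF p' px'])
      let ?r = "join2 ?q a x (p x) b"
      have r: "matching (P - {x, p x} - {x', p x'} \<union> {a, x, p x, b}) ?r"
      proof (rule matching_join2[OF q])
        have "a \<notin> P" "b \<notin> P" using F(1) by blast+
        then show "a \<notin> P - {x, p x} - {x', p x'}" "b \<notin> P - {x, p x} - {x', p x'}" by blast+
        show "x \<notin> P - {x, p x} - {x', p x'}" "p x \<notin> P - {x, p x} - {x', p x'}" by blast+
        show "distinct [a, x, p x, b]" using F(2) ne neF by auto
      qed simp
      \<comment> \<open>Along the projection, \<open>?u\<close> joins \<open>a\<close> to
        \<open>b\<close> through \<open>x\<close>, \<open>p x\<close>, and \<open>c\<close> to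
        \<open>d\<close> through \<open>x'\<close>, \<open>p x'\<close>. With the hook in between,
        \<open>a\<close> and \<open>c\<close> meet below through \<open>x\<close>,
        \<open>x'\<close>, while \<open>b\<close> and \<open>d\<close> are joined through
        \<open>p x\<close>, \<open>x\<close>, \<open>x'\<close>, \<open>p x'\<close> using the pairs
        above.\<close>
      let ?u = "join2 ?r c x' (p x') d"
      have u: "?u \<in> perfect n" unfolding perfect_def mem_Collect_eq
      proof (rule matching_join2[OF r])
        show "points n = P - {x, p x} - {x', p x'} \<union> {a, x, p x, b} \<union> {c, x', p x', d}"
          using F(1) 4 pP ptsP by auto
        have "c \<notin> P" "d \<notin> P" using F(1) by blast+
        then show "c \<notin> P - {x, p x} - {x', p x'} \<union> {a, x, p x, b}"
          "d \<notin> P - {x, p x} - {x', p x'} \<union> {a, x, p x, b}" using F(2) neF by auto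
        show "distinct [c, x', p x', d]" using F(2) ne neF by auto
        show "x' \<notin> P - {x, p x} - {x', p x'} \<union> {a, x, p x, b}"
          "p x' \<notin> P - {x, p x} - {x', p x'} \<union> {a, x, p x, b}" using x ne neF by auto
      qed
      have D: "t a = t x" "t (p x) = t b" "t c = t x'" "t (p x') = t d" if "agrees ?u t" for t
      proof -
        show "t c = t x'" "t (p x') = t d"
          using agrees_join2D[OF that] F(2) ne neF by auto
        show "t a = t x" "t (p x) = t b"
          using agreesD[OF that, of a] agreesD[OF that, of b] F(2) ne neF x by (auto simp: join2_def)
      qed
      have "profile y ?u = profile y (join2 p a b c d)"
      proof (rule forced[OF forced_proj[OF p(2)] u perf[OF F]])
        fix s t assume st: "agrees p s" "agrees p t" "\<And>v. v \<in> points n \<Longrightarrow> p v = v \<Longrightarrow> s v = t v" "agrees ?u t"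
        show "agrees (join2 p a b c d) s"
          using D[OF st(4)] st(3)[OF inF] agreesD[OF st(2), of x] agreesD[OF st(2), of x']
          by (intro agrees_join2I[OF st(1)]) auto
      qed
      moreover have "profile y ?u = profile y (join2 p a c b d)"
      proof (rule forced_hook[OF forced_proj_hook[OF p x(1-3)] u perf fixh x(1-3)])
        fix s t' t assume st: "agrees p s" "agrees p t'"
          "\<And>v. v \<in> points n \<Longrightarrow> p v = v \<Longrightarrow> s v = t' v" "t' x = t' x'" "t x = t x'"
          "\<And>v. v \<in> points n \<Longrightarrow> v \<noteq> x \<Longrightarrow> v \<noteq> x' \<Longrightarrow> t' v = t v" "agrees ?u t"
        have "s a = t a" "s b = t b" "s c = t c" "s d = t d" 
          "t' (p x) = t (p x)" "t' (p x') = t (p x')"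
          using st(3)[OF inF] st(6) inF neF ne x(4) pP 4 ptsP by auto
        then show "agrees (join2 p a c b d) s"
          using D[OF st(7)] agreesD[OF st(2), of x] agreesD[OF st(2), of x'] st(4,5)
          by (intro agrees_join2I[OF st(1)]) auto
      qed (use F in auto)
      ultimately show ?thesis by simp
    qed
    have "profile y (join2 p a b d c) = profile y (join2 p a d b c)"
      by (rule step) (use F in auto)
    moreover have "join2 p a b d c = join2 p a b c d" by (rule join2_sym[OF F(2)])
    ultimately show ?thesis using step[OF F] by (intro main[OF F]) auto
  qed
qed

lemma act_hook_fixed:
  assumes y: "y \<in> X" and q: "matching Q q" "Q \<subseteq> {1..n}" and fixq: "act y (proj_rel n q) = y"
    and x: "x \<in> Q"
  shows "act y (hook n x (q x)) = y"
proof -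
  have qx: "q x \<noteq> x" "q x \<in> Q" using x matching_fix_iff[OF q(1)] matching_in_iff[OF q(1)] by auto
  have xn: "x \<in> {1..n}" "q x \<in> {1..n}" using x qx q(2) by blast+
  have "act y (hook n x (q x)) = act (act y (proj_rel n q)) (hook n x (q x))" using fixq by simp
  also have "\<dots> = act y (proj_rel n q OO hook n x (q x))"
    using qx by (intro act_comp brauer_proj_rel[OF q] brauer_hook xn y) auto
  also have "proj_rel n q OO hook n x (q x) = proj_rel n q"
    using q x by (intro link_rel_hook) auto
  finally show ?thesis using fixq by simp
qed

text \<open>A nonconstant profile excludes the exceptional case of \<open>merge_classes\<close>, so
  that the pairs of \<open>p\<close> can be read off from the point.\<close>

definition level4 :: "(nat \<Rightarrow> nat) \<Rightarrow> 'x set" where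
  "level4 p = {y \<in> X. act y (proj_rel n p) = y \<and>
     (\<exists>u\<in>perfect n. \<exists>w\<in>perfect n. profile y u \<noteq> profile y w)}"

lemma level4_disjoint:
  assumes p: "matching P p" "P \<subseteq> {1..n}" "card (points n - P) = 4"
    and q: "matching Q q" "Q \<subseteq> {1..n}" "card (points n - Q) = 4"
    and y: "y \<in> level4 p" "y \<in> level4 q"
  shows "p = q"
proof (rule ccontr)
  assume "p \<noteq> q"
  have "card (points n - S) + card S = card (points n)" if "S \<subseteq> {1..n}" for S
  proof -
    have S: "S \<subseteq> points n" using that points_subset by blast
    then have "finite S" using finite_points by (rule finite_subset)
    with S show ?thesis by (simp add: card_Diff_subset card_mono)
  qed
  from this[OF p(2)] this[OF q(2)] have "card P = card Q" using p(3) q(3) by linarith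
  then have "\<exists>x\<in>Q. p x \<noteq> q x"
    using finite_subset[OF p(2)] \<open>p \<noteq> q\<close> by (intro matching_differ[OF p(1) q(1)]) auto
  then obtain x where x: "x \<in> Q" "p x \<noteq> q x" by blast
  have qx: "q x \<noteq> x" "q x \<in> Q" using x matching_fix_iff[OF q(1)] matching_in_iff[OF q(1)] by auto
  have xn: "x \<in> {1..n}" "q x \<in> {1..n}" using x qx q(2) by blast+
  have yX: "y \<in> X" and py: "act y (proj_rel n p) = y" and qy: "act y (proj_rel n q) = y"
    using y by (auto simp: level4_def)
  have "act y (hook n x (q x)) = y" by (rule act_hook_fixed[OF yX q(1,2) qy x(1)])
  then have "profile y u = profile y w" if "u \<in> perfect n" "w \<in> perfect n" for u w
    using that qx(1) by (intro merge_classes[OF yX p py xn _ x(2)]) simp_all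
  with y(1) show False unfolding level4_def by blast
qed

text \<open>The three points come from rotating three of the four defects, fixing \<open>0\<close> if \<open>n\<close> is odd:
  this permutes the three perfect matchings of the defects cyclically.\<close>

lemma level4_card:
  assumes p: "matching P p" "P \<subseteq> {1..n}" "card (points n - P) = 4"
  shows "card (level4 p) \<ge> 3"
proof -
  let ?F = "points n - P"
  \<comment> \<open>No diagram moves \<open>0\<close>, so for odd \<open>n\<close> it has to be the
    defect that the rotation leaves in place.\<close>
  have "\<exists>a\<in>?F. odd n \<longrightarrow> a = 0"
  proof (cases "odd n")
    case True
    then have "0 \<in> ?F" using p(2) by (auto simp: points_def)
    then show ?thesis by blast
  next
    case False
    have "?F \<noteq> {}" using p(3) by (metis card.empty zero_neq_numeral)
    with False show ?thesis by blast
  qed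
  then obtain a where a: "a \<in> ?F" "odd n \<Longrightarrow> a = 0" by blast
  obtain b c d where F: "?F = {a, b, c, d}" "distinct [a, b, c, d]"
    using card_4_obtain[OF p(3) a(1)] by blast
  note pP = matching_fix_iff[OF p(1)] matching_in_iff[OF p(1)]
  have bcd: "b \<in> {1..n} - P" "c \<in> {1..n} - P" "d \<in> {1..n} - P"
  proof -
    have "b \<in> ?F" "c \<in> ?F" "d \<in> ?F" using F(1) by blast+
    moreover have "b \<noteq> 0" "c \<noteq> 0" "d \<noteq> 0" if "odd n" using a(2)[OF that] F(2) by auto
    ultimately show "b \<in> {1..n} - P" "c \<in> {1..n} - P" "d \<in> {1..n} - P" by (auto simp: points_cases)
  qed
  define g where "g = id(b := c, c := d, d := b)"
  have g: "g a = a" "g b = c" "g c = d" "g d = b" using F(2) by (auto simp: g_def)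
  have bij: "bij_betw g ({1..n} - P) ({1..n} - P)"
  proof (rule bij_betw_byWitness[where f' = "id(c := b, d := c, b := d)"])
    show "\<forall>x\<in>{1..n} - P. (id(c := b, d := c, b := d)) (g x) = x"
      "\<forall>x\<in>{1..n} - P. g ((id(c := b, d := c, b := d)) x) = x"
      using F(2) by (auto simp: g_def)
    show "g ` ({1..n} - P) \<subseteq> {1..n} - P" "(id(c := b, d := c, b := d)) ` ({1..n} - P) \<subseteq> {1..n} - P"
      using bcd by (auto simp: g_def)
  qed
  let ?\<rho> = "link_rel n p g p" and ?\<epsilon> = "proj_rel n p"
  have B\<rho>: "brauer n ?\<rho>" using p bij by (intro brauer_link_rel)
  note B = brauer_proj_rel[OF p(1,2)]
  have \<rho>\<epsilon>: "?\<rho> OO ?\<epsilon> = ?\<rho>" using p bij by (intro link_rel_proj)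
  have \<epsilon>\<epsilon>: "?\<epsilon> OO ?\<epsilon> = ?\<epsilon>" using p by (intro link_rel_proj) auto
  let ?m1 = "join2 p a b c d" and ?m2 = "join2 p a c b d" and ?m3 = "join2 p a d b c"
  have perf: "join2 p a x y' w \<in> perfect n" if "{x, y', w} = {b, c, d}" "distinct [x, y', w]" for x y' w
  proof -
    have "points n = P \<union> {a, b, c, d}" using F(1) p(2) points_subset[of n] by blast
    also have "\<dots> = P \<union> {a, x, y', w}" using that by simp
    finally show ?thesis
      unfolding perfect_def using that F p(2)
      by (auto intro!: matching_join2[OF p(1)])
  qed
  have m: "?m1 \<in> perfect n" "?m2 \<in> perfect n" "?m3 \<in> perfect n"
    using F(2) by (auto intro!: perf)
  have rot: "?\<rho> OO min_rel m base = min_rel m' base"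
    if "m \<in> perfect n" "m' \<in> perfect n"
      "\<And>s t. agrees p s \<Longrightarrow> s a = t a \<Longrightarrow> s b = t c \<Longrightarrow> s c = t d \<Longrightarrow> s d = t b \<Longrightarrow> agrees m t \<Longrightarrow> agrees m' s" for m m'
  proof (rule min_rel_left[OF B\<rho> that(1) base that(2)], unfold forced_def, intro allI impI)
    fix s t assume st: "extend_rel n ?\<rho> s t" "agrees m t"
    have fixg: "s v = t (g v)" if "v \<in> {1..n} - P" for v
      using st that pP by (auto simp: extend_rel_def link_rel_def)
    have "s a = t a"
    proof (cases "odd n")
      case True
      then show ?thesis using st a(2) by (auto simp: extend_rel_def)
    next
      case False
      then have "a \<in> {1..n} - P" using a(1) by (auto simp: points_def)
      then show ?thesis using fixg g by metis
    qed
    with fixg[OF bcd(1)] fixg[OF bcd(2)] fixg[OF bcd(3)] g st show "agrees m' s"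
      by (intro that(3)[of s t]) (auto simp: extend_rel_def link_rel_def)
  qed
  have r1: "?\<rho> OO min_rel ?m2 base = min_rel ?m1 base"
    by (rule rot[OF m(2,1)], rule agrees_join2I) (use F(2) in \<open>auto dest: agrees_join2D\<close>)
  have r2: "?\<rho> OO min_rel ?m3 base = min_rel ?m2 base"
    by (rule rot[OF m(3,2)], rule agrees_join2I) (use F(2) in \<open>auto dest: agrees_join2D\<close>)
  have r3: "?\<rho> OO min_rel ?m1 base = min_rel ?m3 base"
    by (rule rot[OF m(1,3)], rule agrees_join2I) (use F(2) in \<open>auto dest: agrees_join2D\<close>)
  have proj: "?\<epsilon> OO min_rel w base = min_rel w base"
    if "w = join2 p a x y' v" "{x, y', v} = {b, c, d}" "distinct [x, y', v]" for w x y' v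
  proof -
    have w: "w \<in> perfect n" using perf that by simp
    have xin: "a \<in> ?F" "x \<in> ?F" "y' \<in> ?F" "v \<in> ?F" using F(1) that(2) by auto
    have ne: "a \<noteq> x" "a \<noteq> y'" "a \<noteq> v" using that(2) F(2) by auto
    show ?thesis
    proof (rule min_rel_left[OF B w base w forced_proj[OF p(2)]])
      fix s t assume st: "agrees p s" "\<And>v. v \<in> points n \<Longrightarrow> p v = v \<Longrightarrow> s v = t v" "agrees w t"
      have "s k = t k" if "k \<in> ?F" for k using st(2)[of k] that pP by auto
      then have "s a = t a" "s x = t x" "s y' = t y'" "s v = t v" using xin by auto
      then show "agrees w s" using st(3) that(1,3) ne agrees_join2D[of p a x y' v t]
        by (auto intro: agrees_join2I[OF st(1)])
    qed
  qed
  have pr: "?\<epsilon> OO min_rel ?m1 base = min_rel ?m1 base" "?\<epsilon> OO min_rel ?m2 base = min_rel ?m2 base"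
    "?\<epsilon> OO min_rel ?m3 base = min_rel ?m3 base"
    using F(2) by (auto intro!: proj)
  have "?m1 \<noteq> ?m2" using F(2) by (auto simp: join2_def fun_eq_iff)
  then have "min_rel ?m1 base \<noteq> min_rel ?m2 base"
    using min_rel_inj[OF m(1,2) base base] by blast
  then obtain x where x: "x \<in> X" "act x (min_rel ?m1 base) \<noteq> act x (min_rel ?m2 base)"
    using faithful[OF brauer_base[OF m(1)] brauer_base[OF m(2)]] by blast
  \<comment> \<open>The three points found below have the rotations of \<open>(e1, e2, e3)\<close>
    as profiles. Two equal rotations would make all entries equal, so \<open>e1\<close> and
    \<open>e2\<close> being different makes the points distinct.\<close>
  define e1 e2 e3 where "e1 = act x (min_rel ?m1 base)" "e2 = act x (min_rel ?m2 base)" "e3 = act x (min_rel ?m3 base)"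
  have e12: "e1 \<noteq> e2" using x by (simp add: e1_e2_e3_def)
  have val: "profile (act x R) w = act x (R OO min_rel w base)" if "brauer n R" "w \<in> perfect n" for R w
    unfolding profile_def by (rule act_comp) (use that brauer_base x in auto)
  let ?y1 = "act x ?\<epsilon>" and ?y2 = "act x ?\<rho>" and ?y3 = "act x (?\<rho> OO ?\<rho>)"
  have B2: "brauer n (?\<rho> OO ?\<rho>)" by (rule brauer_comp[OF B\<rho> B\<rho>])
  have v1: "profile ?y1 ?m1 = e1" "profile ?y1 ?m2 = e2" "profile ?y1 ?m3 = e3"
    by (simp_all add: val[OF B] m pr e1_e2_e3_def)
  have v2: "profile ?y2 ?m1 = e3" "profile ?y2 ?m2 = e1" "profile ?y2 ?m3 = e2"
    by (simp_all add: val[OF B\<rho>] m r1 r2 r3 e1_e2_e3_def)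
  have v3: "profile ?y3 ?m1 = e2" "profile ?y3 ?m2 = e3" "profile ?y3 ?m3 = e1"
    by (simp_all add: val[OF B2] m r1 r2 r3 e1_e2_e3_def relcompp_assoc)
  \<comment> \<open>A nonconstant profile also shows that the point is not \<open>z\<close>, whose
    profile is constant.\<close>
  have in4: "act x R \<in> level4 p"
    if R: "brauer n R" "R OO ?\<epsilon> = R" and u: "u \<in> perfect n" "w \<in> perfect n" "profile (act x R) u \<noteq> profile (act x R) w" for R u w
  proof -
    have "act x R \<noteq> z" using u profile_z by metis
    then have "act x R \<in> X" using act_in[OF x(1) R(1)] by blast
    moreover have "act (act x R) ?\<epsilon> = act x R" using act_comp[OF R(1) B x(1)] R(2) by simp
    ultimately show ?thesis using u unfolding level4_def by blast
  qed
  have "?y1 \<in> level4 p" by (rule in4[OF B \<epsilon>\<epsilon> m(1,2)]) (use v1 e12 in simp)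
  moreover have "?y2 \<in> level4 p" by (rule in4[OF B\<rho> \<rho>\<epsilon> m(2,3)]) (use v2 e12 in simp)
  moreover have "?y3 \<in> level4 p"
    by (rule in4[OF B2 _ m(1,3)]) (use v3 e12 \<rho>\<epsilon> in \<open>auto simp: relcompp_assoc\<close>)
  moreover have "?y1 \<noteq> ?y2" using v1 v2 e12 by metis
  moreover have "?y1 \<noteq> ?y3" using v1 v3 e12 by metis
  moreover have "?y2 \<noteq> ?y3" using v2 v3 e12 by metis
  ultimately have "{?y1, ?y2, ?y3} \<subseteq> level4 p" "card {?y1, ?y2, ?y3} = 3" by auto
  moreover have "finite (level4 p)" using fin by (simp add: level4_def)
  ultimately show ?thesis by (metis card_mono)
qed

end

section \<open>Projections with two defects\<close>

definition swap_rel :: "nat \<Rightarrow> (nat \<Rightarrow> nat) \<Rightarrow> (nat \<Rightarrow> bool) \<Rightarrow> (nat \<Rightarrow> bool) \<Rightarrow> bool" where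
  "swap_rel n p s r \<longleftrightarrow> agrees p s \<and> agrees p r \<and>
     (\<forall>x\<in>{1..n}. \<forall>y\<in>{1..n}. p x = x \<longrightarrow> p y = y \<longrightarrow> x \<noteq> y \<longrightarrow> s x = r y)"

text \<open>Names the defects in some order. \<open>swap_rel\<close> is phrased without the names,
  so that \<open>level2\<close> depends on \<open>p\<close> alone.\<close>

locale two_defects =
  fixes n :: nat and P :: "nat set" and p :: "nat \<Rightarrow> nat" and a b :: nat
  assumes p: "matching P p" and P: "P \<subseteq> {1..n}" and ab: "{1..n} - P = {a, b}" "a \<noteq> b"
begin

lemma ab_in: "a \<in> {1..n}" "b \<in> {1..n}" "a \<notin> P" "b \<notin> P" "p a = a" "p b = b"
  using ab p by (auto simp: matching_fix_iff)

lemma fixed_iff: "x \<in> {1..n} \<Longrightarrow> p x = x \<longleftrightarrow> x = a \<or> x = b"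
  using ab matching_fix_iff[OF p, of x] by blast

lemma proj_rel_iff: "proj_rel n p s r \<longleftrightarrow> agrees p s \<and> agrees p r \<and> s a = r a \<and> s b = r b"
  unfolding link_rel_def using fixed_iff ab_in by auto

lemma swap_rel_iff: "swap_rel n p s r \<longleftrightarrow> agrees p s \<and> agrees p r \<and> s a = r b \<and> s b = r a"
  unfolding swap_rel_def using fixed_iff ab_in ab(2) by auto

lemma brauer_swap_rel: "brauer n (swap_rel n p)"
proof -
  have "swap_rel n p = link_rel n p (id(a := b, b := a)) p"
    unfolding link_rel_def swap_rel_iff[abs_def] using fixed_iff ab_in ab(2) by (auto simp: fun_eq_iff)
  moreover have "bij_betw (id(a := b, b := a)) ({1..n} - P) ({1..n} - P)"
    unfolding ab(1) using ab(2) by (auto simp: bij_betw_def inj_on_def)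
  ultimately show ?thesis using brauer_link_rel[OF p p P P] by simp
qed

lemma brauer_proj: "brauer n (proj_rel n p)"
  by (rule brauer_proj_rel[OF p P])

lemma swap_proj_comp:
  "swap_rel n p OO swap_rel n p = proj_rel n p" "swap_rel n p OO proj_rel n p = swap_rel n p"
  "proj_rel n p OO swap_rel n p = swap_rel n p" "proj_rel n p OO proj_rel n p = proj_rel n p"
proof -
  show "swap_rel n p OO swap_rel n p = proj_rel n p"
    by (rule brauer_rel_eq[OF brauer_comp[OF brauer_swap_rel brauer_swap_rel] brauer_proj])
      (auto simp: swap_rel_iff proj_rel_iff)
  show "swap_rel n p OO proj_rel n p = swap_rel n p"
    by (rule brauer_rel_eq[OF brauer_comp[OF brauer_swap_rel brauer_proj] brauer_swap_rel])
      (auto simp: swap_rel_iff proj_rel_iff)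
  show "proj_rel n p OO swap_rel n p = swap_rel n p"
    by (rule brauer_rel_eq[OF brauer_comp[OF brauer_proj brauer_swap_rel] brauer_swap_rel])
      (auto simp: swap_rel_iff proj_rel_iff)
  show "proj_rel n p OO proj_rel n p = proj_rel n p"
    by (rule brauer_rel_eq[OF brauer_comp[OF brauer_proj brauer_proj] brauer_proj])
      (auto simp: proj_rel_iff)
qed

lemma proj_neq_swap: "proj_rel n p \<noteq> swap_rel n p"
proof
  assume eq: "proj_rel n p = swap_rel n p"
  have "agrees p (\<lambda>x. x = a)"
    using ab_in(5) matching_inv[OF p] unfolding agrees_def by metis
  then have "proj_rel n p (\<lambda>x. x = a) (\<lambda>x. x = a)" by (simp add: proj_rel_iff)
  then show False using ab(2) unfolding eq by (simp add: swap_rel_iff)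
qed

text \<open>Exchanging two equal labels has no effect.\<close>

lemma swap_proj_absorb:
  assumes "\<And>s t. Q s t \<Longrightarrow> agrees p t \<Longrightarrow> t a = t b"
  shows "Q OO swap_rel n p = Q OO proj_rel n p"
  using assms by (intro ext) (auto simp: relcompp_apply swap_rel_iff proj_rel_iff)

end

lemma two_defects_sym: "two_defects n P p a b \<Longrightarrow> two_defects n P p b a"
  by (auto simp: two_defects_def)

lemma partial_matchings_2:
  assumes "p \<in> partial_matchings n 2"
  obtains P a b where "two_defects n P p a b"
proof -
  obtain P where P: "P \<subseteq> {1..n}" "card P + 2 = n" "matching P p"
    using assms by (auto simp: partial_matchings_def)
  then have "card ({1..n} - P) = 2"
    by (metis add_diff_cancel_left' card_Diff_subset card_atLeastAtMost diff_Suc_1 finite_atLeastAtMost finite_subset)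
  then obtain a b where "{1..n} - P = {a, b}" "a \<noteq> b" by (auto simp: card_2_iff)
  with P that show ?thesis by (auto simp: two_defects_def)
qed

context brauer_action
begin

definition level2 :: "(nat \<Rightarrow> nat) \<Rightarrow> 'x set" where
  "level2 p = {y \<in> X. act y (proj_rel n p) = y \<and> act y (swap_rel n p) \<noteq> y}"

text \<open>If \<open>Q\<close> joins the two defects on its lower side, then after \<open>Q\<close>
  the swap acts like the projection, which fixes \<open>y\<close>; but the swap moves
  \<open>y\<close>.\<close>

lemma level2_absurd:
  assumes "two_defects n P p a b" "y \<in> level2 p" "brauer n Q" "act y Q = y"
    and "\<And>s t. Q s t \<Longrightarrow> agrees p t \<Longrightarrow> t a = t b"
  shows False
proof -
  interpret two_defects n P p a b by fact
  have y: "y \<in> X" "act y (proj_rel n p) = y" "act y (swap_rel n p) \<noteq> y"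
    using assms(2) by (auto simp: level2_def)
  have "act y (swap_rel n p) = act (act y Q) (swap_rel n p)" using assms(4) by simp
  also have "\<dots> = act y (Q OO swap_rel n p)" by (rule act_comp[OF assms(3) brauer_swap_rel y(1)])
  also have "\<dots> = act y (Q OO proj_rel n p)" using swap_proj_absorb[of Q, OF assms(5)] by simp
  also have "\<dots> = act (act y Q) (proj_rel n p)" by (rule act_comp[OF assms(3) brauer_proj y(1), symmetric])
  also have "\<dots> = y" using y assms(4) by simp
  finally show False using y(3) by simp
qed

text \<open>A hook on any other pair, combined with diagrams that fix \<open>y\<close> anyway, would
  join the two defects below, against \<open>level2_absurd\<close>. Hence \<open>y\<close>
  determines the pairs of \<open>p\<close>.\<close>

lemma level2_hook:
  assumes td: "two_defects n P p a b" and y: "y \<in> level2 p"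
    and x: "x \<in> {1..n}" "x' \<in> {1..n}" "x \<noteq> x'" and h: "act y (hook n x x') = y"
  shows "p x = x'"
proof (rule ccontr)
  assume ne: "p x \<noteq> x'"
  have yX: "y \<in> X" and yp: "act y (proj_rel n p) = y" using y by (auto simp: level2_def)
  have absorb: "act y R = y" if "brauer n R" "proj_rel n p OO R = proj_rel n p" "brauer n (proj_rel n p)" for R
    using act_comp[OF that(3,1) yX] that(2) yp by simp
  have one: False
    if td: "two_defects n P p a b" and x': "x' \<in> P" and h: "act y (hook n a x') = y" for a b x'
  proof -
    interpret two_defects n P p a b by fact
    have q: "p x' \<noteq> x'" "p x' \<in> P" "x' \<in> {1..n}" "p x' \<in> {1..n}"
      using x' matching_fix_iff[OF p] matching_in_iff[OF p] P by blast+
    have d: "a \<noteq> x'" "b \<noteq> x'" "a \<noteq> p x'" "b \<noteq> p x'" using q x' ab_in by auto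
    note B1 = brauer_hook[OF ab_in(1) q(3) d(1)]
    \<comment> \<open>This factor continues the path \<open>a\<close>, \<open>x'\<close> through
      \<open>p x'\<close> to \<open>b\<close>. Preceded by the projection it straightens to the
      projection, so it fixes \<open>y\<close> as well.\<close>
    note B2 = brauer_comp[OF brauer_hook[OF q(4) ab_in(2) d(4)[symmetric]] brauer_proj]
    have fix2: "act y (hook n (p x') b OO proj_rel n p) = y"
    proof (rule absorb[OF B2 _ brauer_proj], rule brauer_rel_eq[OF brauer_comp[OF brauer_proj B2] brauer_proj])
      fix s r assume "(proj_rel n p OO hook n (p x') b OO proj_rel n p) s r"
      then obtain t u where h: "proj_rel n p s t" "hook n (p x') b t u" "proj_rel n p u r" by blast
      have "t a = u a" "t x' = u x'" using h(2) ab_in q d ab(2) by (auto simp: hook_def)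
      moreover have "t b = t (p x')" "u b = u (p x')" using h(2) by (auto simp: hook_def)
      moreover have "t (p x') = t x'" "u (p x') = u x'" using h by (auto simp: proj_rel_iff agreesD)
      ultimately show "proj_rel n p s r" using h(1,3) by (auto simp: proj_rel_iff)
    qed
    show False
    proof (rule level2_absurd[OF td y brauer_comp[OF B1 B2] act_fix_comp[OF yX B1 B2 h fix2]])
      fix s t assume "(hook n a x' OO hook n (p x') b OO proj_rel n p) s t"
      then obtain u w where h: "hook n a x' s u" "hook n (p x') b u w" "proj_rel n p w t" by blast
      have "u a = u x'" "w (p x') = w b" using h by (auto simp: hook_def)
      moreover have "u a = w a" "u x' = w x'" using h(2) ab_in q d ab(2) by (auto simp: hook_def)
      moreover have "w (p x') = w x'" "w a = t a" "w b = t b" using h(3) by (auto simp: proj_rel_iff agreesD)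
      ultimately show "t a = t b" by simp
    qed
  qed
  interpret two_defects n P p a b by fact
  have "x = a \<or> x = b \<or> x \<in> P" "x' = a \<or> x' = b \<or> x' \<in> P" using x ab(1) by blast+
  then consider "{x, x'} = {a, b}" | "x = a" "x' \<in> P" | "x = b" "x' \<in> P"
    | "x' = a" "x \<in> P" | "x' = b" "x \<in> P" | "x \<in> P" "x' \<in> P" using x(3) by blast
  then show False
  proof cases
    case 1
    show False
      by (rule level2_absurd[OF td y brauer_hook[OF x] h]) (use 1 in \<open>auto simp: hook_def doubleton_eq_iff\<close>)
  next
    case 2
    then show False using one[OF td] h by simp
  next
    case 3
    then show False using one[OF two_defects_sym[OF td]] h by simp
  next
    case 4
    then show False using one[OF td] h hook_commute[of n x x'] by simp
  next
    case 5
    then show False using one[OF two_defects_sym[OF td]] h hook_commute[of n x x'] by simp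
  next
    case 6
    have q: "p x \<noteq> x" "p x' \<noteq> x'" "p x \<in> P" "p x' \<in> P"
      using 6 matching_fix_iff[OF p] matching_in_iff[OF p] by blast+
    have qn: "p x \<in> {1..n}" "p x' \<in> {1..n}" using q P by blast+
    have d: "a \<noteq> x" "b \<noteq> x'" "b \<noteq> x" "a \<noteq> x'" "a \<noteq> p x" "a \<noteq> p x'" "b \<noteq> p x" "b \<noteq> p x'" "p x' \<noteq> x" "p x \<noteq> p x'"
      using 6 q ab_in x(3) ne matching_eq_iff[OF p] matching_inv[OF p, of x'] by (blast, blast, blast, blast, blast, blast, blast, blast, metis, metis)
    note H0 = brauer_hook[OF x] and H1 = brauer_hook[OF ab_in(1) x(1) d(1)]
      and H2 = brauer_hook[OF ab_in(2) x(2) d(2)]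
    \<comment> \<open>The hooks to \<open>a\<close> and \<open>b\<close> draw the pairs of
      \<open>x\<close> and \<open>x'\<close> into the two transversals. Preceded by the projection
      alone this straightens, so it fixes \<open>y\<close>. With the hook on \<open>x\<close>,
      \<open>x'\<close> in front, the path from \<open>a\<close> runs through \<open>x\<close> and
      \<open>p x\<close>, across that hook to \<open>p x'\<close>, and through \<open>x'\<close> to
      \<open>b\<close>.\<close>
    note B2 = brauer_comp[OF H1 brauer_comp[OF H2 brauer_proj]]
    have fix2: "act y (hook n a x OO hook n b x' OO proj_rel n p) = y"
    proof (rule absorb[OF B2 _ brauer_proj], rule brauer_rel_eq[OF brauer_comp[OF brauer_proj B2] brauer_proj])
      fix s r assume "(proj_rel n p OO hook n a x OO hook n b x' OO proj_rel n p) s r"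
      then obtain t u w where h: "proj_rel n p s t" "hook n a x t u" "hook n b x' u w" "proj_rel n p w r" by blast
      have "t b = u b" "t x' = u x'" "t (p x) = u (p x)" "t (p x') = u (p x')"
        using hook_other[OF h(2)] ab_in(1,2) qn x(1,2) d ab(2) q ne by metis+
      moreover have "u a = w a" "u x = w x" "u (p x) = w (p x)" "u (p x') = w (p x')"
        using hook_other[OF h(3)] ab_in(1,2) qn x(1,2) d ab(2) x(3) ne q by metis+
      moreover have "t a = t x" "u a = u x" "u b = u x'" "w b = w x'" using h(2,3) by (auto simp: hook_def)
      moreover have "t (p x) = t x" "t (p x') = t x'" "w (p x) = w x" "w (p x') = w x'"
        using h(1,4) by (auto simp: proj_rel_iff agreesD)
      ultimately show "proj_rel n p s r" using h(1,4) by (auto simp: proj_rel_iff)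
    qed
    note B01 = brauer_comp[OF brauer_proj H0]
    have fix1: "act y (proj_rel n p OO hook n x x') = y" by (rule act_fix_comp[OF yX brauer_proj H0 yp h])
    show False
    proof (rule level2_absurd[OF td y brauer_comp[OF B01 B2] act_fix_comp[OF yX B01 B2 fix1 fix2]])
      fix s t' assume "((proj_rel n p OO hook n x x') OO hook n a x OO hook n b x' OO proj_rel n p) s t'"
      then obtain v t u w where h: "proj_rel n p s v" "hook n x x' v t" "hook n a x t u" "hook n b x' u w" "proj_rel n p w t'"
        by blast
      have "v x = v x'" using h(2) by (simp add: hook_def)
      moreover have "v (p x) = t (p x)" "v (p x') = t (p x')"
        using hook_other[OF h(2)] qn q ne d by metis+
      moreover have "t (p x) = u (p x)" "t (p x') = u (p x')"
        using hook_other[OF h(3)] qn q ne d by metis+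
      moreover have "u a = w a" "u x = w x" "u (p x) = w (p x)" "u (p x') = w (p x')"
        using hook_other[OF h(4)] ab_in(1,2) qn x(1,2) d ab(2) x(3) ne q by metis+
      moreover have "u a = u x" "w b = w x'" using h(3,4) by (auto simp: hook_def)
      moreover have "v (p x) = v x" "v (p x') = v x'" "w (p x) = w x" "w (p x') = w x'" "w a = t' a" "w b = t' b"
        using h(1,5) by (auto simp: proj_rel_iff agreesD)
      ultimately show "t' a = t' b" by simp
    qed
  qed
qed

lemma level2_disjoint:
  assumes p: "p \<in> partial_matchings n 2" and q: "q \<in> partial_matchings n 2"
    and y: "y \<in> level2 p" "y \<in> level2 q"
  shows "p = q"
proof (rule ccontr)
  assume "p \<noteq> q"
  obtain P a b where td: "two_defects n P p a b" using p by (rule partial_matchings_2)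
  obtain P' where P': "P' \<subseteq> {1..n}" "card P' + 2 = n" "matching P' p"
    using p by (auto simp: partial_matchings_def)
  obtain Q where Q: "Q \<subseteq> {1..n}" "card Q + 2 = n" "matching Q q"
    using q by (auto simp: partial_matchings_def)
  have "\<exists>x\<in>Q. p x \<noteq> q x"
    using finite_subset[OF P'(1)] P'(2) Q(2) \<open>p \<noteq> q\<close> by (intro matching_differ[OF P'(3) Q(3)]) auto
  then obtain x where x: "x \<in> Q" "p x \<noteq> q x" by blast
  have "act y (hook n x (q x)) = y"
    by (rule act_hook_fixed[OF _ Q(3,1) _ x(1)]) (use y in \<open>auto simp: level2_def\<close>)
  moreover have "q x \<noteq> x" "q x \<in> Q" using x matching_fix_iff[OF Q(3)] matching_in_iff[OF Q(3)] by auto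
  moreover have "x \<in> {1..n}" "q x \<in> {1..n}" using calculation x Q(1) by blast+
  ultimately have "p x = q x" by (intro level2_hook[OF td y(1)]) simp_all
  with x show False by simp
qed

lemma level2_card:
  assumes "p \<in> partial_matchings n 2"
  shows "card (level2 p) \<ge> 2"
proof -
  obtain P a b where "two_defects n P p a b" using assms by (rule partial_matchings_2)
  then interpret two_defects n P p a b .
  obtain x where x: "x \<in> X" "act x (proj_rel n p) \<noteq> act x (swap_rel n p)"
    using faithful[OF brauer_proj brauer_swap_rel] proj_neq_swap by blast
  let ?y = "act x (proj_rel n p)" and ?y' = "act x (swap_rel n p)"
  have c: "act ?y (proj_rel n p) = ?y" "act ?y (swap_rel n p) = ?y'"
    "act ?y' (proj_rel n p) = ?y'" "act ?y' (swap_rel n p) = ?y"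
    using act_comp[OF brauer_proj brauer_proj x(1)] act_comp[OF brauer_proj brauer_swap_rel x(1)]
      act_comp[OF brauer_swap_rel brauer_proj x(1)] act_comp[OF brauer_swap_rel brauer_swap_rel x(1)]
    by (simp_all only: swap_proj_comp)
  \<comment> \<open>The swap exchanges the two different points, while every diagram fixes
    \<open>z\<close>.\<close>
  have "?y \<noteq> z" using c(2) x(2) act_z[OF brauer_swap_rel] by metis
  moreover have "?y' \<noteq> z" using c(4) x(2) act_z[OF brauer_swap_rel] by metis
  ultimately have "?y \<in> X" "?y' \<in> X"
    using act_in[OF x(1) brauer_proj] act_in[OF x(1) brauer_swap_rel] by blast+
  then have "{?y, ?y'} \<subseteq> level2 p" using c x(2) by (auto simp: level2_def)
  moreover have "finite (level2 p)" using fin by (simp add: level2_def)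
  ultimately have "card {?y, ?y'} \<le> card (level2 p)" by (rule card_mono[rotated])
  then show ?thesis using x(2) by simp
qed

text \<open>For even \<open>n\<close> the two defects are the only points that the pairs of
  \<open>p\<close> leave over, so the perfect completion is unique.\<close>

lemma two_defects_perfect:
  assumes td: "two_defects n P p a b" and "even n" and w: "w \<in> perfect n" and wp: "\<And>x. x \<in> P \<Longrightarrow> w x = p x"
  shows "w a = b"
proof -
  interpret two_defects n P p a b by fact
  have pts: "points n = {1..n}" using \<open>even n\<close> by (simp add: points_def)
  have "w a \<noteq> a" "w a \<in> {1..n}"
    using matching_fix_iff[OF perfectD[OF w], of a] matching_in_iff[OF perfectD[OF w], of a] ab_in pts by auto
  moreover have "w a \<notin> P"
  proof
    assume "w a \<in> P"
    then have "p (w a) = a" using wp perfectD[OF w] by (metis matching_inv)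
    with \<open>w a \<in> P\<close> show False using matching_in_iff[OF p, of "w a"] ab_in by simp
  qed
  ultimately show ?thesis using ab(1) by blast
qed

text \<open>By \<open>perfect_restrict\<close> only completions of \<open>p\<close> matter, and
  there is just one. The constant profile keeps these points out of \<open>level4\<close>.\<close>

lemma level2_profile:
  assumes p: "p \<in> partial_matchings n 2" and "even n" and y: "y \<in> level2 p"
    and u: "u \<in> perfect n" and w: "w \<in> perfect n"
  shows "profile y u = profile y w"
proof -
  obtain P a b where td: "two_defects n P p a b" using p by (rule partial_matchings_2)
  interpret two_defects n P p a b by fact
  have yX: "y \<in> X" "act y (proj_rel n p) = y" using y by (auto simp: level2_def)
  obtain u' where u': "u' \<in> perfect n" "profile y u = profile y u'" "\<And>x. x \<in> P \<Longrightarrow> u' x = p x"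
    using perfect_restrict[OF yX(1) p P yX(2) u] by metis
  obtain w' where w': "w' \<in> perfect n" "profile y w = profile y w'" "\<And>x. x \<in> P \<Longrightarrow> w' x = p x"
    using perfect_restrict[OF yX(1) p P yX(2) w] by metis
  have "u' = w'"
  proof (rule matching_eq_off_pair[OF perfectD[OF u'(1)] perfectD[OF w'(1)], of a])
    fix x assume "x \<notin> {a, u' a}"
    then have "x \<notin> {a, b}" using two_defects_perfect[OF td \<open>even n\<close> u'(1,3)] by simp
    moreover have "points n = {1..n}" using \<open>even n\<close> by (simp add: points_def)
    ultimately consider "x \<in> P" | "x \<notin> points n" using ab(1) by blast
    then show "u' x = w' x"
    proof cases
      case 2
      then show ?thesis using matching_fix_iff[OF perfectD[OF u'(1)]] matching_fix_iff[OF perfectD[OF w'(1)]] by metis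
    qed (use u' w' in simp)
  qed
  with u' w' show ?thesis by simp
qed

section \<open>Points fixed by an element of the minimal ideal\<close>

definition level0 :: "'x set" where
  "level0 = {y \<in> X. \<exists>u\<in>perfect n. \<exists>v\<in>perfect n. act y (min_rel u v) = y}"

text \<open>In a rectangular band, a factor in front absorbs the left factor of what
  follows.\<close>

lemma level0_profile:
  assumes y: "y \<in> level0" and u: "u \<in> perfect n" and w: "w \<in> perfect n"
  shows "profile y u = profile y w"
proof -
  obtain u0 v0 where uv: "u0 \<in> perfect n" "v0 \<in> perfect n" "act y (min_rel u0 v0) = y" and yX: "y \<in> X"
    using y by (auto simp: level0_def)
  have "profile y w' = act y (min_rel u0 base)" if w': "w' \<in> perfect n" for w'
  proof -
    have "profile y w' = act (act y (min_rel u0 v0)) (min_rel w' base)" using uv by (simp add: profile_def)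
    also have "\<dots> = act y (min_rel u0 v0 OO min_rel w' base)"
      by (rule act_comp[OF brauer_min_rel[OF uv(1,2)] brauer_base[OF w'] yX])
    finally show ?thesis using min_rel_comp[OF uv(1,2) w' base] by simp
  qed
  from this[OF u] this[OF w] show ?thesis by simp
qed

text \<open>Multiplying \<open>min_rel u v\<close> by the projection still fixes \<open>y\<close>.
  For even \<open>n\<close> the new right factor contains the pair \<open>{a, b}\<close>, so the
  product joins the defects, against \<open>level2_absurd\<close>.\<close>

lemma level0_level2:
  assumes p: "p \<in> partial_matchings n 2" and "even n" and y: "y \<in> level2 p" "y \<in> level0"
  shows False
proof -
  obtain P a b where td: "two_defects n P p a b" using p by (rule partial_matchings_2)
  interpret two_defects n P p a b by fact
  obtain u v where uv: "u \<in> perfect n" "v \<in> perfect n" "act y (min_rel u v) = y" and yX: "y \<in> X"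
    using y(2) by (auto simp: level0_def)
  obtain w where w: "w \<in> perfect n" "\<And>r. agrees w r \<longleftrightarrow> (\<exists>t. agrees v t \<and> extend_rel n (proj_rel n p) t r)"
    using perfect_image[OF brauer_proj uv(2)] by metis
  have E: "min_rel u v OO proj_rel n p = min_rel u w"
    by (rule min_rel_right[OF brauer_proj uv(1,2) w(1)]) (use w(2) in auto)
  have "w x = p x" if "x \<in> P" for x
  proof (rule matching_forced[OF perfectD[OF w(1)]])
    fix s assume "agrees w s"
    then have "agrees p s" using w(2) by (auto simp: extend_rel_def proj_rel_iff)
    then show "s x = s (p x)" by (simp add: agreesD)
  qed (use that matching_fix_iff[OF p(1), of x] in auto)
  then have wa: "w a = b" by (intro two_defects_perfect[OF td \<open>even n\<close> w(1)])
  have yp: "act y (proj_rel n p) = y" using y(1) by (simp add: level2_def)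
  have "act y (min_rel u w) = y"
    using act_fix_comp[OF yX brauer_min_rel[OF uv(1,2)] brauer_proj uv(3) yp] E by simp
  then show False
  proof (rule level2_absurd[OF td y(1) brauer_min_rel[OF uv(1) w(1)]])
    fix s t assume "min_rel u w s t"
    then have "t (w a) = t a" by (rule min_rel_target) (use ab_in wa in auto)
    then show "t a = t b" using wa by simp
  qed
qed

end

section \<open>Switches and the connectedness of perfect matchings\<close>

definition switch :: "(nat \<Rightarrow> nat) \<Rightarrow> nat \<Rightarrow> nat \<Rightarrow> nat \<Rightarrow> nat" where
  "switch u a c = u(u a := u c, u c := u a, a := c, c := a)"

lemma switch_perfect:
  "u \<in> perfect n \<Longrightarrow> a \<in> points n \<Longrightarrow> c \<in> points n \<Longrightarrow> a \<noteq> c \<Longrightarrow> switch u a c \<in> perfect n"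
  unfolding perfect_def switch_def by (simp add: matching_switch)

lemma switch_commute:
  assumes "matching A u" "a \<noteq> c" "u a \<noteq> c"
  shows "switch u a c = switch u c a"
proof -
  have "u a \<noteq> u c" "u c \<noteq> a" using assms by (metis matching_inv)+
  then show ?thesis using assms by (auto simp: switch_def)
qed

lemma switch_partner: "matching A u \<Longrightarrow> switch u a (u a) = u"
  by (auto simp: switch_def)

text \<open>Three switches at \<open>e\<close> produce in turn the pairs \<open>{e, x}\<close>, then
  \<open>{x, y}\<close> together with \<open>{e, u y}\<close>, and finally \<open>{e, u e}\<close>
  again together with \<open>{u x, u y}\<close>. Coinciding positions are handled separately in
  \<open>switch_invariant_const\<close>.\<close>

lemma switch_via:
  assumes u: "matching A u" and A: "{e, x, y} \<subseteq> A" and ne: "distinct [e, u e, x, u x, y, u y]"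
  shows "switch u x y = switch (switch (switch u e x) e (u y)) e (u e)"
proof -
  have inv: "u (u v) = v" for v using u by simp
  have 1: "switch u e x = u(u e := u x, u x := u e, e := x, x := e)" by (simp add: switch_def)
  have 2: "switch (switch u e x) e (u y) = u(u e := u x, u x := u e, x := y, y := x, e := u y, u y := e)"
    unfolding 1 using ne inv by (auto simp: switch_def)
  show ?thesis unfolding 2 using ne inv by (auto simp: switch_def)
qed

text \<open>Perfect matchings are connected under switches at one fixed point. This is what forces a
  right congruence on them to be trivial or universal.\<close>

lemma switch_invariant_const:
  assumes e: "e \<in> points n"
    and f: "\<And>u c. u \<in> perfect n \<Longrightarrow> c \<in> points n \<Longrightarrow> c \<noteq> e \<Longrightarrow> f (switch u e c) = f u"
    and u: "u \<in> perfect n" and w: "w \<in> perfect n"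
  shows "f u = f w"
proof -
  have sw: "f (switch u x y) = f u"
    if u: "u \<in> perfect n" and x: "x \<in> points n" and y: "y \<in> points n" and xy: "x \<noteq> y" for u x y
  proof -
    note m = perfectD[OF u]
    have inv: "u (u v) = v" for v using m by simp
    have inP: "u v \<in> points n" if "v \<in> points n" for v using matching_in_iff[OF m] that by simp
    have nf: "u v \<noteq> v" if "v \<in> points n" for v using matching_fix_iff[OF m] that by simp
    consider "y = u x" | "y \<noteq> u x" "x = e" | "y \<noteq> u x" "y = e" | "y \<noteq> u x" "x = u e" "y \<noteq> e"
      | "y \<noteq> u x" "y = u e" "x \<noteq> e" | "y \<noteq> u x" "x \<noteq> e" "y \<noteq> e" "x \<noteq> u e" "y \<noteq> u e" by blast
    then show ?thesis
    proof cases
      case 1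
      then show ?thesis using switch_partner[OF m] by simp
    next
      case 2
      then show ?thesis using f[OF u y] xy by simp
    next
      case 3
      then show ?thesis using f[OF u x] xy switch_commute[OF m xy] by simp
    next
      case 4
      then have d: "u y \<noteq> e" "u y \<noteq> u e" using inv xy by metis+
      then have "switch u x y = switch u e (u y)"
        using 4 inv xy nf[OF e] nf[OF y] by (auto simp: switch_def fun_eq_iff)
      then show ?thesis using f[OF u inP[OF y]] d by simp
    next
      case 5
      then have d: "u x \<noteq> e" "u x \<noteq> u e" using inv xy by metis+
      then have "switch u x y = switch u e (u x)"
        using 5 inv xy nf[OF e] nf[OF x] by (auto simp: switch_def fun_eq_iff)
      then show ?thesis using f[OF u inP[OF x]] d by simp
    next
      case 6
      have "u x \<noteq> e" "u y \<noteq> e" "u x \<noteq> u e" "u y \<noteq> u e" "u x \<noteq> u y" "u y \<noteq> x"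
        using 6 inv xy by metis+
      then have ne: "distinct [e, u e, x, u x, y, u y]"
        using 6 xy nf[OF e] nf[OF x] nf[OF y] by auto
      have c: "u y \<noteq> e" "u e \<noteq> e" using ne by auto
      have u1: "switch u e x \<in> perfect n" using switch_perfect[OF u e x] 6 by simp
      have u2: "switch (switch u e x) e (u y) \<in> perfect n"
        using switch_perfect[OF u1 e inP[OF y]] c by simp
      show ?thesis
        using switch_via[OF m _ ne] e x y f[OF u x] f[OF u1 inP[OF y] c(1)] f[OF u2 inP[OF e] c(2)] 6 by simp
    qed
  qed
  show ?thesis using u
  proof (induction "card {x \<in> points n. u x \<noteq> w x}" arbitrary: u rule: less_induct)
    case less
    note m = perfectD[OF less.prems] and mw = perfectD[OF w]
    show ?case
    proof (cases "u = w")
      case False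
      then obtain x where x: "u x \<noteq> w x" by blast
      then have xP: "x \<in> points n" using matching_fix_iff[OF m] matching_fix_iff[OF mw] by metis
      have wxP: "w x \<in> points n" "x \<noteq> w x"
        using xP matching_in_iff[OF mw] matching_fix_iff[OF mw, of x] by auto
      \<comment> \<open>This creates a pair of \<open>w\<close> and destroys none, so fewer points
        of disagreement remain.\<close>
      let ?u = "switch u x (w x)"
      have inv: "u (u v) = v" "w (w v) = v" for v using m mw by auto
      have "{v \<in> points n. ?u v \<noteq> w v} \<subseteq> {v \<in> points n. u v \<noteq> w v}"
      proof
        fix v assume "v \<in> {v \<in> points n. ?u v \<noteq> w v}"
        then have v: "v \<in> points n" "?u v \<noteq> w v" by auto
        have "u v \<noteq> w v"
        proof
          assume eq: "u v = w v"
          then have "v \<noteq> x" "v \<noteq> w x" "v \<noteq> u x" "v \<noteq> u (w x)" using x inv by metis+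
          then show False using v(2) eq by (simp add: switch_def)
        qed
        with v show "v \<in> {v \<in> points n. u v \<noteq> w v}" by simp
      qed
      moreover have "x \<in> {v \<in> points n. u v \<noteq> w v}" using x xP by simp
      moreover have "x \<notin> {v \<in> points n. ?u v \<noteq> w v}" using wxP by (simp add: switch_def)
      ultimately have "{v \<in> points n. ?u v \<noteq> w v} \<subset> {v \<in> points n. u v \<noteq> w v}" by blast
      then have "card {v \<in> points n. ?u v \<noteq> w v} < card {v \<in> points n. u v \<noteq> w v}"
        by (rule psubset_card_mono[rotated]) simp
      then have "f ?u = f w"
        using less.hyps switch_perfect[OF less.prems xP wxP] by blast
      then show ?thesis using sw[OF less.prems xP wxP] by simp
    qed simp
  qed
qed

lemma perfect_eq_on_four:
  assumes w: "w \<in> perfect n" and w': "w' \<in> perfect n" and d: "distinct [a, b, c, d]" "c \<in> points n"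
    and w'v: "w' a = b" "w' c = d" and wa: "w a = b"
    and eq: "\<And>x. x \<in> points n - {a, b, c, d} \<Longrightarrow> w x = w' x"
  shows "w = w'"
proof (rule sym, rule matching_eq_off_pair[OF perfectD[OF w'] perfectD[OF w], of c])
  fix x assume x: "x \<notin> {c, w' c}"
  have "w' b = a" "w b = a" using w'v wa perfectD[OF w] perfectD[OF w'] by (metis matching_inv)+
  moreover have "x = a \<or> x = b \<or> x \<notin> points n \<or> x \<in> points n - {a, b, c, d}" using x w'v by auto
  moreover have "w' x = w x" if "x \<notin> points n"
    using that matching_fix_iff[OF perfectD[OF w], of x] matching_fix_iff[OF perfectD[OF w'], of x] by simp
  ultimately show "w' x = w x" using w'v wa eq by metis
qed

text \<open>\<open>slot\<close> lets the extra point \<open>0\<close>, which every diagram fixes, be mapped to itself.\<close>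

lemma separate_matchings:
  assumes v: "v \<in> perfect n" and v': "v' \<in> perfect n" and w: "w \<in> perfect n" and w': "w' \<in> perfect n"
    and dx: "distinct [x, y, x1, y1]" "{x, y, x1, y1} \<subseteq> points n"
    and da: "distinct [a, b, c, d]" "{a, b, c, d} \<subseteq> points n"
    and vv: "v x = y" "v' x = x1" and ww: "w a = b" "w c = d" "w' a = c" "w' b = d"
    and eq: "\<And>k. k \<in> points n - {a, b, c, d} \<Longrightarrow> w k = w' k"
    and slot: "odd n \<Longrightarrow> x = 0 \<and> a = 0 \<or> y1 = 0 \<and> d = 0"
  obtains R where "brauer n R"
    "\<And>u. u \<in> perfect n \<Longrightarrow> min_rel u v OO R = min_rel u w"
    "\<And>u. u \<in> perfect n \<Longrightarrow> min_rel u v' OO R = min_rel u w'"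
proof -
  let ?T = "{x, y, x1, y1}" and ?S = "{a, b, c, d}"
  have "card ?T = 4" using dx(1) by simp
  then have "card (points n - ?T) + 4 = card (points n)"
    using dx(2) by (metis add.commute card_Diff_subset card_mono finite.emptyI finite_insert finite_points le_add_diff_inverse)
  then have "even (card (points n - ?T))" using even_card_points[of n] by (metis even_add even_numeral)
  \<comment> \<open>Any matching of the other points serves: the four points of \<open>?T\<close>
    become ends of transversals, and only the partner of \<open>x\<close> decides the image.\<close>
  then obtain p where p: "matching (points n - ?T) p" using matching_exists[of "points n - ?T"] by auto
  note mw = perfectD[OF w]
  define q where "q = w(a := a, b := b, c := c, d := d)"
  have q: "matching (points n - ?S) q"
  proof -
    have "matching (points n - {a, b}) (w(a := a, b := b))"
      by (rule matching_unpair[OF mw ww(1)])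
    then have "matching (points n - {a, b} - {c, d}) (w(a := a, b := b, c := c, d := d))"
      by (rule matching_unpair) (use da ww in auto)
    moreover have "points n - {a, b} - {c, d} = points n - ?S" by auto
    ultimately show ?thesis by (simp add: q_def)
  qed
  have T0: "0 \<in> ?T" "0 \<in> ?S" if "odd n" using slot[OF that] by auto
  have subs: "points n - ?T \<subseteq> {1..n}" "points n - ?S \<subseteq> {1..n}"
    using T0 by (auto simp: points_def split: if_splits)
  define g where "g = id(x := a, y := b, x1 := c, y1 := d)"
  have g: "g x = a" "g y = b" "g x1 = c" "g y1 = d" using dx(1) by (auto simp: g_def)
  have dom: "{1..n} - (points n - ?T) = {1..n} \<inter> ?T" "{1..n} - (points n - ?S) = {1..n} \<inter> ?S"
    using points_subset by blast+
  have bij: "bij_betw g ({1..n} - (points n - ?T)) ({1..n} - (points n - ?S))"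
  proof -
    have b: "bij_betw g ?T ?S"
      by (rule bij_betw_byWitness[where f' = "id(a := x, b := y, c := x1, d := y1)"]) (use g da(1) in auto)
    have in1: "k \<in> {1..n} \<longleftrightarrow> g k \<in> {1..n}" if "k \<in> ?T" for k
    proof (cases "odd n")
      case True
      have "k \<in> {1..n} \<longleftrightarrow> k \<noteq> 0" "g k \<in> {1..n} \<longleftrightarrow> g k \<noteq> 0"
        using that dx(2) da(2) b bij_betw_apply[OF b that] True by (auto simp: points_def)
      moreover obtain j where j: "j \<in> ?T" "j = 0" "g j = 0" using slot[OF True] g by auto
      then have "k = 0 \<longleftrightarrow> g k = 0"
        using inj_on_eq_iff[OF bij_betw_imp_inj_on[OF b] that j(1)] by simp
      ultimately show ?thesis by simp
    next
      case False
      then show ?thesis using that dx(2) da(2) bij_betw_apply[OF b that] by (auto simp: points_def)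
    qed
    show ?thesis unfolding dom
    proof (rule bij_betw_imageI)
      show "inj_on g ({1..n} \<inter> ?T)" by (rule inj_on_subset[OF bij_betw_imp_inj_on[OF b]]) auto
      show "g ` ({1..n} \<inter> ?T) = {1..n} \<inter> ?S"
      proof
        show "g ` ({1..n} \<inter> ?T) \<subseteq> {1..n} \<inter> ?S"
        proof (rule image_subsetI)
          fix k assume "k \<in> {1..n} \<inter> ?T"
          then have k: "k \<in> {1..n}" "k \<in> ?T" by (rule IntD1, rule IntD2)
          with in1[OF k(2)] bij_betw_apply[OF b k(2)] show "g k \<in> {1..n} \<inter> ?S" by (intro IntI) simp_all
        qed
        show "{1..n} \<inter> ?S \<subseteq> g ` ({1..n} \<inter> ?T)"
        proof
          fix l assume l: "l \<in> {1..n} \<inter> ?S"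
          then have "l \<in> g ` ?T" using bij_betw_imp_surj_on[OF b] by simp
          then obtain k where "k \<in> ?T" "g k = l" by blast
          with l in1 show "l \<in> g ` ({1..n} \<inter> ?T)" by blast
        qed
      qed
    qed
  qed
  define R where "R = link_rel n p g q"
  have R: "brauer n R" unfolding R_def by (rule brauer_link_rel[OF p q subs bij])
  have tr: "t k = r (g k)" if "extend_rel n R t r" "k \<in> ?T" for t r k
  proof (cases "k = 0")
    case True
    have "odd n" using that(2) dx(2) True by (auto simp: points_def split: if_splits)
    then have "g k = 0" using slot True g dx(1) by auto
    then show ?thesis using that(1) True \<open>odd n\<close> by (simp add: extend_rel_def)
  next
    case False
    then have "k \<in> {1..n}" using that(2) dx(2) by (auto simp: points_def split: if_splits)
    moreover have "p k = k" using matching_fix_iff[OF p] that(2) by blast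
    ultimately show ?thesis using that(1) by (simp add: extend_rel_def R_def link_rel_def)
  qed
  \<comment> \<open>The image contains the pairs of \<open>w\<close> outside \<open>?S\<close> and
    joins \<open>a\<close> to \<open>g k\<close>, where \<open>k\<close> is the partner of
    \<open>x\<close>; the last pair is then determined.\<close>
  have img: "\<exists>w0\<in>perfect n. (\<forall>u\<in>perfect n. min_rel u v0 OO R = min_rel u w0) \<and>
      (\<forall>k\<in>points n - ?S. w0 k = w k) \<and> w0 a = g k"
    if v0: "v0 \<in> perfect n" "v0 x = k" "k \<in> {y, x1}" for v0 k
  proof -
    obtain w0 where w0: "w0 \<in> perfect n" "\<And>r. agrees w0 r \<longleftrightarrow> (\<exists>t. agrees v0 t \<and> extend_rel n R t r)"
      using perfect_image[OF R v0(1)] by metis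
    have "min_rel u v0 OO R = min_rel u w0" if "u \<in> perfect n" for u
      by (rule min_rel_right[OF R that v0(1) w0(1)]) (use w0(2) in auto)
    moreover have "w0 k = w k" if "k \<in> points n - ?S" for k
    proof -
      have qk: "q k = w k" using that by (simp add: q_def)
      have "w0 k = q k"
      proof (rule matching_forced[OF perfectD[OF w0(1)]])
        fix r assume "agrees w0 r"
        then have "agrees q r" using w0(2) by (auto simp: extend_rel_def R_def link_rel_def)
        then show "r k = r (q k)" by (simp add: agreesD)
      qed (use that matching_fix_iff[OF q, of k] in auto)
      with qk show ?thesis by simp
    qed
    moreover have "w0 a = g k"
    proof (rule matching_forced[OF perfectD[OF w0(1)]])
      fix r assume "agrees w0 r"
      then obtain t where t: "agrees v0 t" "extend_rel n R t r" using w0(2) by blast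
      have "t x = t k" using agreesD[OF t(1), of x] v0(2) by simp
      then show "r a = r (g k)" using tr[OF t(2), of x] tr[OF t(2), of k] v0(3) g by auto
    qed (use v0(3) g da(1) in auto)
    ultimately show ?thesis using w0(1) by blast
  qed
  obtain w0 where w0: "w0 \<in> perfect n" "\<And>u. u \<in> perfect n \<Longrightarrow> min_rel u v OO R = min_rel u w0"
    "\<And>k. k \<in> points n - ?S \<Longrightarrow> w0 k = w k" "w0 a = b"
    using img[OF v vv(1)] g by auto
  have "w0 = w"
    by (rule perfect_eq_on_four[OF w0(1) w da(1) _ ww(1,2) w0(4,3)]) (use da(2) in auto)
  obtain w1 where w1: "w1 \<in> perfect n" "\<And>u. u \<in> perfect n \<Longrightarrow> min_rel u v' OO R = min_rel u w1"
    "\<And>k. k \<in> points n - ?S \<Longrightarrow> w1 k = w k" "w1 a = c"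
    using img[OF v' vv(2)] g by auto
  have "w1 = w'"
    by (rule perfect_eq_on_four[OF w1(1) w' _ _ ww(3,4) w1(4)]) (use da w1(3) eq in auto)
  show ?thesis
    by (rule that[OF R]) (use w0(2) w1(2) \<open>w0 = w\<close> \<open>w1 = w'\<close> in auto)
qed

section \<open>Finiteness and counting of matchings\<close>

lemma finite_matchings: "finite {p. \<exists>P\<subseteq>{0..n}. matching P (p :: nat \<Rightarrow> nat)}" (is "finite ?M")
proof (rule finite_imageD)
  have "(\<lambda>p. restrict p {0..n}) ` ?M \<subseteq> {0..n} \<rightarrow>\<^sub>E {0..n}"
  proof
    fix f assume "f \<in> (\<lambda>p. restrict p {0..n}) ` ?M"
    then obtain p P where p: "f = restrict p {0..n}" "P \<subseteq> {0..n}" "matching P p" by blast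
    have "p x \<in> {0..n}" if "x \<in> {0..n}" for x
      using that p(2) matching_in_iff[OF p(3), of x] matching_fix_iff[OF p(3), of x] by (cases "x \<in> P") (blast, simp)
    then show "f \<in> {0..n} \<rightarrow>\<^sub>E {0..n}" unfolding p(1) by simp
  qed
  then show "finite ((\<lambda>p. restrict p {0..n}) ` ?M)" by (rule finite_subset) (simp add: finite_PiE)
  show "inj_on (\<lambda>p. restrict p {0..n}) ?M"
  proof (rule inj_onI, rule ext)
    fix p q x assume "p \<in> ?M" "q \<in> ?M" and eq: "restrict p {0..n} = restrict q {0..n}"
    then obtain P Q where P: "P \<subseteq> {0..n}" "matching P p" and Q: "Q \<subseteq> {0..n}" "matching Q q" by blast
    show "p x = q x"
    proof (cases "x \<in> {0..n}")
      case True
      then show ?thesis using fun_cong[OF eq, of x] by simp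
    next
      case False
      then have "x \<notin> P" "x \<notin> Q" using P(1) Q(1) by blast+
      then show ?thesis using matching_fix_iff[OF P(2), of x] matching_fix_iff[OF Q(2), of x] by simp
    qed
  qed
qed

lemma finite_partial_matchings: "finite (partial_matchings n r)"
proof (rule finite_subset[OF _ finite_matchings[of n]])
  have "{1..n} \<subseteq> {0..n}" by auto
  then show "partial_matchings n r \<subseteq> {p. \<exists>P\<subseteq>{0..n}. matching P p}"
    unfolding partial_matchings_def by blast
qed

lemma finite_perfect: "finite (perfect n)"
proof (rule finite_subset[OF _ finite_matchings[of n]])
  have "points n \<subseteq> {0..n}" by (auto simp: points_def)
  then show "perfect n \<subseteq> {p. \<exists>P\<subseteq>{0..n}. matching P p}"
    unfolding perfect_def by blast
qed

text \<open>For odd \<open>n\<close>, cutting off \<open>0\<close> turns its partner into the only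
  unmatched point, from which the cut is undone.\<close>

lemma card_perfect: "card (perfect n) = card (partial_matchings n (if odd n then 1 else 0))"
proof (cases "odd n")
  case False
  have "perfect n = partial_matchings n 0"
  proof
    show "perfect n \<subseteq> partial_matchings n 0"
      using False by (auto simp: perfect_def partial_matchings_def points_def)
    show "partial_matchings n 0 \<subseteq> perfect n"
    proof
      fix p assume "p \<in> partial_matchings n 0"
      then obtain P where P: "P \<subseteq> {1..n}" "card P = n" "matching P p" by (auto simp: partial_matchings_def)
      then have "P = {1..n}" by (intro card_subset_eq) auto
      with P False show "p \<in> perfect n" by (simp add: perfect_def points_def)
    qed
  qed
  with False show ?thesis by simp
next
  case True
  let ?cut = "\<lambda>u :: nat \<Rightarrow> nat. u(0 := 0, u 0 := u 0)"
  have "bij_betw ?cut (perfect n) (partial_matchings n 1)"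
  proof (rule bij_betw_imageI)
    show "inj_on ?cut (perfect n)"
    proof (rule inj_onI)
      fix u w assume u: "u \<in> perfect n" and w: "w \<in> perfect n" and eq: "?cut u = ?cut w"
      note U = perfect_odd_cut[OF u True] and W = perfect_odd_cut[OF w True]
      have "?cut u (u 0) = u 0" using matching_fix_iff[OF U(1)] by blast
      then have "?cut w (u 0) = u 0" using eq by simp
      then have "u 0 \<notin> {1..n} - {w 0}" using matching_fix_iff[OF W(1)] by blast
      then have "u 0 = w 0" using U(2) by blast
      show "u = w"
      proof (rule matching_eq_off_pair[OF perfectD[OF u] perfectD[OF w], of 0])
        fix x assume "x \<notin> {0, u 0}"
        then show "u x = w x" using fun_cong[OF eq, of x] \<open>u 0 = w 0\<close> by simp
      qed
    qed
    show "?cut ` perfect n = partial_matchings n 1"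
    proof
      show "?cut ` perfect n \<subseteq> partial_matchings n 1"
      proof
        fix p assume "p \<in> ?cut ` perfect n"
        then obtain u where u: "u \<in> perfect n" "p = ?cut u" by blast
        note U = perfect_odd_cut[OF u(1) True]
        have "card ({1..n} - {u 0}) + 1 = n" using U(2) by simp
        with U(1) u(2) show "p \<in> partial_matchings n 1"
          unfolding partial_matchings_def by blast
      qed
      show "partial_matchings n 1 \<subseteq> ?cut ` perfect n"
      proof
        fix p assume "p \<in> partial_matchings n 1"
        then obtain P where P: "P \<subseteq> {1..n}" "card P + 1 = n" "matching P p"
          by (auto simp: partial_matchings_def)
        then have "card ({1..n} - P) = 1"
          by (metis add_diff_cancel_left' card_Diff_subset card_atLeastAtMost diff_Suc_1 finite_atLeastAtMost finite_subset)
        then obtain d where d: "{1..n} - P = {d}" by (auto simp: card_1_singleton_iff)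
        have "d \<in> {1..n}" "d \<notin> P" "0 \<notin> P" using d P(1) by auto
        then have pd: "p d = d" "p 0 = 0" "d \<noteq> 0" using matching_fix_iff[OF P(3)] by auto
        have "points n = P \<union> {0, d}" using d P(1) True by (auto simp: points_def)
        moreover have "0 \<notin> P" "d \<notin> P" using d P(1) by auto
        ultimately have h1: "p(0 := d, d := 0) \<in> perfect n"
          unfolding perfect_def using matching_join[OF P(3), of 0 d] pd(3) by simp
        have h2: "p = ?cut (p(0 := d, d := 0))" using pd by auto
        show "p \<in> ?cut ` perfect n" by (rule image_eqI[where x = "p(0 := d, d := 0)"]) (rule h2, rule h1)
      qed
    qed
  qed
  with True show ?thesis by (auto dest: bij_betw_same_card)
qed

definition degree_count :: "nat \<Rightarrow> nat" where
  "degree_count n = card (perfect n) + (if odd n then 3 * card (partial_matchings n 3)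
     else 2 * card (partial_matchings n 2) + 3 * card (partial_matchings n 4))"

text \<open>For odd \<open>n\<close> the three unmatched points are joined by \<open>0\<close>,
  which lies outside every partial matching.\<close>

lemma partial_matchings_four:
  assumes "p \<in> partial_matchings n (if odd n then 3 else 4)"
  obtains P where "matching P p" "P \<subseteq> {1..n}" "card (points n - P) = 4"
proof -
  obtain P where P: "matching P p" "P \<subseteq> {1..n}" "card P + (if odd n then 3 else 4) = n"
    using assms by (auto simp: partial_matchings_def)
  have "P \<subseteq> points n" using P(2) points_subset by blast
  then have "card (points n - P) = card (points n) - card P"
    using finite_subset[OF P(2)] by (simp add: card_Diff_subset)
  also have "card (points n) = (if odd n then n + 1 else n)" by (simp add: points_def)
  finally have "card (points n - P) = 4" using P(3) by (simp split: if_splits)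
  with P that show ?thesis by blast
qed

section \<open>The size of the minimal layer and the two lower bounds\<close>

context brauer_action
begin

text \<open>For odd \<open>n\<close> the switches are made at \<open>0\<close>, because
  \<open>separate_matchings\<close> requires \<open>0\<close> to be among the four points on either
  side.\<close>

definition pivot :: nat where
  "pivot = (if odd n then 0 else 1)"

lemma pivot: "pivot \<in> points n"
  using n3 by (auto simp: pivot_def points_def)

lemma card_points: "card (points n) \<ge> 4"
  using n3 by (cases "n = 3") (auto simp: points_def)

lemma exists_other:
  assumes "card S \<le> 3" "finite S"
  obtains c where "c \<in> points n" "c \<notin> S"
proof -
  have "\<not> points n \<subseteq> S" using card_mono[OF assms(2), of "points n"] card_points assms(1) by auto
  with that show ?thesis by blast
qed

text \<open>By faithfulness some orbit of the minimal ideal has two different values. If the values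
  at two different matchings coincided, then, since a diagram sends these two to any
  \<open>u\<close> and its switch at the pivot, the value would be invariant under such switches and
  hence constant.\<close>

lemma level0_embedding:
  obtains x u0 where "x \<in> X" "u0 \<in> perfect n" "\<And>v. v \<in> perfect n \<Longrightarrow> act x (min_rel u0 v) \<in> level0"
    "inj_on (\<lambda>v. act x (min_rel u0 v)) (perfect n)"
proof -
  \<comment> \<open>There are at least four points, so a second perfect matching is
    available.\<close>
  have "card {pivot, base pivot} \<le> 3" by (simp add: card_insert_if)
  then obtain c where c: "c \<in> points n" "c \<notin> {pivot, base pivot}"
    using exists_other by (metis finite.emptyI finite_insert)
  let ?w = "switch base pivot c"
  have w: "?w \<in> perfect n" using switch_perfect[OF base pivot c(1)] c by auto
  have "?w pivot \<noteq> base pivot" using c by (simp add: switch_def)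
  then have "?w \<noteq> base" by metis
  then have "min_rel base ?w \<noteq> min_rel base base" using min_rel_inj[OF base base w base] by blast
  then obtain x where x: "x \<in> X" "act x (min_rel base ?w) \<noteq> act x (min_rel base base)"
    using faithful[OF brauer_min_rel[OF base w] brauer_min_rel[OF base base]] by blast
  define g where "g v = act x (min_rel base v)" for v
  have gact: "act (g v) R = g w" if "v \<in> perfect n" "brauer n R" "min_rel base v OO R = min_rel base w" for v w R
    unfolding g_def using act_comp[OF brauer_min_rel[OF base that(1)] that(2) x(1)] that(3) by simp
  \<comment> \<open>The minimal ideal leads from any value of the orbit to any other, so one
    undefined value would make all of them undefined.\<close>
  have "g v \<noteq> z" if v: "v \<in> perfect n" for v
  proof
    assume gz: "g v = z"
    have "g w = z" if "w \<in> perfect n" for w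
      using gact[OF v brauer_min_rel[OF base that] min_rel_comp[OF base v base that]] gz
        act_z[OF brauer_min_rel[OF base that]] by simp
    from this[OF w] this[OF base] x show False by (simp add: g_def)
  qed
  then have gX: "g v \<in> X" if "v \<in> perfect n" for v
    using that act_in[OF x(1) brauer_min_rel[OF base that]] by (auto simp: g_def)
  have "g v \<in> level0" if v: "v \<in> perfect n" for v
    unfolding level0_def using gX[OF v] gact[OF v brauer_min_rel[OF base v] min_rel_comp[OF base v base v]] base v by blast
  moreover have "inj_on g (perfect n)"
  proof (rule inj_onI, rule ccontr)
    fix v v' assume v: "v \<in> perfect n" and v': "v' \<in> perfect n" and eq: "g v = g v'" and ne: "v \<noteq> v'"
    note mv = perfectD[OF v] and mv' = perfectD[OF v']
    have "g (switch u pivot c) = g u" if u: "u \<in> perfect n" and c: "c \<in> points n" "c \<noteq> pivot" for u c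
    proof (cases "c = u pivot")
      case True
      then show ?thesis using switch_partner[OF perfectD[OF u]] by simp
    next
      case False
      note mu = perfectD[OF u]
      let ?e = pivot and ?d = "u pivot" and ?c' = "u c"
      let ?s = "switch u ?e c"
      have s: "?s \<in> perfect n" by (rule switch_perfect[OF u pivot c(1) c(2)[symmetric]])
      have inv: "u (u k) = k" for k using mu by simp
      have pts: "?d \<in> points n" "?c' \<in> points n" using matching_in_iff[OF mu] pivot c by auto
      have "?d \<noteq> ?e" "?c' \<noteq> c" using matching_fix_iff[OF mu] pivot c by auto
      moreover have "?c' \<noteq> ?e" "?c' \<noteq> ?d" using False c inv by metis+
      ultimately have d4: "distinct [?e, ?d, c, ?c']" using False c by auto
      have sv: "?s ?e = c" "?s c = ?e" "?s ?d = ?c'" "?s ?c' = ?d" using d4 by (auto simp: switch_def)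
      have seq: "u k = ?s k" if "k \<notin> {?e, ?d, c, ?c'}" for k using that by (simp add: switch_def)
      have e0: "pivot = 0" if "odd n" using that by (simp add: pivot_def)
      have "\<exists>R. brauer n R \<and> min_rel base v OO R = min_rel base u \<and> min_rel base v' OO R = min_rel base ?s"
      \<comment> \<open>If \<open>v\<close> and \<open>v'\<close> agree at the pivot, the pivot
        takes the place of the fourth point \<open>y1\<close>; otherwise it is itself the point
        \<open>x\<close> at which they differ.\<close>
      proof (cases "v ?e = v' ?e")
        case True
        obtain x where x: "v x \<noteq> v' x" using ne by blast
        have xP: "x \<in> points n" using x matching_fix_iff[OF mv] matching_fix_iff[OF mv'] by metis
        have vP: "v x \<in> points n" "v' x \<in> points n" using xP matching_in_iff[OF mv] matching_in_iff[OF mv'] by auto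
        have "x \<noteq> v x" "x \<noteq> v' x" using xP matching_fix_iff[OF mv] matching_fix_iff[OF mv'] by metis+
        moreover have "x \<noteq> ?e" using x True by metis
        moreover have "v x \<noteq> ?e" "v' x \<noteq> ?e" using x True mv mv' by (metis matching_inv)+
        ultimately have "distinct [x, v x, v' x, ?e]" using x by auto
        then show ?thesis
        proof (rule separate_matchings[OF v v' u s])
          show "{x, v x, v' x, ?e} \<subseteq> points n" using xP vP pivot by simp
          show "distinct [?c', c, ?d, ?e]" using d4 by auto
          show "{?c', c, ?d, ?e} \<subseteq> points n" using pts c pivot by simp
          show "u k = ?s k" if "k \<in> points n - {?c', c, ?d, ?e}" for k using that seq[of k] by blast
        qed (use inv sv e0 base in auto)
      next
        case False
        have vP: "v ?e \<in> points n" "v' ?e \<in> points n" using pivot matching_in_iff[OF mv] matching_in_iff[OF mv'] by auto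
        have vn: "?e \<noteq> v ?e" "?e \<noteq> v' ?e" using pivot matching_fix_iff[OF mv] matching_fix_iff[OF mv'] by metis+
        have "card {?e, v ?e, v' ?e} \<le> 3" by (simp add: card_insert_if)
        then obtain y1 where y1: "y1 \<in> points n" "y1 \<notin> {?e, v ?e, v' ?e}"
          using exists_other by (metis finite.emptyI finite_insert)
        have "distinct [?e, v ?e, v' ?e, y1]" using vn False y1 by auto
        then show ?thesis
        proof (rule separate_matchings[OF v v' u s])
          show "{?e, v ?e, v' ?e, y1} \<subseteq> points n" using vP pivot y1 by simp
          show "distinct [?e, ?d, c, ?c']" by (rule d4)
          show "{?e, ?d, c, ?c'} \<subseteq> points n" using pts c pivot by simp
          show "u k = ?s k" if "k \<in> points n - {?e, ?d, c, ?c'}" for k using that seq[of k] by blast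
        qed (use inv sv e0 base in auto)
      qed
      then obtain R where R: "brauer n R" "min_rel base v OO R = min_rel base u" "min_rel base v' OO R = min_rel base ?s"
        by blast
      show ?thesis using gact[OF v R(1,2)] gact[OF v' R(1,3)] eq by simp
    qed
    then have "g ?w = g base" by (intro switch_invariant_const[OF pivot _ w base])
    with x show False by (simp add: g_def)
  qed
  ultimately show ?thesis using that[OF x(1) base] by (simp add: g_def[abs_def])
qed

lemma level0_card: "card level0 \<ge> card (perfect n)"
proof -
  obtain x u0 where x: "\<And>v. v \<in> perfect n \<Longrightarrow> act x (min_rel u0 v) \<in> level0"
    "inj_on (\<lambda>v. act x (min_rel u0 v)) (perfect n)" using level0_embedding by metis
  have "finite level0" using fin by (simp add: level0_def)
  then show ?thesis using x by (intro card_inj_on_le[OF x(2)]) auto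
qed

lemma partial_matchings_four_nonempty:
  obtains p where "p \<in> partial_matchings n (if odd n then 3 else 4)"
proof -
  define k where "k = (if odd n then 3 else (4::nat))"
  have k: "k \<le> n" "even (n - k)" using n3 by (auto simp: k_def)
  obtain p where "matching {1..n - k} p" using matching_exists[of "{1..n - k}"] k by auto
  then have "p \<in> partial_matchings n k"
    unfolding partial_matchings_def using k(1) by (intro CollectI exI[of _ "{1..n - k}"]) auto
  with that show ?thesis by (simp add: k_def)
qed

text \<open>Without undefined values, the values separated by a point of \<^const>\<open>level4\<close> are themselves
  in \<^const>\<open>level0\<close>, but an orbit of the minimal ideal contains at most one of them.\<close>

lemma level0_card_total:
  assumes total: "\<And>x R. x \<in> X \<Longrightarrow> brauer n R \<Longrightarrow> act x R \<noteq> z"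
  shows "card level0 \<ge> card (perfect n) + 1"
proof -
  obtain x u0 where x: "x \<in> X" "u0 \<in> perfect n" "\<And>v. v \<in> perfect n \<Longrightarrow> act x (min_rel u0 v) \<in> level0"
    "inj_on (\<lambda>v. act x (min_rel u0 v)) (perfect n)" using level0_embedding by metis
  obtain p where p: "p \<in> partial_matchings n (if odd n then 3 else 4)" by (rule partial_matchings_four_nonempty)
  obtain P where P: "matching P p" "P \<subseteq> {1..n}" "card (points n - P) = 4" by (rule partial_matchings_four[OF p])
  have "card (level4 p) \<noteq> 0" using level4_card[OF P] by simp
  then obtain y where y: "y \<in> level4 p" by (metis card.empty ex_in_conv)
  then obtain u w where uw: "u \<in> perfect n" "w \<in> perfect n" "profile y u \<noteq> profile y w" and yX: "y \<in> X"
    by (auto simp: level4_def)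
  let ?O = "(\<lambda>v. act x (min_rel u0 v)) ` perfect n"
  have prof: "profile y u \<in> level0" if u: "u \<in> perfect n" for u
  proof -
    have "profile y u \<in> X"
      unfolding profile_def using act_in[OF yX brauer_base[OF u]] total[OF yX brauer_base[OF u]] by auto
    moreover have "act (profile y u) (min_rel u base) = profile y u"
      unfolding profile_def using act_comp[OF brauer_base[OF u] brauer_base[OF u] yX] min_rel_comp[OF u base u base] by simp
    ultimately show ?thesis unfolding level0_def using u base by blast
  qed
  \<comment> \<open>The factor \<open>min_rel u base\<close> fixes \<open>profile y u\<close> but
    sends the whole orbit to a single point. So two different values of the profile cannot both lie
    in the orbit.\<close>
  have "profile y u = act x (min_rel u0 base)" if u: "u \<in> perfect n" and o: "profile y u \<in> ?O" for u
  proof -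
    obtain v where v: "v \<in> perfect n" "profile y u = act x (min_rel u0 v)" using o by blast
    have "profile y u = act (profile y u) (min_rel u base)"
      unfolding profile_def using act_comp[OF brauer_base[OF u] brauer_base[OF u] yX] min_rel_comp[OF u base u base] by simp
    also have "\<dots> = act x (min_rel u0 v OO min_rel u base)"
      unfolding v(2) by (rule act_comp[OF brauer_min_rel[OF x(2) v(1)] brauer_base[OF u] x(1)])
    finally show ?thesis using min_rel_comp[OF x(2) v(1) u base] by simp
  qed
  then have "\<not> (profile y u \<in> ?O \<and> profile y w \<in> ?O)" using uw by metis
  then obtain k where k: "k \<in> level0" "k \<notin> ?O" using prof uw by blast
  have "finite level0" using fin by (simp add: level0_def)
  moreover have "insert k ?O \<subseteq> level0" using k x(3) by auto
  ultimately have "card (insert k ?O) \<le> card level0" by (rule card_mono)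
  moreover have "card (insert k ?O) = card (perfect n) + 1"
    using k(2) card_image[OF x(4)] finite_perfect by simp
  ultimately show ?thesis by simp
qed

text \<open>Stated relative to \<open>level0\<close>, whose estimate is the only one that differs
  between partial and total actions, and without subtraction.\<close>

lemma card_levels: "card X + card (perfect n) \<ge> degree_count n + card level0"
proof -
  define Q2 where "Q2 = (if odd n then {} else partial_matchings n 2)"
  define Q4 where "Q4 = partial_matchings n (if odd n then 3 else 4)"
  have fQ: "finite Q2" "finite Q4" by (auto simp: Q2_def Q4_def finite_partial_matchings)
  have fl: "finite level0" "finite (level2 p)" "finite (level4 p)" for p
    using fin by (auto simp: level0_def level2_def level4_def)
  have d4: "level4 p \<inter> level4 q = {}" if pq: "p \<in> Q4" "q \<in> Q4" "p \<noteq> q" for p q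
  proof -
    obtain P where P: "matching P p" "P \<subseteq> {1..n}" "card (points n - P) = 4"
      using pq(1) unfolding Q4_def by (rule partial_matchings_four)
    obtain Q where Q: "matching Q q" "Q \<subseteq> {1..n}" "card (points n - Q) = 4"
      using pq(2) unfolding Q4_def by (rule partial_matchings_four)
    show ?thesis using level4_disjoint[OF P Q] pq(3) by blast
  qed
  have c4: "card (\<Union>p\<in>Q4. level4 p) \<ge> 3 * card Q4"
  proof -
    have "card (\<Union>p\<in>Q4. level4 p) = (\<Sum>p\<in>Q4. card (level4 p))"
      using fQ fl d4 by (intro card_UN_disjoint) auto
    also have "\<dots> \<ge> (\<Sum>p\<in>Q4. 3)"
    proof (rule sum_mono)
      fix p assume "p \<in> Q4"
      then obtain P where "matching P p" "P \<subseteq> {1..n}" "card (points n - P) = 4"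
        unfolding Q4_def by (rule partial_matchings_four)
      then show "3 \<le> card (level4 p)" by (rule level4_card)
    qed
    finally show ?thesis by simp
  qed
  have Q2: "even n" "p \<in> partial_matchings n 2" if "p \<in> Q2" for p
    using that by (auto simp: Q2_def split: if_splits)
  have c2: "card (\<Union>p\<in>Q2. level2 p) \<ge> 2 * card Q2"
  proof -
    have "card (\<Union>p\<in>Q2. level2 p) = (\<Sum>p\<in>Q2. card (level2 p))"
      using fQ fl level2_disjoint Q2(2) by (intro card_UN_disjoint) blast+
    also have "\<dots> \<ge> (\<Sum>p\<in>Q2. 2)" using level2_card Q2(2) by (intro sum_mono) blast
    finally show ?thesis by simp
  qed
  have "level0 \<inter> (\<Union>p\<in>Q2. level2 p) = {}" using level0_level2 Q2 by blast
  moreover have "(level0 \<union> (\<Union>p\<in>Q2. level2 p)) \<inter> (\<Union>p\<in>Q4. level4 p) = {}"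
  proof -
    have "profile y u = profile y w"
      if "y \<in> level0 \<union> (\<Union>p\<in>Q2. level2 p)" "u \<in> perfect n" "w \<in> perfect n" for y u w
      using that level0_profile level2_profile Q2 by blast
    then show ?thesis unfolding level4_def by blast
  qed
  ultimately have "card (level0 \<union> (\<Union>p\<in>Q2. level2 p) \<union> (\<Union>p\<in>Q4. level4 p)) =
      card level0 + card (\<Union>p\<in>Q2. level2 p) + card (\<Union>p\<in>Q4. level4 p)"
    using fQ fl by (simp add: card_Un_disjoint)
  moreover have "level0 \<union> (\<Union>p\<in>Q2. level2 p) \<union> (\<Union>p\<in>Q4. level4 p) \<subseteq> X"
    by (auto simp: level0_def level2_def level4_def)
  then have "card (level0 \<union> (\<Union>p\<in>Q2. level2 p) \<union> (\<Union>p\<in>Q4. level4 p)) \<le> card X"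
    by (rule card_mono[OF fin])
  ultimately have "card level0 + 2 * card Q2 + 3 * card Q4 \<le> card X" using c2 c4 by linarith
  then show ?thesis by (auto simp: degree_count_def Q2_def Q4_def)
qed

theorem degree_lower_bound: "degree_count n \<le> card X"
  using card_levels level0_card by linarith

theorem degree_lower_bound_total:
  assumes "\<And>x R. x \<in> X \<Longrightarrow> brauer n R \<Longrightarrow> act x R \<noteq> z"
  shows "degree_count n + 1 \<le> card X"
  using card_levels level0_card_total[OF assms] by linarith

end

section \<open>The upper bound\<close>

text \<open>Converse of \<open>brauer_rel_link\<close>. It is used for images of states, where the
  upper row has two or four points, and for faithfulness.\<close>

lemma brauer_rel_decompose:
  assumes "brauer_rel A B R"
  obtains P p Q q f where "matching P p" "P \<subseteq> A" "matching Q q" "Q \<subseteq> B" "bij_betw f (A - P) (B - Q)"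
    "\<And>s r. R s r \<longleftrightarrow> agrees p s \<and> agrees q r \<and> (\<forall>x\<in>A - P. s x = r (f x))"
proof -
  obtain m where m: "matching (Up ` A \<union> Dn ` B) m" and R: "\<And>s r. R s r \<longleftrightarrow> agrees m (lab s r)"
    using assms by (auto simp: brauer_rel_def)
  \<comment> \<open>The partner of an upper vertex is either upper, and given by \<open>p\<close>,
    or lower, and given by \<open>f\<close>; the other map takes the default \<open>x\<close>.
    Likewise for \<open>q\<close> and \<open>g\<close> below.\<close>
  define p where "p x = (case m (Up x) of Up y \<Rightarrow> y | _ \<Rightarrow> x)" for x
  define q where "q x = (case m (Dn x) of Dn y \<Rightarrow> y | _ \<Rightarrow> x)" for x
  define f where "f x = (case m (Up x) of Dn y \<Rightarrow> y | _ \<Rightarrow> x)" for x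
  define g where "g x = (case m (Dn x) of Up y \<Rightarrow> y | _ \<Rightarrow> x)" for x
  define P where "P = {x. p x \<noteq> x}"
  define Q where "Q = {x. q x \<noteq> x}"
  have mm: "m (m v) = v" for v using m by simp
  have nm: "m v = v" if "v \<notin> Up ` A \<union> Dn ` B" for v using that matching_fix_iff[OF m] by blast
  have noMid: "m (Up x) \<noteq> Mid y" "m (Dn x) \<noteq> Mid y" for x y
    using nm[of "Mid y"] mm[of "Up x"] mm[of "Dn x"] by (metis imageE UnE vertex.distinct)+
  have pp: "matching P p"
  proof (unfold matching_def, intro conjI allI)
    fix x show "p (p x) = x"
    proof (cases "m (Up x)")
      case (Up y)
      then have "m (Up y) = Up x" using mm by metis
      then show ?thesis using Up by (simp add: p_def)
    qed (simp_all add: p_def)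
  qed (simp add: P_def)
  have qq: "matching Q q"
  proof (unfold matching_def, intro conjI allI)
    fix x show "q (q x) = x"
    proof (cases "m (Dn x)")
      case (Dn y)
      then have "m (Dn y) = Dn x" using mm by metis
      then show ?thesis using Dn by (simp add: q_def)
    qed (simp_all add: q_def)
  qed (simp add: Q_def)
  have PA: "P \<subseteq> A"
  proof
    fix x assume "x \<in> P"
    then have "m (Up x) \<noteq> Up x" by (auto simp: P_def p_def)
    then show "x \<in> A" using nm[of "Up x"] by auto
  qed
  have QB: "Q \<subseteq> B"
  proof
    fix x assume "x \<in> Q"
    then have "m (Dn x) \<noteq> Dn x" by (auto simp: Q_def q_def)
    then show "x \<in> B" using nm[of "Dn x"] by auto
  qed
  have fU: "m (Up x) = Dn (f x)" "f x \<in> B - Q" "g (f x) = x" if "x \<in> A - P" for x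
  proof -
    have ne: "m (Up x) \<noteq> Up x" using that matching_fix_iff[OF m, of "Up x"] by blast
    show *: "m (Up x) = Dn (f x)"
      using that ne noMid[of x] by (cases "m (Up x)") (auto simp: P_def p_def f_def)
    then have **: "m (Dn (f x)) = Up x" using mm by metis
    then show "g (f x) = x" by (simp add: g_def)
    have "q (f x) = f x" using ** by (simp add: q_def)
    moreover have "f x \<in> B" using nm[of "Dn (f x)"] ** by auto
    ultimately show "f x \<in> B - Q" by (simp add: Q_def)
  qed
  have gU: "m (Dn x) = Up (g x)" "g x \<in> A - P" "f (g x) = x" if "x \<in> B - Q" for x
  proof -
    have ne: "m (Dn x) \<noteq> Dn x" using that matching_fix_iff[OF m, of "Dn x"] by blast
    show *: "m (Dn x) = Up (g x)"
      using that ne noMid[of _ x] by (cases "m (Dn x)") (auto simp: Q_def q_def g_def noMid)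
    then have **: "m (Up (g x)) = Dn x" using mm by metis
    then show "f (g x) = x" by (simp add: f_def)
    have "p (g x) = g x" using ** by (simp add: p_def)
    moreover have "g x \<in> A" using nm[of "Up (g x)"] ** by auto
    ultimately show "g x \<in> A - P" by (simp add: P_def)
  qed
  have bij: "bij_betw f (A - P) (B - Q)"
  proof (rule bij_betw_byWitness[where f' = g])
    show "\<forall>x\<in>A - P. g (f x) = x" using fU(3) by blast
    show "\<forall>x\<in>B - Q. f (g x) = x" using gU(3) by blast
    show "f ` (A - P) \<subseteq> B - Q" using fU(2) by (rule image_subsetI)
    show "g ` (B - Q) \<subseteq> A - P" using gU(2) by (rule image_subsetI)
  qed
  have mP: "m (Up x) = Up (p x)" if "x \<in> P" for x
    using that noMid by (cases "m (Up x)") (auto simp: P_def p_def)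
  have mQ: "m (Dn x) = Dn (q x)" if "x \<in> Q" for x
    using that noMid by (cases "m (Dn x)") (auto simp: Q_def q_def)
  have "R s r \<longleftrightarrow> agrees p s \<and> agrees q r \<and> (\<forall>x\<in>A - P. s x = r (f x))" for s r
  proof
    assume "R s r"
    then have a: "agrees m (lab s r)" using R by simp
    have "s (p x) = s x" if "x \<in> P" for x using agreesD[OF a, of "Up x"] mP[OF that] by simp
    moreover have "r (q x) = r x" if "x \<in> Q" for x using agreesD[OF a, of "Dn x"] mQ[OF that] by simp
    moreover have "s x = r (f x)" if "x \<in> A - P" for x using agreesD[OF a, of "Up x"] fU(1)[OF that] by simp
    ultimately show "agrees p s \<and> agrees q r \<and> (\<forall>x\<in>A - P. s x = r (f x))"
      using agrees_matchingI[OF pp] agrees_matchingI[OF qq] by blast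
  next
    assume a: "agrees p s \<and> agrees q r \<and> (\<forall>x\<in>A - P. s x = r (f x))"
    have "agrees m (lab s r)"
    proof (rule agrees_matchingI[OF m])
      fix v assume "v \<in> Up ` A \<union> Dn ` B"
      then consider x where "v = Up x" "x \<in> P" | x where "v = Up x" "x \<in> A - P"
        | x where "v = Dn x" "x \<in> Q" | x where "v = Dn x" "x \<in> B - Q" by blast
      then show "lab s r (m v) = lab s r v"
      proof cases
        case 1 then show ?thesis using mP a by (simp add: agreesD)
      next
        case 2 then show ?thesis using fU a by simp
      next
        case 3 then show ?thesis using mQ a by (simp add: agreesD)
      next
        case 4
        then have "s (g x) = r x" using gU[of x] a by metis
        then show ?thesis using 4 gU by simp
      qed
    qed
    then show "R s r" using R by simp
  qed
  with that pp PA qq QB bij show ?thesis by blast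
qed

section \<open>The points of the optimal representation and their images\<close>

definition cls0 :: "(nat \<Rightarrow> nat) \<Rightarrow> (nat \<Rightarrow> bool) set" where
  "cls0 u = {r. agrees u r}"

definition cls2 :: "(nat \<Rightarrow> nat) \<Rightarrow> nat \<Rightarrow> nat \<Rightarrow> (nat \<Rightarrow> bool) set" where
  "cls2 p i j = {r. agrees p r \<and> r i \<and> \<not> r j}"

definition cls4 :: "(nat \<Rightarrow> nat) \<Rightarrow> nat \<Rightarrow> nat \<Rightarrow> nat \<Rightarrow> nat \<Rightarrow> (nat \<Rightarrow> bool) set" where
  "cls4 p i j k l = {r. agrees p r \<and> r i = r j \<and> r k = r l \<and> r i \<noteq> r k}"

definition states0 :: "nat \<Rightarrow> (nat \<Rightarrow> bool) set set" where
  "states0 n = cls0 ` perfect n"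

text \<open>The order of \<open>i\<close> and \<open>j\<close> matters, as they carry the labels 1
  and 0; this is the source of the factor 2.\<close>

definition states2 :: "nat \<Rightarrow> (nat \<Rightarrow> bool) set set" where
  "states2 n = {K. even n \<and> (\<exists>P p i j. matching P p \<and> P \<subseteq> {1..n} \<and> {1..n} - P = {i, j} \<and> i \<noteq> j \<and>
     K = cls2 p i j)}"

text \<open>\<open>cls4\<close> depends only on the splitting into \<open>{i, j}\<close> and
  \<open>{k, l}\<close>, so demanding \<open>i = 0\<close> for odd \<open>n\<close> merely fixes the
  order of listing.\<close>

definition states4 :: "nat \<Rightarrow> (nat \<Rightarrow> bool) set set" where
  "states4 n = {K. \<exists>P p i j k l. matching P p \<and> P \<subseteq> {1..n} \<and> points n - P = {i, j, k, l} \<and>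
     distinct [i, j, k, l] \<and> (odd n \<longrightarrow> i = 0) \<and> K = cls4 p i j k l}"

text \<open>The points of the optimal representation are sets of labelings, on which diagrams act by
  relational image; the empty set plays the role of an undefined value.\<close>

definition states :: "nat \<Rightarrow> (nat \<Rightarrow> bool) set set" where
  "states n = states0 n \<union> states2 n \<union> states4 n"

lemma states2E:
  assumes "K \<in> states2 n"
  obtains P p i j where "even n" "matching P p" "P \<subseteq> {1..n}" "{1..n} - P = {i, j}" "i \<noteq> j" "K = cls2 p i j"
  using assms unfolding states2_def mem_Collect_eq by (elim exE conjE) (rule that)

lemma states4E:
  assumes "K \<in> states4 n"
  obtains P p i j k l where "matching P p" "P \<subseteq> {1..n}" "points n - P = {i, j, k, l}"
     "distinct [i, j, k, l]" "odd n \<longrightarrow> i = 0" "K = cls4 p i j k l"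
  using assms unfolding states4_def mem_Collect_eq by (elim exE conjE) (rule that)

definition image_rel :: "nat \<Rightarrow> (nat \<Rightarrow> bool) set \<Rightarrow> ((nat \<Rightarrow> bool) \<Rightarrow> (nat \<Rightarrow> bool) \<Rightarrow> bool) \<Rightarrow> (nat \<Rightarrow> bool) set" where
  "image_rel n K R = {r. \<exists>s\<in>K. extend_rel n R s r}"

lemma image_rel_empty: "image_rel n {} R = {}"
  by (simp add: image_rel_def)

lemma image_rel_comp:
  "brauer n R \<Longrightarrow> brauer n Q \<Longrightarrow> image_rel n (image_rel n K R) Q = image_rel n K (R OO Q)"
  unfolding image_rel_def extend_OO by blast

lemma states_nonempty: "{} \<notin> states n"
proof -
  have "K \<noteq> {}" if "K \<in> states0 n" for K
    using that agrees_const by (auto simp: states0_def cls0_def)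
  moreover have "K \<noteq> {}" if "K \<in> states2 n" for K
    using that
  proof (rule states2E)
    fix P p i j assume p: "matching P p" and f: "{1..n} - P = {i, j}" "i \<noteq> j" and K: "K = cls2 p i j"
    have "i \<notin> P" using f by blast
    then have "(\<lambda>y. y = i) \<in> K"
      using agrees_fixed_indicator[OF p, of i] f(2) by (auto simp: K cls2_def)
    then show ?thesis by blast
  qed
  moreover have "K \<noteq> {}" if "K \<in> states4 n" for K
    using that
  proof (rule states4E)
    fix P p i j k l assume p: "matching P p" and f: "points n - P = {i, j, k, l}" "distinct [i, j, k, l]"
      and K: "K = cls4 p i j k l"
    have "i \<notin> P" "j \<notin> P" using f by blast+
    then have "agrees p (\<lambda>y. y = i)" "agrees p (\<lambda>y. y = j)" using agrees_fixed_indicator[OF p] by blast+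
    then have "agrees p (\<lambda>y. y = i \<or> y = j)" by (simp add: agrees_def)
    then have "(\<lambda>y. y = i \<or> y = j) \<in> K" using f(2) by (auto simp: K cls4_def)
    then show ?thesis by blast
  qed
  ultimately show ?thesis unfolding states_def by blast
qed

lemma image_states0:
  assumes "K \<in> states0 n" "brauer n R"
  shows "image_rel n K R \<in> states0 n"
proof -
  obtain u where u: "u \<in> perfect n" "K = cls0 u" using assms(1) by (auto simp: states0_def)
  obtain w where w: "w \<in> perfect n" "\<And>r. agrees w r \<longleftrightarrow> (\<exists>t. agrees u t \<and> extend_rel n R t r)"
    using perfect_image[OF assms(2) u(1)] by metis
  have "image_rel n K R = cls0 w" unfolding u image_rel_def cls0_def using w(2) by auto
  with w(1) show ?thesis by (auto simp: states0_def)
qed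

text \<open>\<open>K\<close> consists of the lower labelings of a relation with two upper points
  labelled 1 and 0. Composition with \<open>R\<close> gives a relation of the same kind: either the
  two upper points have become partners, and no labeling is left, or they lead to two new
  defects.\<close>

lemma image_states2:
  assumes "K \<in> states2 n" "brauer n R"
  shows "image_rel n K R \<in> insert {} (states2 n)"
proof -
  obtain P p i j where p: "matching P p" "P \<subseteq> {1..n}" and ij: "{1..n} - P = {i, j}" "i \<noteq> j"
    and K: "K = cls2 p i j" and ev: "even n" using assms(1) by (rule states2E)
  let ?h = "\<lambda>x :: nat. if x = 1 then i else j"
  let ?S = "\<lambda>s r. agrees id s \<and> agrees p r \<and> (\<forall>x\<in>{1, 2 :: nat} - {}. s x = r (?h x))"
  have "brauer_rel {1, 2} {1..n} ?S"
  proof (rule brauer_rel_link)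
    show "bij_betw ?h ({1, 2} - {}) ({1..n} - P)" unfolding ij(1) using ij(2) by (auto simp: bij_betw_def inj_on_def)
  qed (use p in \<open>auto simp: matching_def\<close>)
  from brauer_rel_comp[OF this assms(2)] have "brauer_rel {1, 2} {1..n} (?S OO R)" by simp
  then obtain D d Q q f where d: "matching D d" "D \<subseteq> {1, 2}" and q: "matching Q q" "Q \<subseteq> {1..n}"
    and f: "bij_betw f ({1, 2} - D) ({1..n} - Q)"
    and SR: "\<And>s r. (?S OO R) s r \<longleftrightarrow> agrees d s \<and> agrees q r \<and> (\<forall>x\<in>{1, 2} - D. s x = r (f x))"
    by (rule brauer_rel_decompose) blast
  have img: "image_rel n K R = {r. \<exists>s. s 1 \<and> \<not> s 2 \<and> (?S OO R) s r}"
  proof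
    show "image_rel n K R \<subseteq> {r. \<exists>s. s 1 \<and> \<not> s 2 \<and> (?S OO R) s r}"
    proof
      fix r assume "r \<in> image_rel n K R"
      then obtain t where "agrees p t" "t i" "\<not> t j" "R t r"
        by (auto simp: image_rel_def K cls2_def extend_rel_def)
      then have "(?S OO R) (\<lambda>x. x = 1) r" by (intro relcomppI[of _ _ t]) (auto simp: agrees_def)
      then show "r \<in> {r. \<exists>s. s 1 \<and> \<not> s 2 \<and> (?S OO R) s r}"
        by (intro CollectI exI[of _ "\<lambda>x. x = 1"]) simp
    qed
    show "{r. \<exists>s. s 1 \<and> \<not> s 2 \<and> (?S OO R) s r} \<subseteq> image_rel n K R"
      using ev by (auto simp: image_rel_def K cls2_def extend_rel_def)
  qed
  consider "d 1 = 2" | "d 1 = 1" using matching_fix_pair[OF d] by metis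
  then show ?thesis
  proof cases
    case 1
    have "image_rel n K R = {}"
    proof (rule equals0I)
      fix r assume "r \<in> image_rel n K R"
      then obtain s where s: "s 1" "\<not> s 2" "agrees d s" unfolding img SR by blast
      then show False using agreesD[OF s(3), of 1] 1 by simp
    qed
    then show ?thesis by simp
  next
    case 2
    then have D: "D = {}" using d by (metis Diff_empty Diff_insert0 insert_absorb2 insert_iff matching_fix_iff matching_in_iff singletonD subset_empty subset_insert subset_singletonD)
    then have d_id: "agrees d s" for s using matching_fix_iff[OF d(1)] by (simp add: agrees_def)
    have fe: "{1..n} - Q = {f 1, f 2}" "f 1 \<noteq> f 2"
      using f by (auto simp: D bij_betw_def)
    have "image_rel n K R = cls2 q (f 1) (f 2)"
    proof
      show "image_rel n K R \<subseteq> cls2 q (f 1) (f 2)"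
        unfolding img SR D cls2_def by auto
      show "cls2 q (f 1) (f 2) \<subseteq> image_rel n K R"
        unfolding img SR D cls2_def using d_id by (auto intro!: exI[of _ "\<lambda>x. x = 1"])
    qed
    then show ?thesis using q fe ev unfolding states2_def by blast
  qed
qed

text \<open>The same with four upper points whose labels agree within \<open>{1, 2}\<close> and
  within \<open>{3, 4}\<close> and differ between these. A pair across makes the image empty. If one
  or both of the two pairs have closed up, the condition that labels differ puts no restriction on
  the lower labels, and a perfect matching remains.\<close>

lemma image_states4:
  assumes "K \<in> states4 n" "brauer n R"
  shows "image_rel n K R \<in> insert {} (states0 n \<union> states4 n)"
proof -
  obtain P p i j k l where p: "matching P p" "P \<subseteq> {1..n}" and F: "points n - P = {i, j, k, l}" "distinct [i, j, k, l]"
    and i0: "odd n \<longrightarrow> i = 0" and K: "K = cls4 p i j k l" using assms(1) by (rule states4E)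
  let ?A = "{1, 2, 3, 4 :: nat}"
  let ?h = "\<lambda>x. if x = (1::nat) then i else if x = 2 then j else if x = 3 then k else l"
  let ?S = "\<lambda>s r. agrees id s \<and> agrees p r \<and> (\<forall>x\<in>?A - {}. s x = r (?h x))"
  have "brauer_rel ?A (points n) ?S"
  proof (rule brauer_rel_link)
    show "bij_betw ?h (?A - {}) (points n - P)" unfolding F(1) using F(2) by (auto simp: bij_betw_def inj_on_def)
    show "P \<subseteq> points n" using p(2) points_subset by blast
  qed (use p in \<open>auto simp: matching_def\<close>)
  from brauer_rel_comp[OF this brauer_rel_extend[OF assms(2)] finite_points]
  have "brauer_rel ?A (points n) (?S OO extend_rel n R)" .
  then obtain D d Q q f where d: "matching D d" "D \<subseteq> ?A" and q: "matching Q q" "Q \<subseteq> points n"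
    and f: "bij_betw f (?A - D) (points n - Q)"
    and SR: "\<And>s r. (?S OO extend_rel n R) s r \<longleftrightarrow> agrees d s \<and> agrees q r \<and> (\<forall>x\<in>?A - D. s x = r (f x))"
    by (rule brauer_rel_decompose) blast
  let ?ok = "\<lambda>s :: nat \<Rightarrow> bool. s 1 = s 2 \<and> s 3 = s 4 \<and> s 1 \<noteq> s 3"
  have img: "image_rel n K R = {r. \<exists>s. ?ok s \<and> (?S OO extend_rel n R) s r}"
  proof
    show "image_rel n K R \<subseteq> {r. \<exists>s. ?ok s \<and> (?S OO extend_rel n R) s r}"
    proof
      fix r assume "r \<in> image_rel n K R"
      then obtain t where t: "agrees p t" "t i = t j" "t k = t l" "t i \<noteq> t k" "extend_rel n R t r"
        by (auto simp: image_rel_def K cls4_def)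
      have A: "(?S OO extend_rel n R) (\<lambda>x. t (?h x)) r"
        using t by (intro relcomppI[of _ _ t]) (auto simp: agrees_def)
      have "?ok (\<lambda>x. t (?h x))" using t by simp
      from conjI[OF this A] show "r \<in> {r. \<exists>s. ?ok s \<and> (?S OO extend_rel n R) s r}"
        by (intro CollectI exI[of _ "\<lambda>x. t (?h x)"])
    qed
    show "{r. \<exists>s. ?ok s \<and> (?S OO extend_rel n R) s r} \<subseteq> image_rel n K R"
    proof
      fix r assume "r \<in> {r. \<exists>s. ?ok s \<and> (?S OO extend_rel n R) s r}"
      then obtain s t where s: "?ok s" and st: "?S s t" and t: "extend_rel n R t r" by blast
      have "s 1 = t i" "s 2 = t j" "s 3 = t k" "s 4 = t l" using st by auto
      then have "t \<in> K" unfolding K cls4_def using s st by auto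
      then show "r \<in> image_rel n K R" unfolding image_rel_def using t by blast
    qed
  qed
  have dA: "d x \<in> ?A" if "x \<in> ?A" for x
    using that d(2) matching_in_iff[OF d(1), of x] matching_fix_iff[OF d(1), of x] by (cases "x \<in> D") (blast, simp)
  have dd: "d (d x) = x" for x using d(1) by simp
  have Dx: "x \<in> D \<longleftrightarrow> d x \<noteq> x" for x using matching_fix_iff[OF d(1)] by blast
  have empty: "image_rel n K R = {}" if "d x = y" "x \<in> {1, 2}" "y \<in> {3, 4}" for x y
  proof (rule equals0I)
    fix r assume "r \<in> image_rel n K R"
    then obtain s where s: "?ok s" "agrees d s" unfolding img SR by blast
    then show False using agreesD[OF s(2), of x] that by auto
  qed
  \<comment> \<open>The two surviving points must have equal labels and may have any common one,
    since the closed pair can take the opposite label. Their lower ends therefore become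
    partners.\<close>
  have joined: "image_rel n K R \<in> states0 n"
    if D: "?A - D = {x, y}" "x \<noteq> y" and s: "\<And>c. \<exists>s. ?ok s \<and> agrees d s \<and> s x = c \<and> s y = c"
      and ok: "\<And>s. ?ok s \<Longrightarrow> s x = s y" for x y
  proof -
    have fe: "points n - Q = {f x, f y}" "f x \<noteq> f y" using f D(2) unfolding D(1) by (auto simp: bij_betw_def)
    let ?u = "q(f x := f y, f y := f x)"
    have nQ: "f x \<notin> Q" "f y \<notin> Q" using fe(1) by blast+
    have "Q \<union> {f x, f y} = points n" using fe(1) q(2) by blast
    then have u: "?u \<in> perfect n" unfolding perfect_def using matching_join[OF q(1) fe(2) nQ] by simp
    have qf: "q (f x) = f x" "q (f y) = f y" using nQ matching_fix_iff[OF q(1)] by auto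
    have au: "agrees ?u r \<longleftrightarrow> agrees q r \<and> r (f x) = r (f y)" for r
      using qf fe(2) unfolding agrees_def by (smt (verit) fun_upd_apply)
    have "image_rel n K R = cls0 ?u"
    proof
      show "image_rel n K R \<subseteq> cls0 ?u"
      proof
        fix r assume "r \<in> image_rel n K R"
        then obtain s where s': "?ok s" "agrees q r" "s x = r (f x)" "s y = r (f y)"
          unfolding img SR D by blast
        have "s x = s y" by (rule ok[OF s'(1)])
        then show "r \<in> cls0 ?u" using s'(2-4) by (simp add: cls0_def au)
      qed
      show "cls0 ?u \<subseteq> image_rel n K R"
      proof
        fix r assume "r \<in> cls0 ?u"
        then have r: "agrees q r" "r (f x) = r (f y)" by (simp_all add: cls0_def au)
        obtain t where t: "?ok t \<and> agrees d t \<and> t x = r (f x) \<and> t y = r (f x)" using s ..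
        then have "\<forall>v\<in>{x, y}. t v = r (f v)" using r(2) by simp
        with t r(1) show "r \<in> image_rel n K R" unfolding img SR D by (intro CollectI exI[of _ t]) auto
      qed
    qed
    then show ?thesis using u by (simp add: states0_def)
  qed
  consider "d 1 \<in> {3, 4} \<or> d 2 \<in> {3, 4}" | "d 1 = 2" "d 2 = 1" "d 3 = 4" "d 4 = 3"
    | "d 1 = 2" "d 2 = 1" "d 3 = 3" "d 4 = 4" | "d 1 = 1" "d 2 = 2" "d 3 = 4" "d 4 = 3"
    | "d 1 = 1" "d 2 = 2" "d 3 = 3" "d 4 = 4"
    using dA[of 1] dA[of 2] dA[of 3] dA[of 4] dd[of 1] dd[of 2] dd[of 3] dd[of 4] by auto
  then show ?thesis
  proof cases
    case 1
    then show ?thesis using empty[OF refl, of 1] empty[OF refl, of 2] by auto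
  next
    case 2
    then have D: "?A - D = {}" by (simp add: insert_Diff_if Dx)
    then have "points n - Q = {}" using f by (simp add: bij_betw_def)
    then have "Q = points n" using q(2) by blast
    then have qp: "q \<in> perfect n" using q(1) by (simp add: perfect_def)
    have ds: "agrees d (\<lambda>x. x = 1 \<or> x = 2)"
      by (rule agrees_matchingI[OF d(1)]) (use 2 d(2) in auto)
    have "image_rel n K R = cls0 q"
    proof
      show "image_rel n K R \<subseteq> cls0 q" unfolding img SR cls0_def by blast
      show "cls0 q \<subseteq> image_rel n K R"
      proof
        fix r assume "r \<in> cls0 q"
        then show "r \<in> image_rel n K R" unfolding img SR D cls0_def
          using ds by (intro CollectI exI[of _ "\<lambda>x. x = 1 \<or> x = 2"]) auto
      qed
    qed
    then show ?thesis using qp by (simp add: states0_def)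
  next
    case 3
    have "agrees d (\<lambda>x. if x = 1 \<or> x = 2 then \<not> c else c)" for c
      by (rule agrees_matchingI[OF d(1)]) (use 3 d(2) in auto)
    then have "\<exists>s. ?ok s \<and> agrees d s \<and> s 3 = c \<and> s 4 = c" for c
      by (intro exI[of _ "\<lambda>x. if x = 1 \<or> x = 2 then \<not> c else c"]) auto
    moreover have "?A - D = {3, 4}" using 3 by (simp add: insert_Diff_if Dx)
    ultimately show ?thesis using joined[of 3 4] by simp
  next
    case 4
    have "agrees d (\<lambda>x. if x = 1 \<or> x = 2 then c else \<not> c)" for c
      by (rule agrees_matchingI[OF d(1)]) (use 4 d(2) in auto)
    then have "\<exists>s. ?ok s \<and> agrees d s \<and> s 1 = c \<and> s 2 = c" for c
      by (intro exI[of _ "\<lambda>x. if x = 1 \<or> x = 2 then c else \<not> c"]) auto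
    moreover have "?A - D = {1, 2}" using 4 by (simp add: insert_Diff_if Dx)
    ultimately show ?thesis using joined[of 1 2] by simp
  next
    case 5
    then have D: "?A - D = ?A" by (simp add: insert_Diff_if Dx)
    have fe: "points n - Q = {f 1, f 2, f 3, f 4}" "distinct [f 1, f 2, f 3, f 4]"
      using f unfolding D by (auto simp: bij_betw_def inj_on_def)
    have ds: "agrees d s" for s
      by (rule agrees_matchingI[OF d(1)]) (use 5 d(2) in auto)
    have img4: "image_rel n K R = cls4 q (f 1) (f 2) (f 3) (f 4)"
    proof
      show "image_rel n K R \<subseteq> cls4 q (f 1) (f 2) (f 3) (f 4)" unfolding img SR D cls4_def by auto
      show "cls4 q (f 1) (f 2) (f 3) (f 4) \<subseteq> image_rel n K R"
      proof
        fix r assume "r \<in> cls4 q (f 1) (f 2) (f 3) (f 4)"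
        then show "r \<in> image_rel n K R" unfolding img SR D cls4_def
          using ds by (intro CollectI exI[of _ "\<lambda>x. r (f x)"]) auto
      qed
    qed
    \<comment> \<open>Upper point 1 is tied to the defect \<open>0\<close>, and the transversal at
      \<open>0\<close> leads on to the lower \<open>0\<close>; the indicator of \<open>f 1\<close>
      detects this.\<close>
    have f0: "f 1 = 0" if on: "odd n"
    proof (rule ccontr)
      assume ne: "f 1 \<noteq> 0"
      have "f 1 \<notin> Q" using fe(1) by blast
      then have "agrees q (\<lambda>y. y = f 1)" by (rule agrees_fixed_indicator[OF q(1)])
      then have "(?S OO extend_rel n R) (\<lambda>x. f x = f 1) (\<lambda>y. y = f 1)"
        unfolding SR using ds by simp
      then obtain t where t: "?S (\<lambda>x. f x = f 1) t" "extend_rel n R t (\<lambda>y. y = f 1)" by (rule relcomppE)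
      have "t i" using t(1) by simp
      moreover have "t 0 = (0 = f 1)" using t(2) on by (simp add: extend_rel_def)
      ultimately show False using i0 on ne by simp
    qed
    have "Q \<subseteq> {1..n}"
    proof
      fix x assume x: "x \<in> Q"
      then have "x \<noteq> 0" if "odd n" using f0[OF that] fe(1) by (metis DiffD2 insertI1)
      moreover have "x \<in> points n" using x q(2) by blast
      ultimately show "x \<in> {1..n}" unfolding points_cases by blast
    qed
    then show ?thesis using img4 q(1) fe f0 unfolding states4_def by blast
  qed
qed

lemma image_states:
  assumes "K \<in> states n" "brauer n R"
  shows "image_rel n K R \<in> insert {} (states n)"
  using assms image_states0 image_states2 image_states4 unfolding states_def by blast

section \<open>Counting the states\<close>

lemma card_states0: "finite (states0 n)" "card (states0 n) \<le> card (perfect n)"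
  unfolding states0_def using finite_perfect card_image_le by auto

lemma card_states2:
  assumes "even n"
  shows "finite (states2 n)" "card (states2 n) \<le> 2 * card (partial_matchings n 2)"
proof -
  define S where "S p = {K. \<exists>P i j. matching P p \<and> P \<subseteq> {1..n} \<and> {1..n} - P = {i, j} \<and> i \<noteq> j \<and>
    K = cls2 p i j}" for p
  have S: "finite (S p) \<and> card (S p) \<le> 2" if p: "p \<in> partial_matchings n 2" for p
  proof -
    obtain P a b where td: "two_defects n P p a b" using p by (rule partial_matchings_2)
    then interpret two_defects n P p a b .
    have "S p \<subseteq> {cls2 p a b, cls2 p b a}"
    proof
      fix K assume "K \<in> S p"
      then obtain Q i j where Q: "matching Q p" "{1..n} - Q = {i, j}" "i \<noteq> j" "K = cls2 p i j"
        by (auto simp: S_def)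
      have "Q = P" using Q(1) local.p by (auto simp: matching_def)
      then have "{i, j} = {a, b}" using Q(2) ab(1) by simp
      then show "K \<in> {cls2 p a b, cls2 p b a}" using Q(4) by (auto simp: doubleton_eq_iff)
    qed
    moreover have "card {cls2 p a b, cls2 p b a} \<le> 2" by (simp add: card_insert_if)
    ultimately show ?thesis by (meson card_mono finite.emptyI finite_insert finite_subset le_trans)
  qed
  have eq: "states2 n \<subseteq> (\<Union>p\<in>partial_matchings n 2. S p)"
  proof
    fix K assume "K \<in> states2 n"
    then obtain P p i j where p: "matching P p" "P \<subseteq> {1..n}" "{1..n} - P = {i, j}" "i \<noteq> j" "K = cls2 p i j"
      by (rule states2E)
    then have "card ({1..n} - P) = 2" by simp
    then have "card P + 2 = n" using p(2) card_mono[of "{1..n}" P]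
      by (simp add: card_Diff_subset finite_subset)
    then have "p \<in> partial_matchings n 2" using p unfolding partial_matchings_def by blast
    moreover have "K \<in> S p" using p unfolding S_def by blast
    ultimately show "K \<in> (\<Union>p\<in>partial_matchings n 2. S p)" by blast
  qed
  have fin: "finite (\<Union>p\<in>partial_matchings n 2. S p)" using S finite_partial_matchings by blast
  then show "finite (states2 n)" using eq finite_subset by blast
  have "card (states2 n) \<le> card (\<Union>p\<in>partial_matchings n 2. S p)" by (rule card_mono[OF fin eq])
  also have "\<dots> \<le> (\<Sum>p\<in>partial_matchings n 2. card (S p))" by (rule card_UN_le[OF finite_partial_matchings])
  also have "\<dots> \<le> (\<Sum>p\<in>partial_matchings n 2. 2)" using S by (intro sum_mono) blast
  finally show "card (states2 n) \<le> 2 * card (partial_matchings n 2)" by simp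
qed

lemma cls4_sym: "cls4 p j i k l = cls4 p i j k l" "cls4 p i j l k = cls4 p i j k l" "cls4 p k l i j = cls4 p i j k l"
  by (auto simp: cls4_def)

text \<open>By \<open>cls4_sym\<close> the point \<open>a\<close> may be moved to the front; its
  partner then determines the splitting.\<close>

lemma cls4_three:
  assumes "{i, j, k, l} = {a, b, c, d}" "distinct [i, j, k, l]" "distinct [a, b, c, d]"
  shows "cls4 p i j k l \<in> {cls4 p a b c d, cls4 p a c b d, cls4 p a d b c}"
proof -
  have main: "cls4 p a j k l \<in> {cls4 p a b c d, cls4 p a c b d, cls4 p a d b c}"
    if "{j, k, l} = {b, c, d}" "distinct [j, k, l]" for j k l
  proof -
    have "j \<in> {b, c, d}" using that(1) by blast
    moreover have "{k, l} = {j, k, l} - {j}" using that(2) by auto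
    then have "{k, l} = {b, c, d} - {j}" unfolding that(1) .
    moreover have "{b, c, d} - {b} = {c, d}" "{b, c, d} - {c} = {b, d}" "{b, c, d} - {d} = {b, c}"
      using assms(3) by auto
    ultimately consider "j = b" "{k, l} = {c, d}" | "j = c" "{k, l} = {b, d}" | "j = d" "{k, l} = {b, c}"
      by auto
    then show ?thesis by cases (auto simp: doubleton_eq_iff cls4_sym)
  qed
  have "a \<in> {i, j, k, l}" using assms(1) by blast
  moreover have rest: "{j', k', l'} = {b, c, d}" if "{a, j', k', l'} = {a, b, c, d}" "distinct [a, j', k', l']" for j' k' l'
  proof -
    have "{j', k', l'} = {a, j', k', l'} - {a}" using that(2) by auto
    also have "\<dots> = {b, c, d}" unfolding that(1) using assms(3) by auto
    finally show ?thesis .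
  qed
  ultimately consider "a = i" | "a = j" | "a = k" | "a = l" by blast
  then show ?thesis
  proof cases
    case 1
    have "{j, k, l} = {b, c, d}" by (rule rest) (use 1 assms in auto)
    from main[OF this] show ?thesis using 1 assms(2) by simp
  next
    case 2
    have "{i, k, l} = {b, c, d}" by (rule rest) (use 2 assms in \<open>auto simp: insert_commute\<close>)
    from main[OF this] show ?thesis using 2 assms(2) cls4_sym(1)[of p j i k l] by simp
  next
    case 3
    have "{l, i, j} = {b, c, d}" by (rule rest) (use 3 assms in \<open>auto simp: insert_commute\<close>)
    from main[OF this] show ?thesis using 3 assms(2) cls4_sym(3)[of p k l i j] by simp
  next
    case 4
    have "{k, i, j} = {b, c, d}" by (rule rest) (use 4 assms in \<open>auto simp: insert_commute\<close>)
    from main[OF this] show ?thesis using 4 assms(2) cls4_sym(1)[of p k l i j] cls4_sym(3)[of p k l i j] by simp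
  qed
qed

lemma card_states4:
  shows "finite (states4 n)" "card (states4 n) \<le> 3 * card (partial_matchings n (if odd n then 3 else 4))"
proof -
  let ?M = "partial_matchings n (if odd n then 3 else 4)"
  define S where "S p = {K. \<exists>P i j k l. matching P p \<and> points n - P = {i, j, k, l} \<and>
     distinct [i, j, k, l] \<and> K = cls4 p i j k l}" for p
  have S: "finite (S p) \<and> card (S p) \<le> 3" if p: "p \<in> ?M" for p
  proof -
    obtain P where P: "matching P p" "P \<subseteq> {1..n}" "card (points n - P) = 4"
      using p by (rule partial_matchings_four)
    then have "points n - P \<noteq> {}" by (metis card.empty zero_neq_numeral)
    then obtain a where "a \<in> points n - P" by blast
    then obtain b c d where F: "points n - P = {a, b, c, d}" "distinct [a, b, c, d]"
      using card_4_obtain[OF P(3)] by metis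
    have "S p \<subseteq> {cls4 p a b c d, cls4 p a c b d, cls4 p a d b c}"
    proof
      fix K assume "K \<in> S p"
      then obtain Q i j k l where Q: "matching Q p" "points n - Q = {i, j, k, l}" "distinct [i, j, k, l]" "K = cls4 p i j k l"
        unfolding S_def by blast
      have "Q = P" using Q(1) P(1) by (auto simp: matching_def)
      then have "{i, j, k, l} = {a, b, c, d}" using Q(2) F(1) by simp
      from cls4_three[OF this Q(3) F(2)] show "K \<in> {cls4 p a b c d, cls4 p a c b d, cls4 p a d b c}"
        unfolding Q(4) .
    qed
    moreover have "card {cls4 p a b c d, cls4 p a c b d, cls4 p a d b c} \<le> 3" by (simp add: card_insert_if)
    ultimately show ?thesis by (meson card_mono finite.emptyI finite_insert finite_subset le_trans)
  qed
  have eq: "states4 n \<subseteq> (\<Union>p\<in>?M. S p)"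
  proof
    fix K assume "K \<in> states4 n"
    then obtain P p i j k l where p: "matching P p" "P \<subseteq> {1..n}" "points n - P = {i, j, k, l}" "distinct [i, j, k, l]" "K = cls4 p i j k l"
      by (rule states4E)
    have "card (points n - P) = 4" unfolding p(3) using p(4) by simp
    moreover have "P \<subseteq> points n" using p(2) points_subset by blast
    ultimately have "card P + 4 = card (points n)"
      using card_mono[of "points n" P] finite_subset[OF p(2)] by (simp add: card_Diff_subset)
    also have "card (points n) = (if odd n then n + 1 else n)" by (simp add: points_def)
    finally have "card P + (if odd n then 3 else 4) = n" by (simp split: if_splits)
    then have "p \<in> ?M" using p unfolding partial_matchings_def by blast
    moreover have "K \<in> S p" using p unfolding S_def by blast
    ultimately show "K \<in> (\<Union>p\<in>?M. S p)" by blast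
  qed
  have fin: "finite (\<Union>p\<in>?M. S p)" using S finite_partial_matchings by blast
  then show "finite (states4 n)" using eq finite_subset by blast
  have "card (states4 n) \<le> card (\<Union>p\<in>?M. S p)" by (rule card_mono[OF fin eq])
  also have "\<dots> \<le> (\<Sum>p\<in>?M. card (S p))" by (rule card_UN_le[OF finite_partial_matchings])
  also have "\<dots> \<le> (\<Sum>p\<in>?M. 3)" using S by (intro sum_mono) blast
  finally show "card (states4 n) \<le> 3 * card ?M" by simp
qed

lemma states2_odd: "odd n \<Longrightarrow> states2 n = {}"
  by (simp add: states2_def)

lemma finite_states: "finite (states n)"
  unfolding states_def using card_states0(1) card_states4(1) card_states2(1) states2_odd
  by (cases "odd n") auto

lemma card_states: "card (states n) \<le> degree_count n"
proof -
  have "card (states n) \<le> card (states0 n) + card (states2 n) + card (states4 n)"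
    unfolding states_def by (meson card_Un_le add_le_mono1 le_trans)
  then show ?thesis
    using card_states0(2)[of n] card_states4(2)[of n] card_states2(2)[of n] states2_odd[of n]
    unfolding degree_count_def by (cases "odd n") auto
qed

section \<open>Separating states and faithfulness of the action\<close>

lemma states4_indicator:
  assumes Z: "Z \<subseteq> points n" "even (card Z)" and ij: "i \<in> Z" "j \<in> Z" "i \<noteq> j"
    and kl: "k \<in> points n - Z" "l \<in> points n - Z" "k \<noteq> l" and i0: "odd n \<Longrightarrow> i = 0"
  obtains p where "cls4 p i j k l \<in> states4 n" "(\<lambda>x. x \<in> Z) \<in> cls4 p i j k l"
proof -
  have finZ: "finite Z" using Z(1) finite_points by (rule finite_subset)
  have "even (card (points n - Z))"
    using Z even_card_points[of n] finZ card_mono[OF finite_points Z(1)]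
    by (simp add: card_Diff_subset)
  then have "even (card (points n - Z - {k, l}))" using kl by (intro even_card_Diff_pair) auto
  then obtain q where q: "matching (points n - Z - {k, l}) q" using matching_exists by (metis finite_Diff finite_points)
  have "even (card (Z - {i, j}))" using ij Z(2) finZ by (intro even_card_Diff_pair)
  then obtain p where p: "matching (Z - {i, j}) p" using matching_exists finZ by (metis finite_Diff)
  \<comment> \<open>Both sides of \<open>Z\<close> keep an even number of points after two defects
    are removed from each. The matching does not cross \<open>Z\<close>, so the indicator of
    \<open>Z\<close> is compatible with it.\<close>
  let ?P = "(Z - {i, j}) \<union> (points n - Z - {k, l})"
  let ?p = "\<lambda>x. if x \<in> Z - {i, j} then p x else q x"
  have P: "matching ?P ?p" by (rule matching_Un[OF p q]) auto
  have eq: "points n - ?P = {i, j, k, l}" using ij kl Z(1) by auto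
  have d: "distinct [i, j, k, l]" using ij kl by auto
  have "?P \<subseteq> {1..n}"
  proof
    fix x assume x: "x \<in> ?P"
    then have "x \<in> points n" using Z(1) by blast
    moreover have "x \<noteq> i" using x ij(1) by blast
    then have "x \<noteq> 0" if "odd n" using i0[OF that] by simp
    ultimately show "x \<in> {1..n}" unfolding points_cases by blast
  qed
  then have "cls4 ?p i j k l \<in> states4 n"
    unfolding states4_def using P eq d i0 by blast
  moreover have "agrees ?p (\<lambda>x. x \<in> Z)"
  proof (rule agrees_indicator)
    fix x assume x: "x \<in> Z"
    show "?p x \<in> Z"
    proof (cases "x \<in> Z - {i, j}")
      case True
      then show ?thesis using matching_in_iff[OF p, of x] by auto
    next
      case False
      then have "q x = x" using x matching_fix_iff[OF q, of x] by blast
      then show ?thesis using x False by auto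
    qed
  qed (rule matching_inv[OF P])
  then have "(\<lambda>x. x \<in> Z) \<in> cls4 ?p i j k l" using ij kl by (auto simp: cls4_def)
  ultimately show ?thesis by (rule that)
qed

lemma states2_exists:
  assumes "even n" "x \<in> {1..n}" "y \<in> {1..n}" "x \<noteq> y"
  obtains p where "cls2 p x y \<in> states2 n" "matching ({1..n} - {x, y}) p"
proof -
  have "even (card ({1..n} - {x, y}))" using assms by (intro even_card_Diff_pair) auto
  then obtain p where p: "matching ({1..n} - {x, y}) p" using matching_exists by (metis finite_Diff finite_atLeastAtMost)
  have "{1..n} - ({1..n} - {x, y}) = {x, y}" using assms by blast
  then have "cls2 p x y \<in> states2 n" unfolding states2_def using p assms by blast
  then show ?thesis using p by (rule that)
qed

text \<open>The last clause determines the label of \<open>x\<close> instead of only separating it from that of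
  \<open>y\<close>; the lower end of the transversal at \<open>x\<close> is read off from it.\<close>

lemma separating_state_fixed:
  assumes "n \<ge> 3" and p: "matching P p" "P \<subseteq> {1..n}"
    and x: "x \<in> {1..n} - P" and y: "y \<in> {1..n} - P" and xy: "x \<noteq> y"
  obtains K s where "K \<in> states n" "s \<in> K" "agrees p s" "\<And>t. t \<in> K \<Longrightarrow> t x \<noteq> t y"
    "\<And>t t'. t \<in> K \<Longrightarrow> t' \<in> K \<Longrightarrow> (odd n \<longrightarrow> t 0 = t' 0) \<Longrightarrow> t x = t' x"
proof (cases "odd n")
  case True
  let ?T = "points n - P"
  have "finite P" using p(2) finite_subset by blast
  have "P \<subseteq> points n" using p(2) points_subset by blast
  have "even (card P)" by (rule matching_even[OF p(1) \<open>finite P\<close>])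
  then have ev: "even (card ?T)"
    using even_card_points[of n] \<open>P \<subseteq> points n\<close> \<open>finite P\<close> card_mono[OF finite_points \<open>P \<subseteq> points n\<close>]
    by (simp add: card_Diff_subset)
  have 0: "0 \<in> ?T" "x \<noteq> 0" "y \<noteq> 0" "x \<in> ?T" "y \<in> ?T"
    using True p(2) x y points_subset by (auto simp: points_def)
  \<comment> \<open>By parity there is a fourth unmatched point, needed as the last defect.\<close>
  have "?T \<noteq> {0, x, y}" by (rule even_card_neq(2)[OF ev]) (use 0 xy in auto)
  then obtain t where t: "t \<in> ?T" "t \<notin> {0, x, y}" using 0 by blast
  have "{0, x} \<subseteq> points n" "even (card {0, x})" using 0 by auto
  \<comment> \<open>Pairing \<open>x\<close> with \<open>0\<close> ties their labels, so that the
    label of \<open>0\<close> determines that of \<open>x\<close>.\<close>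
  then obtain q where q: "cls4 q 0 x y t \<in> states4 n" "(\<lambda>v. v \<in> {0, x}) \<in> cls4 q 0 x y t"
    using states4_indicator[of "{0, x}" n 0 x y t] 0 t xy by auto
  have "agrees p (\<lambda>v. v \<in> {0, x})"
  proof (rule agrees_indicator)
    fix v assume "v \<in> {0, x}"
    then have "p v = v" using matching_fix_iff[OF p(1)] 0 by auto
    then show "p v \<in> {0, x}" using \<open>v \<in> {0, x}\<close> by simp
  qed (use p in simp)
  moreover have "t x \<noteq> t y" if "t \<in> cls4 q 0 x y t'" for t t' using that by (auto simp: cls4_def)
  moreover have "s x = s' x" if "s \<in> cls4 q 0 x y t" "s' \<in> cls4 q 0 x y t" "odd n \<longrightarrow> s 0 = s' 0" for s s'
    using that True by (auto simp: cls4_def)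
  ultimately show ?thesis using that[OF _ q(2)] q(1) by (auto simp: states_def)
next
  case False
  obtain q where q: "cls2 q x y \<in> states2 n" "matching ({1..n} - {x, y}) q"
    using states2_exists[of n x y] False x y xy by (metis DiffD1)
  have "agrees q (\<lambda>v. v = x)" by (rule agrees_fixed_indicator[OF q(2)]) simp
  then have s: "(\<lambda>v. v = x) \<in> cls2 q x y" using xy by (simp add: cls2_def)
  have ap: "agrees p (\<lambda>v. v = x)" by (rule agrees_fixed_indicator[OF p(1)]) (use x in simp)
  show ?thesis
    by (rule that[OF _ s ap]) (use q(1) in \<open>auto simp: states_def cls2_def\<close>)
qed

text \<open>Such a state distinguishes a diagram with upper pattern \<open>p\<close> from one with
  the upper pair \<open>{x, y}\<close>: the latter sends it to the empty set, the former does
  not.\<close>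

lemma separating_state:
  assumes n: "n \<ge> 3" and p: "matching P p" "P \<subseteq> {1..n}"
    and x: "x \<in> {1..n}" and y: "y \<in> {1..n}" and xy: "x \<noteq> y" "p x \<noteq> y"
  obtains K s where "K \<in> states n" "s \<in> K" "agrees p s" "\<And>t. t \<in> K \<Longrightarrow> t x \<noteq> t y"
proof -
  have finP: "finite P" using p(2) finite_subset by blast
  have Pp: "P \<subseteq> points n" using p(2) points_subset by blast
  let ?T = "points n - P"
  have ev: "even (card ?T)"
    using even_card_points[of n] Pp finP card_mono[OF finite_points Pp] matching_even[OF p(1) finP]
    by (simp add: card_Diff_subset)
  have xp: "x \<in> points n" "y \<in> points n" using x y points_subset by blast+
  have pin: "p v \<in> points n" if "v \<in> points n" for v
    using that Pp matching_in_iff[OF p(1), of v] matching_fix_iff[OF p(1), of v] by (cases "v \<in> P") (blast, simp)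
  have pp: "p (p v) = v" for v using p(1) by simp
  have fixp: "p v = v \<longleftrightarrow> v \<notin> P" for v by (rule matching_fix_iff[OF p(1)])
  have T0: "0 \<in> ?T" "x \<noteq> 0" "y \<noteq> 0" "p 0 = 0" if "odd n"
    using that p(2) x y fixp by (auto simp: points_def)
  note result = that
  \<comment> \<open>\<open>Z\<close> is closed under \<open>p\<close>, so its indicator is
    compatible with \<open>p\<close>; the state pairs two defects inside \<open>Z\<close> and two
    outside.\<close>
  have use_Z: thesis
    if Z: "Z \<subseteq> points n" "even (card Z)" "\<And>v. v \<in> Z \<Longrightarrow> p v \<in> Z" and ij: "i \<in> Z" "j \<in> Z" "i \<noteq> j"
    and kl: "k \<in> points n - Z" "l \<in> points n - Z" "k \<noteq> l" and i0: "odd n \<Longrightarrow> i = 0"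
    and sep: "a \<in> {i, j}" "b \<in> {k, l}" "{a, b} = {x, y}" for Z i j k l a b
  proof -
    obtain q where q: "cls4 q i j k l \<in> states4 n" "(\<lambda>v. v \<in> Z) \<in> cls4 q i j k l"
      using states4_indicator[OF Z(1,2) ij kl i0] by blast
    have "t x \<noteq> t y" if "t \<in> cls4 q i j k l" for t
    proof -
      have "t a \<noteq> t b" using that sep(1,2) by (auto simp: cls4_def)
      then show ?thesis using sep(3) by (auto simp: doubleton_eq_iff)
    qed
    moreover have "agrees p (\<lambda>v. v \<in> Z)" by (rule agrees_indicator[OF Z(3) pp])
    moreover have "cls4 q i j k l \<in> states n" using q(1) by (simp add: states_def)
    ultimately show thesis by (intro result[OF _ q(2)])
  qed
  \<comment> \<open>Just one of the two points is matched by \<open>p\<close>. \<open>Z\<close>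
    consists of the other one and a further unmatched point, which is \<open>0\<close> if
    \<open>n\<close> is odd.\<close>
  have mixed: thesis if a: "a \<in> {1..n} - P" "b \<in> {1..n}" "b \<in> P" "{a, b} = {x, y}" for a b
  proof -
    have ab: "a \<in> points n" "b \<in> points n" using a points_subset by blast+
    have "\<exists>t. t \<in> ?T \<and> t \<noteq> a \<and> (odd n \<longrightarrow> t = 0)"
    proof (cases "odd n")
      case True
      then show ?thesis using T0(1)[OF True] a(1) by (intro exI[of _ 0]) auto
    next
      case False
      have "?T \<noteq> {a}" by (rule even_card_neq(1)[OF ev])
      then show ?thesis using False ab a(1) by blast
    qed
    then obtain t where t: "t \<in> ?T" "t \<noteq> a" "odd n \<longrightarrow> t = 0" by blast
    have pb: "p b \<noteq> b" "p b \<in> P" using a(3) fixp matching_in_iff[OF p(1)] by auto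
    show thesis
    proof (rule use_Z[of "{t, a}" t a b "p b" a b])
      show "{t, a} \<subseteq> points n" "even (card {t, a})" using t ab by auto
      show "p v \<in> {t, a}" if "v \<in> {t, a}" for v
      proof -
        have "v \<notin> P" using that t a(1) by auto
        then show ?thesis using that fixp by metis
      qed
      show "b \<in> points n - {t, a}" "p b \<in> points n - {t, a}" using ab a t pb Pp by auto
    qed (use t a pb in auto)
  qed
  consider "x \<in> P" "y \<in> P" | "x \<notin> P" "y \<notin> P" | "x \<notin> P" "y \<in> P" | "x \<in> P" "y \<notin> P" by blast
  then show thesis
  proof cases
    case 1
    have ne: "p x \<noteq> x" "p y \<noteq> y" "p y \<noteq> x" "p x \<noteq> p y" "p x \<in> P" "p y \<in> P"
      using 1 fixp pp xy matching_in_iff[OF p(1)] by metis+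
    show thesis
    proof (cases "odd n")
      case True
      have "?T \<noteq> {0}" by (rule even_card_neq(1)[OF ev])
      then obtain t where t: "t \<in> ?T" "t \<noteq> 0" using T0(1)[OF True] by blast
      have d: "distinct [0, x, p x, t]" using T0[OF True] t 1 ne p(2) by auto
      show thesis
      \<comment> \<open>For odd \<open>n\<close> the first defect must be \<open>0\<close>, so the
        pair of \<open>x\<close> is enlarged by \<open>0\<close>, and by another unmatched point
        \<open>t\<close> to keep the size even.\<close>
      proof (rule use_Z[of "{0, x, p x, t}" 0 x y "p y" x y])
        show "{0, x, p x, t} \<subseteq> points n" using T0[OF True] t xp pin by auto
        show "even (card {0, x, p x, t})" using d by simp
        show "p v \<in> {0, x, p x, t}" if "v \<in> {0, x, p x, t}" for v
          using that T0(4)[OF True] pp fixp[of t] t by auto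
        show "y \<in> points n - {0, x, p x, t}" "p y \<in> points n - {0, x, p x, t}"
          using xp pin xy ne 1 t T0[OF True] p(2) by auto
      qed (use T0[OF True] ne in auto)
    next
      case False
      show thesis
      proof (rule use_Z[of "{x, p x}" x "p x" y "p y" x y])
        show "{x, p x} \<subseteq> points n" using xp pin by auto
        show "even (card {x, p x})" using ne by simp
        show "p v \<in> {x, p x}" if "v \<in> {x, p x}" for v using that pp by auto
        show "y \<in> points n - {x, p x}" "p y \<in> points n - {x, p x}" using xp pin xy ne by auto
      qed (use False ne in auto)
    qed
  next
    case 2
    show thesis
      using separating_state_fixed[OF n p, of x y] 2 x y xy(1) result by (metis DiffI)
  next
    case 3
    then show thesis using mixed[of x y] x y by simp
  next
    case 4
    then show thesis using mixed[of y x] x y by (simp add: insert_commute)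
  qed
qed

text \<open>In normal form, upper pairs, lower pairs and transversals are compared in this order,
  each time with a state whose image under one diagram contains a labeling that the other
  excludes.\<close>

lemma image_rel_faithful:
  assumes n: "n \<ge> 3" and R: "brauer n R" and R': "brauer n R'"
    and eq: "\<And>K. K \<in> states n \<Longrightarrow> image_rel n K R = image_rel n K R'"
  shows "R = R'"
proof -
  obtain P p Q q f where p: "matching P p" "P \<subseteq> {1..n}" and q: "matching Q q" "Q \<subseteq> {1..n}"
    and f: "bij_betw f ({1..n} - P) ({1..n} - Q)"
    and Rd: "\<And>s r. R s r \<longleftrightarrow> agrees p s \<and> agrees q r \<and> (\<forall>x\<in>{1..n} - P. s x = r (f x))"
    using R by (rule brauer_rel_decompose) blast
  obtain P' p' Q' q' f' where p': "matching P' p'" "P' \<subseteq> {1..n}" and q': "matching Q' q'" "Q' \<subseteq> {1..n}"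
    and f': "bij_betw f' ({1..n} - P') ({1..n} - Q')"
    and Rd': "\<And>s r. R' s r \<longleftrightarrow> agrees p' s \<and> agrees q' r \<and> (\<forall>x\<in>{1..n} - P'. s x = r (f' x))"
    using R' by (rule brauer_rel_decompose) blast
  \<comment> \<open>Labels are copied along the transversals, the label of \<open>0\<close> is kept,
    and lower pairs get False.\<close>
  have dom: "\<exists>r. extend_rel n S s r"
    if q: "matching Q q" "Q \<subseteq> {1..n}" and f: "bij_betw f ({1..n} - P) ({1..n} - Q)"
      and Rd: "\<And>s r. S s r \<longleftrightarrow> agrees p s \<and> agrees q r \<and> (\<forall>x\<in>{1..n} - P. s x = r (f x))"
      and s: "agrees p s" for p q f P Q S s
  proof -
    define g where "g = inv_into ({1..n} - P) f"
    define r where "r v = (if v \<in> {1..n} - Q then s (g v) else if v = 0 then s 0 else False)" for v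
    have "agrees q r"
    proof (rule agrees_matchingI[OF q(1)])
      fix v assume v: "v \<in> Q"
      then have "q v \<in> Q" using matching_in_iff[OF q(1)] by blast
      then show "r (q v) = r v" using v q(2) by (auto simp: r_def)
    qed
    moreover have "s x = r (f x)" if "x \<in> {1..n} - P" for x
      using bij_betw_apply[OF f that] bij_betw_inv_into_left[OF f that] by (simp add: r_def g_def)
    moreover have "r 0 = s 0" by (simp add: r_def)
    ultimately show ?thesis using Rd s by (auto simp: extend_rel_def)
  qed
  \<comment> \<open>A state that separates \<open>x\<close> from its partner \<open>p x\<close> has
    empty image under \<open>S\<close>, but not under \<open>S'\<close>.\<close>
  have upper: "p x = p' x"
    if p: "matching P p" "P \<subseteq> {1..n}"
      and Rd: "\<And>s r. S s r \<longleftrightarrow> agrees p s \<and> agrees q r \<and> (\<forall>x\<in>{1..n} - P. s x = r (f x))"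
      and p': "matching P' p'" "P' \<subseteq> {1..n}" and q': "matching Q' q'" "Q' \<subseteq> {1..n}"
      and f': "bij_betw f' ({1..n} - P') ({1..n} - Q')"
      and Rd': "\<And>s r. S' s r \<longleftrightarrow> agrees p' s \<and> agrees q' r \<and> (\<forall>x\<in>{1..n} - P'. s x = r (f' x))"
      and eq: "\<And>K. K \<in> states n \<Longrightarrow> image_rel n K S = image_rel n K S'" and x: "x \<in> P"
    for p q f P S p' q' f' P' Q' S' x
  proof (rule ccontr)
    assume ne: "p x \<noteq> p' x"
    have px: "p x \<in> P" "p x \<noteq> x" using x matching_in_iff[OF p(1)] matching_fix_iff[OF p(1)] by auto
    have xn: "x \<in> {1..n}" "p x \<in> {1..n}" using x px p(2) by blast+
    obtain K s where K: "K \<in> states n" "s \<in> K" "agrees p' s" "\<And>t. t \<in> K \<Longrightarrow> t x \<noteq> t (p x)"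
      using separating_state[OF n p' xn px(2)[symmetric] ne[symmetric]] by metis
    obtain r where "extend_rel n S' s r" using dom[OF q' f' Rd' K(3)] by blast
    then have "r \<in> image_rel n K S" unfolding eq[OF K(1)] using K(2) by (auto simp: image_rel_def)
    then obtain t where t: "t \<in> K" "agrees p t" by (auto simp: image_rel_def extend_rel_def Rd)
    then show False using K(4)[OF t(1)] agreesD[OF t(2), of x] by simp
  qed
  have P_eq: "p = p'"
  proof
    fix x
    have "p x = p' x" if "x \<in> P" by (rule upper[OF p Rd p' q' f' Rd' eq that])
    moreover have "p' x = p x" if "x \<in> P'" by (rule upper[OF p' Rd' p q f Rd eq[symmetric] that])
    ultimately show "p x = p' x" using matching_fix_iff[OF p(1), of x] matching_fix_iff[OF p'(1), of x] by metis
  qed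
  then have PP: "P = P'" using p(1) p'(1) by (auto simp: matching_def)
  have lower: "q y = q' y"
    if q: "matching Q q" "Q \<subseteq> {1..n}"
      and Rd: "\<And>s r. S s r \<longleftrightarrow> agrees p s \<and> agrees q r \<and> (\<forall>x\<in>{1..n} - P. s x = r (f x))"
      and p': "matching P' p'" "P' \<subseteq> {1..n}" and q': "matching Q' q'" "Q' \<subseteq> {1..n}"
      and f': "bij_betw f' ({1..n} - P') ({1..n} - Q')"
      and Rd': "\<And>s r. S' s r \<longleftrightarrow> agrees p' s \<and> agrees q' r \<and> (\<forall>x\<in>{1..n} - P'. s x = r (f' x))"
      and eq: "\<And>K. K \<in> states n \<Longrightarrow> image_rel n K S = image_rel n K S'" and y: "y \<in> Q"
    for p q f P Q S p' q' f' P' Q' S' y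
  proof (rule ccontr)
    assume ne: "q y \<noteq> q' y"
    have qy: "q y \<in> Q" "q y \<noteq> y" using y matching_in_iff[OF q(1)] matching_fix_iff[OF q(1)] by auto
    have yn: "y \<in> {1..n}" "q y \<in> {1..n}" using y qy q(2) by blast+
    have no: False if "K \<in> states n" "s \<in> K" "extend_rel n S' s r" "r y \<noteq> r (q y)" for K s r
    proof -
      have "r \<in> image_rel n K S" unfolding eq[OF that(1)] using that by (auto simp: image_rel_def)
      then have "agrees q r" by (auto simp: image_rel_def extend_rel_def Rd)
      then show False using that(4) agreesD[of q r y] by simp
    qed
    \<comment> \<open>If \<open>y\<close> or \<open>q y\<close> belonged to a lower pair of
      \<open>S'\<close>, then the indicator of that pair would be related to the constant labeling
      False, which lies in every \<open>cls0 u\<close>; it takes different values at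
      \<open>y\<close> and \<open>q y\<close>.\<close>
    have edge: False if v: "v \<in> Q'" "v \<in> {y, q y}" for v
    proof -
      obtain u where u: "u \<in> perfect n" using perfect_exists by blast
      have "q' v \<notin> {y, q y} - {v}" using v ne matching_swap_eq[OF q'(1)] by (metis DiffE insert_iff singletonD)
      have "agrees q' (\<lambda>k. k \<in> {v, q' v})" by (rule agrees_indicator) (use q'(1) in auto)
      moreover have "k \<notin> {v, q' v}" if "k \<in> {0} \<union> ({1..n} - Q')" for k
        using that v(1) q'(2) matching_in_iff[OF q'(1), of v] by auto
      moreover have "f' k \<in> {1..n} - Q'" if "k \<in> {1..n} - P'" for k by (rule bij_betw_apply[OF f' that])
      ultimately have "extend_rel n S' (\<lambda>_. False) (\<lambda>k. k \<in> {v, q' v})"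
        unfolding extend_rel_def Rd' using agrees_const[of p' False] by blast
      moreover have "cls0 u \<in> states n" "(\<lambda>_. False) \<in> cls0 u"
        using u by (auto simp: states_def states0_def cls0_def agrees_const)
      ultimately show False using no[of "cls0 u" "\<lambda>_. False" "\<lambda>k. k \<in> {v, q' v}"] v \<open>q' v \<notin> {y, q y} - {v}\<close> qy(2) by auto
    qed
    then have "y \<in> {1..n} - Q'" "q y \<in> {1..n} - Q'" using yn by auto
    then have "y \<in> f' ` ({1..n} - P')" "q y \<in> f' ` ({1..n} - P')"
      by (simp_all only: bij_betw_imp_surj_on[OF f'])
    \<comment> \<open>Both points are now lower ends of transversals of \<open>S'\<close>; a
      separating state gives their upper ends different labels.\<close>
    then obtain x x' where x: "x \<in> {1..n} - P'" "f' x = y" "x' \<in> {1..n} - P'" "f' x' = q y"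
      by (elim imageE) metis
    have xx: "x \<noteq> x'" "p' x \<noteq> x'" using x qy matching_fix_iff[OF p'(1), of x] by auto
    obtain K s where K: "K \<in> states n" "s \<in> K" "agrees p' s" "\<And>t. t \<in> K \<Longrightarrow> t x \<noteq> t x'"
      using separating_state[OF n p' _ _ xx] x by (metis DiffD1)
    obtain r where r: "extend_rel n S' s r" using dom[OF q' f' Rd' K(3)] by blast
    then have "s x = r y" "s x' = r (q y)" using x by (auto simp: extend_rel_def Rd')
    then show False using no[OF K(1,2) r] K(4)[OF K(2)] by simp
  qed
  have Q_eq: "q = q'"
  proof
    fix x
    have "q x = q' x" if "x \<in> Q" by (rule lower[OF q Rd p' q' f' Rd' eq that])
    moreover have "q' x = q x" if "x \<in> Q'" by (rule lower[OF q' Rd' p q f Rd eq[symmetric] that])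
    ultimately show "q x = q' x" using matching_fix_iff[OF q(1), of x] matching_fix_iff[OF q'(1), of x] by metis
  qed
  then have QQ: "Q = Q'" using q(1) q'(1) by (auto simp: matching_def)
  have "f x = f' x" if x: "x \<in> {1..n} - P" for x
  proof (rule ccontr)
    assume ne: "f x \<noteq> f' x"
    have "f x \<in> {1..n} - Q'" using bij_betw_apply[OF f x] QQ by simp
    then obtain k where k: "k \<in> {1..n} - P" "f' k = f x"
      using bij_betw_imp_surj_on[OF f'] PP by (metis imageE)
    have "x \<noteq> k" using ne k by auto
    show False
    proof (rule separating_state_fixed[OF n p x k(1) \<open>x \<noteq> k\<close>])
      fix K s assume K: "K \<in> states n" "s \<in> K" "agrees p s" "\<And>t. t \<in> K \<Longrightarrow> t x \<noteq> t k"
        "\<And>t t'. t \<in> K \<Longrightarrow> t' \<in> K \<Longrightarrow> (odd n \<longrightarrow> t 0 = t' 0) \<Longrightarrow> t x = t' x"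
      have "agrees p' s" using K(3) P_eq by simp
      then obtain r where r: "extend_rel n R' s r" using dom[OF q' f' Rd'] by blast
      then have "r \<in> image_rel n K R" unfolding eq[OF K(1)] using K(2) by (auto simp: image_rel_def)
      then obtain t where t: "t \<in> K" "extend_rel n R t r" by (auto simp: image_rel_def)
      have "t x = r (f x)" using t(2) x by (simp add: extend_rel_def Rd)
      moreover have "s k = r (f x)" using r k PP by (auto simp: extend_rel_def Rd')
      \<comment> \<open>\<open>s\<close> and \<open>t\<close> share the label of \<open>r\<close> at
        \<open>0\<close> if \<open>n\<close> is odd, and this fixes the label of \<open>x\<close>
        within \<open>K\<close>.\<close>
      moreover have "t x = s x" using t(2) r by (intro K(5)[OF t(1) K(2)]) (auto simp: extend_rel_def)
      ultimately show False using K(4)[OF K(2)] by simp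
    qed
  qed
  then have "(\<forall>x\<in>{1..n} - P. s x = r (f x)) \<longleftrightarrow> (\<forall>x\<in>{1..n} - P'. s x = r (f' x))"
    for s r :: "nat \<Rightarrow> bool" unfolding PP by simp
  then show ?thesis unfolding fun_eq_iff Rd Rd' using P_eq Q_eq by simp
qed

text \<open>For odd \<open>n\<close> the defect \<open>0\<close> of \<open>K0\<close> is kept by all
  diagrams, and a diagram can send \<open>j\<close>, \<open>k\<close>, \<open>l\<close> to any three
  other defects in a prescribed order. Closing \<open>k\<close> with \<open>l\<close> instead leaves
  \<open>j\<close>, whose label is that of \<open>0\<close>, and yields the perfect
  matchings.\<close>

lemma orbit_states:
  assumes "odd n" and K0: "K0 \<in> states4 n" and K: "K \<in> states n"
  obtains R where "brauer n R" "image_rel n K0 R = K"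
proof -
  obtain P p i j k l where p: "matching P p" "P \<subseteq> {1..n}" and F: "points n - P = {i, j, k, l}" "distinct [i, j, k, l]"
    and i0: "odd n \<longrightarrow> i = 0" and K0e: "K0 = cls4 p i j k l" using K0 by (rule states4E)
  have i: "i = 0" using i0 \<open>odd n\<close> by simp
  have pts: "points n = insert 0 {1..n}" using \<open>odd n\<close> by (auto simp: points_def)
  have nP: "{1..n} - P = {j, k, l}"
  proof -
    have "{1..n} - P = points n - P - {0}" unfolding pts by auto
    also have "\<dots> = {j, k, l}" unfolding F(1) using F(2) i by auto
    finally show ?thesis .
  qed
  have jkl: "j \<noteq> 0" "k \<noteq> 0" "l \<noteq> 0" "j \<notin> P" "k \<notin> P" "l \<notin> P" "0 \<notin> P" using F i p(2) nP by auto
  \<comment> \<open>A labeling of \<open>K0\<close> with prescribed value at \<open>0\<close>; it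
    provides the preimages below.\<close>
  have two: "agrees p (\<lambda>x. if x \<in> {0, j} then c else \<not> c)" for c
  proof (rule agrees_matchingI[OF p(1)])
    fix x assume x: "x \<in> P"
    then have "p x \<in> P" using matching_in_iff[OF p(1)] by blast
    with x have "x \<notin> {0, j}" "p x \<notin> {0, j}" using jkl(4,7) by (metis insertE singletonD)+
    then show "(if p x \<in> {0, j} then c else \<not> c) = (if x \<in> {0, j} then c else \<not> c)"
      by (simp only: if_False)
  qed
  consider "K \<in> states0 n" | "K \<in> states4 n"
    using K states2_odd[OF \<open>odd n\<close>] by (auto simp: states_def)
  then show ?thesis
  proof cases
    case 1
    then obtain u where u: "u \<in> perfect n" "K = cls0 u" by (auto simp: states0_def)
    note U = perfect_odd_cut[OF u(1) \<open>odd n\<close>]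
    let ?q = "u(0 := 0, u 0 := u 0)"
    let ?p = "p(k := l, l := k)"
    have kl: "k \<noteq> l" using F by auto
    have pk: "matching (P \<union> {k, l}) ?p" by (rule matching_join[OF p(1) kl jkl(5,6)])
    have dom: "{1..n} - (P \<union> {k, l}) = {j}"
    proof -
      have "{1..n} - (P \<union> {k, l}) = {1..n} - P - {k, l}" by blast
      also have "\<dots> = {j}" unfolding nP using F(2) by auto
      finally show ?thesis .
    qed
    have cod: "{1..n} - ({1..n} - {u 0}) = {u 0}" using U(2) by auto
    have "brauer n (\<lambda>s r. agrees ?p s \<and> agrees ?q r \<and> (\<forall>x\<in>{1..n} - (P \<union> {k, l}). s x = r (u 0)))"
    proof (rule brauer_rel_link[OF pk U(1)])
      show "P \<union> {k, l} \<subseteq> {1..n}" using p(2) nP by blast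
      show "bij_betw (\<lambda>_. u 0) ({1..n} - (P \<union> {k, l})) ({1..n} - ({1..n} - {u 0}))"
        unfolding dom cod by (auto simp: bij_betw_def)
    qed auto
    then have B: "brauer n (\<lambda>s r. agrees ?p s \<and> agrees ?q r \<and> s j = r (u 0))" (is "brauer n ?R")
      unfolding dom by simp
    have au: "agrees u r \<longleftrightarrow> agrees ?q r \<and> r (u 0) = r 0" for r
      using U(3)[of r "r 0"] by simp
    have "image_rel n K0 ?R = K"
    proof
      show "image_rel n K0 ?R \<subseteq> K"
        unfolding u(2) image_rel_def cls0_def au K0e cls4_def using i \<open>odd n\<close> by (auto simp: extend_rel_def)
      show "K \<subseteq> image_rel n K0 ?R"
      proof
        fix r assume "r \<in> K"
        then have r: "agrees ?q r" "r (u 0) = r 0" by (auto simp: u(2) cls0_def au)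
        let ?s = "\<lambda>x. if x \<in> {0, j} then r 0 else \<not> r 0"
        have "?s \<in> K0" unfolding K0e cls4_def using two[of "r 0"] jkl F i by auto
        moreover have "agrees ?p ?s"
        proof -
          have "agrees ?p s" if "agrees p s" "s k = s l" for s using that by (simp add: agrees_def)
          from this[OF two[of "r 0"]] show ?thesis using jkl F(2) by auto
        qed
        then have "extend_rel n ?R ?s r" using r by (simp add: extend_rel_def)
        ultimately show "r \<in> image_rel n K0 ?R" unfolding image_rel_def by blast
      qed
    qed
    with B show ?thesis by (rule that)
  next
    case 2
    then obtain Q q i' j' k' l' where q: "matching Q q" "Q \<subseteq> {1..n}" and F': "points n - Q = {i', j', k', l'}" "distinct [i', j', k', l']"
      and i0': "odd n \<longrightarrow> i' = 0" and Ke: "K = cls4 q i' j' k' l'" by (rule states4E)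
    have i': "i' = 0" using i0' \<open>odd n\<close> by simp
    have nQ: "{1..n} - Q = {j', k', l'}"
    proof -
      have "{1..n} - Q = points n - Q - {0}" unfolding pts by auto
      also have "\<dots> = {j', k', l'}" unfolding F'(1) using F'(2) i' by auto
      finally show ?thesis .
    qed
    let ?f = "\<lambda>x. if x = j then j' else if x = k then k' else l'"
    have "bij_betw ?f ({1..n} - P) ({1..n} - Q)"
      unfolding nP nQ using F(2) F'(2) by (auto simp: bij_betw_def inj_on_def)
    then have "brauer n (\<lambda>s r. agrees p s \<and> agrees q r \<and> (\<forall>x\<in>{1..n} - P. s x = r (?f x)))"
      by (rule brauer_rel_link[OF p(1) q(1) p(2) q(2)])
    then have B: "brauer n (\<lambda>s r. agrees p s \<and> agrees q r \<and> s j = r j' \<and> s k = r k' \<and> s l = r l')" (is "brauer n ?R")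
      unfolding nP using F(2) by simp
    have "image_rel n K0 ?R = K"
    proof
      show "image_rel n K0 ?R \<subseteq> K"
        unfolding Ke image_rel_def K0e cls4_def using i i' \<open>odd n\<close> by (auto simp: extend_rel_def)
      show "K \<subseteq> image_rel n K0 ?R"
      proof
        fix r assume "r \<in> K"
        then have r: "agrees q r" "r 0 = r j'" "r k' = r l'" "r 0 \<noteq> r k'" by (auto simp: Ke cls4_def i')
        let ?s = "\<lambda>x. if x \<in> {0, j} then r 0 else \<not> r 0"
        have "?s \<in> K0" unfolding K0e cls4_def using two[of "r 0"] jkl F i by auto
        moreover have "extend_rel n ?R ?s r" using r two[of "r 0"] jkl F(2) by (auto simp: extend_rel_def)
        ultimately show "r \<in> image_rel n K0 ?R" unfolding image_rel_def by blast
      qed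
    qed
    with B show ?thesis by (rule that)
  qed
qed

lemma states4_nonempty:
  assumes "n \<ge> 3" "odd n"
  shows "states4 n \<noteq> {}"
proof -
  have "(2::nat) \<in> points n - {0, 1}" "(3::nat) \<in> points n - {0, 1}" "{0, 1} \<subseteq> points n"
    using assms by (auto simp: points_def)
  then obtain p where "cls4 p 0 1 2 3 \<in> states4 n"
    using states4_indicator[of "{0, 1}" n 0 1 2 3] by auto
  then show ?thesis by blast
qed

section \<open>The degrees\<close>

lemma embeds_partial_transformation:
  assumes "finite Y"
    and f: "\<And>a. a \<in> carrier S \<Longrightarrow> dom (f a) \<subseteq> Y \<and> ran (f a) \<subseteq> Y"
    and hom: "\<And>a b. a \<in> carrier S \<Longrightarrow> b \<in> carrier S \<Longrightarrow> f (a \<otimes>\<^bsub>S\<^esub> b) = f b \<circ>\<^sub>m f a"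
    and inj: "inj_on f (carrier S)"
  shows "embeds S (partial_transformation_monoid (card Y))"
proof -
  obtain h where h: "bij_betw h {1..card Y} Y" using ex_bij_betw_nat_finite_1[OF assms(1)] by blast
  define g where "g = inv_into {1..card Y} h"
  have hg: "h (g y) = y" "g y \<in> {1..card Y}" if "y \<in> Y" for y
    using h that bij_betw_apply[OF bij_betw_inv_into[OF h] that] by (auto simp: g_def bij_betw_inv_into_right)
  define \<phi> where "\<phi> a i = (if i \<in> {1..card Y} then map_option g (f a (h i)) else None)" for a i
  have fY: "y' \<in> Y" if "a \<in> carrier S" "f a y = Some y'" for a y y' using f that by (auto simp: ran_def)
  have mem: "\<phi> a \<in> carrier (partial_transformation_monoid (card Y))" if a: "a \<in> carrier S" for a
  proof -
    have "dom (\<phi> a) \<subseteq> {1..card Y}" by (auto simp: \<phi>_def split: if_splits)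
    moreover have "ran (\<phi> a) \<subseteq> {1..card Y}"
    proof
      fix k assume "k \<in> ran (\<phi> a)"
      then obtain i y where "f a (h i) = Some y" "k = g y" by (auto simp: ran_def \<phi>_def split: if_splits)
      then show "k \<in> {1..card Y}" using fY[OF a] hg(2) by simp
    qed
    ultimately show ?thesis by (simp add: partial_transformation_monoid_def)
  qed
  have homphi: "\<phi> (a \<otimes>\<^bsub>S\<^esub> b) = \<phi> b \<circ>\<^sub>m \<phi> a" if ab: "a \<in> carrier S" "b \<in> carrier S" for a b
  proof
    fix i
    show "\<phi> (a \<otimes>\<^bsub>S\<^esub> b) i = (\<phi> b \<circ>\<^sub>m \<phi> a) i"
      using hg fY[OF ab(1)] by (cases "f a (h i)") (auto simp: \<phi>_def hom[OF ab] map_comp_def)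
  qed
  have "inj_on \<phi> (carrier S)"
  proof (rule inj_onI)
    fix a b assume ab: "a \<in> carrier S" "b \<in> carrier S" and eq: "\<phi> a = \<phi> b"
    have "f a y = f b y" for y
    proof (cases "y \<in> Y")
      case True
      then have "\<phi> a (g y) = \<phi> b (g y)" using eq by simp
      then have "map_option g (f a y) = map_option g (f b y)" using hg[OF True] by (simp add: \<phi>_def)
      then show ?thesis using fY[OF ab(1)] fY[OF ab(2)] hg(1)
        by (cases "f a y"; cases "f b y") (auto, metis)
    next
      case False
      then have "y \<notin> dom (f a)" "y \<notin> dom (f b)" using f ab by blast+
      then show ?thesis by (simp add: domIff)
    qed
    then have "f a = f b" by (rule ext)
    then show "a = b" by (rule inj_onD[OF inj _ ab])
  qed
  with mem homphi have "\<phi> \<in> mon S (partial_transformation_monoid (card Y))"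
    by (auto simp: mon_def hom_def partial_transformation_monoid_def)
  then show ?thesis unfolding embeds_def by blast
qed

lemma embeds_full_transformation:
  assumes "finite Y"
    and f: "\<And>a y. a \<in> carrier S \<Longrightarrow> y \<in> Y \<Longrightarrow> f a y \<in> Y"
    and closed: "\<And>a b. a \<in> carrier S \<Longrightarrow> b \<in> carrier S \<Longrightarrow> a \<otimes>\<^bsub>S\<^esub> b \<in> carrier S"
    and hom: "\<And>a b y. a \<in> carrier S \<Longrightarrow> b \<in> carrier S \<Longrightarrow> y \<in> Y \<Longrightarrow> f (a \<otimes>\<^bsub>S\<^esub> b) y = f b (f a y)"
    and inj: "\<And>a b. a \<in> carrier S \<Longrightarrow> b \<in> carrier S \<Longrightarrow> (\<And>y. y \<in> Y \<Longrightarrow> f a y = f b y) \<Longrightarrow> a = b"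
  shows "embeds S (full_transformation_monoid (card Y))"
proof -
  obtain h where h: "bij_betw h {1..card Y} Y" using ex_bij_betw_nat_finite_1[OF assms(1)] by blast
  define g where "g = inv_into {1..card Y} h"
  have hY: "h i \<in> Y" if "i \<in> {1..card Y}" for i by (rule bij_betw_apply[OF h that])
  have hg: "h (g y) = y" "g y \<in> {1..card Y}" if "y \<in> Y" for y
    using h that bij_betw_apply[OF bij_betw_inv_into[OF h] that] by (auto simp: g_def bij_betw_inv_into_right)
  define \<phi> where "\<phi> a = (\<lambda>i\<in>{1..card Y}. g (f a (h i)))" for a
  have mem: "\<phi> a \<in> {1..card Y} \<rightarrow>\<^sub>E {1..card Y}" if "a \<in> carrier S" for a
    unfolding \<phi>_def restrict_PiE_iff using hg(2) f[OF that] hY by blast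
  have homphi: "\<phi> (a \<otimes>\<^bsub>S\<^esub> b) = compose {1..card Y} (\<phi> b) (\<phi> a)" if ab: "a \<in> carrier S" "b \<in> carrier S" for a b
  proof
    fix i
    show "\<phi> (a \<otimes>\<^bsub>S\<^esub> b) i = compose {1..card Y} (\<phi> b) (\<phi> a) i"
    proof (cases "i \<in> {1..card Y}")
      case True
      have "f a (h i) \<in> Y" by (rule f[OF ab(1) hY[OF True]])
      then show ?thesis using True hg hom[OF ab hY[OF True]] by (simp add: \<phi>_def compose_def)
    next
      case False
      then show ?thesis by (simp only: \<phi>_def compose_def restrict_def if_False)
    qed
  qed
  have "inj_on \<phi> (carrier S)"
  proof (rule inj_onI)
    fix a b assume ab: "a \<in> carrier S" "b \<in> carrier S" and eq: "\<phi> a = \<phi> b"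
    show "a = b"
    proof (rule inj[OF ab])
      fix y assume y: "y \<in> Y"
      have "\<phi> a (g y) = \<phi> b (g y)" using eq by simp
      then have "g (f a y) = g (f b y)" using hg[OF y] by (simp add: \<phi>_def)
      then show "f a y = f b y" using hg(1) f[OF ab(1) y] f[OF ab(2) y] by metis
    qed
  qed
  with mem homphi closed have "\<phi> \<in> mon S (full_transformation_monoid (card Y))"
    by (simp add: mon_def hom_def full_transformation_monoid_def)
  then show ?thesis unfolding embeds_def by blast
qed

text \<open>Embeddings are given on diagrams, while \<open>brauer_action\<close> acts by relations;
  this inverse translates between them.\<close>

definition diagram_of :: "nat \<Rightarrow> ((nat \<Rightarrow> bool) \<Rightarrow> (nat \<Rightarrow> bool) \<Rightarrow> bool) \<Rightarrow> diagram" where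
  "diagram_of n = inv_into (brauer_elements n) diagram_rel"

lemma diagram_of:
  assumes "brauer n R"
  shows "diagram_of n R \<in> brauer_elements n" "diagram_rel (diagram_of n R) = R"
proof -
  have "R \<in> diagram_rel ` brauer_elements n" using diagram_rel_surj[OF assms] by (metis image_eqI)
  then show "diagram_of n R \<in> brauer_elements n" "diagram_rel (diagram_of n R) = R"
    unfolding diagram_of_def by (auto intro: inv_into_into f_inv_into_f)
qed

lemma diagram_of_comp:
  assumes "brauer n R" "brauer n Q"
  shows "diagram_of n (R OO Q) = diagram_mult n (diagram_of n R) (diagram_of n Q)"
proof (rule inj_onD[OF inj_on_diagram_rel])
  show "diagram_of n (R OO Q) \<in> brauer_elements n" by (rule diagram_of(1)[OF brauer_comp[OF assms]])
  show "diagram_mult n (diagram_of n R) (diagram_of n Q) \<in> brauer_elements n"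
    by (rule diagram_mult_closed) (use assms diagram_of(1) in auto)
  show "diagram_rel (diagram_of n (R OO Q)) = diagram_rel (diagram_mult n (diagram_of n R) (diagram_of n Q))"
    using diagram_rel_brauer_mult[OF diagram_of(1)[OF assms(1)] diagram_of(1)[OF assms(2)]]
      diagram_of(2)[OF brauer_comp[OF assms]] diagram_of(2)[OF assms(1)] diagram_of(2)[OF assms(2)] by simp
qed

lemma diagram_mult_assoc:
  assumes "\<alpha> \<in> brauer_elements n" "\<beta> \<in> brauer_elements n" "\<gamma> \<in> brauer_elements n"
  shows "diagram_mult n (diagram_mult n \<alpha> \<beta>) \<gamma> = diagram_mult n \<alpha> (diagram_mult n \<beta> \<gamma>)"
  by (rule inj_onD[OF inj_on_diagram_rel[of n]])
    (simp_all add: assms diagram_mult_closed diagram_rel_brauer_mult relcompp_assoc)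

lemma finite_brauer_elements: "finite (brauer_elements n)"
proof (rule finite_subset)
  show "brauer_elements n \<subseteq> Pow (Pow (verts n))"
  proof
    fix \<alpha> assume "\<alpha> \<in> brauer_elements n"
    then have "\<Union> \<alpha> = verts n" by (simp add: brauer_elements_iff partition_on_def)
    then show "\<alpha> \<in> Pow (Pow (verts n))" by blast
  qed
qed (simp add: verts_def)

section \<open>Bounds for the two transformation degrees\<close>

lemma partial_degree_lower:
  assumes n: "n \<ge> 3" and emb: "embeds (brauer_monoid n) (partial_transformation_monoid m)"
  shows "degree_count n \<le> m"
proof -
  obtain \<phi> where \<phi>: "\<phi> \<in> mon (brauer_monoid n) (partial_transformation_monoid m)"
    using emb by (auto simp: embeds_def)
  have dr: "dom (\<phi> \<alpha>) \<subseteq> {1..m}" "ran (\<phi> \<alpha>) \<subseteq> {1..m}" if "\<alpha> \<in> brauer_elements n" for \<alpha>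
    using \<phi> that by (auto simp: mon_def hom_def partial_transformation_monoid_def)
  have hom: "\<phi> (diagram_mult n \<alpha> \<beta>) = \<phi> \<beta> \<circ>\<^sub>m \<phi> \<alpha>"
    if "\<alpha> \<in> brauer_elements n" "\<beta> \<in> brauer_elements n" for \<alpha> \<beta>
    using \<phi> that by (simp add: mon_def hom_def partial_transformation_monoid_def)
  have inj: "inj_on \<phi> (brauer_elements n)" using \<phi> by (simp add: mon_def)
  \<comment> \<open>Undefined values become \<open>None\<close>, which plays the role of
    \<open>z\<close>.\<close>
  let ?act = "\<lambda>x R. Option.bind x (\<phi> (diagram_of n R))"
  interpret brauer_action n "Some ` {1..m}" None ?act
  proof
    fix x R assume x: "x \<in> Some ` {1..m}" and R: "brauer n R"
    show "?act x R \<in> insert None (Some ` {1..m})"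
    proof (cases "?act x R")
      case (Some k)
      then have "k \<in> ran (\<phi> (diagram_of n R))" using x by (auto simp: ran_def)
      then have "k \<in> {1..m}" using dr(2)[OF diagram_of(1)[OF R]] by blast
      then show ?thesis using Some by blast
    qed simp
  next
    fix x R Q assume R: "brauer n R" and Q: "brauer n Q" and x: "x \<in> Some ` {1..m}"
    show "?act (?act x R) Q = ?act x (R OO Q)"
      unfolding diagram_of_comp[OF R Q] hom[OF diagram_of(1)[OF R] diagram_of(1)[OF Q]]
      by (cases x) (auto simp: map_comp_def split: option.splits)
  next
    fix R Q assume R: "brauer n R" and Q: "brauer n Q"
      and eq: "\<And>x. x \<in> Some ` {1..m} \<Longrightarrow> ?act x R = ?act x Q"
    have "\<phi> (diagram_of n R) = \<phi> (diagram_of n Q)"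
    proof
      fix i
      show "\<phi> (diagram_of n R) i = \<phi> (diagram_of n Q) i"
      proof (cases "i \<in> {1..m}")
        case True
        then show ?thesis using eq[of "Some i"] by simp
      next
        case False
        then have "i \<notin> dom (\<phi> (diagram_of n R))" "i \<notin> dom (\<phi> (diagram_of n Q))"
          using dr(1)[OF diagram_of(1)[OF R]] dr(1)[OF diagram_of(1)[OF Q]] by blast+
        then show ?thesis by (simp add: domIff)
      qed
    qed
    then have "diagram_of n R = diagram_of n Q"
      using inj diagram_of(1)[OF R] diagram_of(1)[OF Q] by (auto simp: inj_on_def)
    then show "R = Q" using diagram_of(2)[OF R] diagram_of(2)[OF Q] by metis
  qed (use n in auto)
  have "degree_count n \<le> card (Some ` {1..m})" by (rule degree_lower_bound)
  then show ?thesis by (simp add: card_image)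
qed

lemma full_degree_lower:
  assumes n: "n \<ge> 3" and emb: "embeds (brauer_monoid n) (full_transformation_monoid m)"
  shows "degree_count n + 1 \<le> m"
proof -
  obtain \<phi> where \<phi>: "\<phi> \<in> mon (brauer_monoid n) (full_transformation_monoid m)"
    using emb by (auto simp: embeds_def)
  have mem: "\<phi> \<alpha> \<in> {1..m} \<rightarrow>\<^sub>E {1..m}" if "\<alpha> \<in> brauer_elements n" for \<alpha>
    using \<phi> that by (auto simp: mon_def hom_def full_transformation_monoid_def)
  have hom: "\<phi> (diagram_mult n \<alpha> \<beta>) = compose {1..m} (\<phi> \<beta>) (\<phi> \<alpha>)"
    if "\<alpha> \<in> brauer_elements n" "\<beta> \<in> brauer_elements n" for \<alpha> \<beta>
    using \<phi> that by (simp add: mon_def hom_def full_transformation_monoid_def)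
  have inj: "inj_on \<phi> (brauer_elements n)" using \<phi> by (simp add: mon_def)
  let ?act = "\<lambda>x R. map_option (\<phi> (diagram_of n R)) x"
  have act: "?act x R \<in> Some ` {1..m}" if "x \<in> Some ` {1..m}" "brauer n R" for x R
    using that(1) PiE_mem[OF mem[OF diagram_of(1)[OF that(2)]]] by auto
  interpret brauer_action n "Some ` {1..m}" None ?act
  proof
    fix x R assume "x \<in> Some ` {1..m}" "brauer n R"
    then show "?act x R \<in> insert None (Some ` {1..m})" using act by blast
  next
    fix x R Q assume R: "brauer n R" and Q: "brauer n Q" and x: "x \<in> Some ` {1..m}"
    show "?act (?act x R) Q = ?act x (R OO Q)"
      unfolding diagram_of_comp[OF R Q] hom[OF diagram_of(1)[OF R] diagram_of(1)[OF Q]]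
      using x by (auto simp: compose_def)
  next
    fix R Q assume R: "brauer n R" and Q: "brauer n Q"
      and eq: "\<And>x. x \<in> Some ` {1..m} \<Longrightarrow> ?act x R = ?act x Q"
    have "\<phi> (diagram_of n R) = \<phi> (diagram_of n Q)"
    proof (rule PiE_ext[OF mem[OF diagram_of(1)[OF R]] mem[OF diagram_of(1)[OF Q]]])
      fix i assume "i \<in> {1..m}"
      then show "\<phi> (diagram_of n R) i = \<phi> (diagram_of n Q) i" using eq[of "Some i"] by simp
    qed
    then have "diagram_of n R = diagram_of n Q"
      using inj diagram_of(1)[OF R] diagram_of(1)[OF Q] by (auto simp: inj_on_def)
    then show "R = Q" using diagram_of(2)[OF R] diagram_of(2)[OF Q] by metis
  qed (use n in auto)
  have "degree_count n + 1 \<le> card (Some ` {1..m})"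
    by (rule degree_lower_bound_total) (use act in force)
  then show ?thesis by (simp add: card_image)
qed

lemma image_diagram_mult:
  assumes "\<alpha> \<in> brauer_elements n" "\<beta> \<in> brauer_elements n"
  shows "image_rel n K (diagram_rel (diagram_mult n \<alpha> \<beta>)) = image_rel n (image_rel n K (diagram_rel \<alpha>)) (diagram_rel \<beta>)"
  using image_rel_comp[OF brauer_rel_diagram_rel[OF assms(1)] brauer_rel_diagram_rel[OF assms(2)]]
    diagram_rel_brauer_mult[OF assms] by simp

lemma image_diagram_faithful:
  assumes "n \<ge> 3" and \<alpha>: "\<alpha> \<in> brauer_elements n" and \<beta>: "\<beta> \<in> brauer_elements n"
    and "\<And>K. K \<in> states n \<Longrightarrow> image_rel n K (diagram_rel \<alpha>) = image_rel n K (diagram_rel \<beta>)"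
  shows "\<alpha> = \<beta>"
  using image_rel_faithful[OF assms(1) brauer_rel_diagram_rel[OF \<alpha>] brauer_rel_diagram_rel[OF \<beta>] assms(4)]
    inj_onD[OF inj_on_diagram_rel _ \<alpha> \<beta>] by blast

lemma partial_degree_upper:
  assumes n: "n \<ge> 3"
  shows "embeds (brauer_monoid n) (partial_transformation_monoid (card (states n)))"
proof -
  define f where "f \<alpha> K = (if K \<in> states n \<and> image_rel n K (diagram_rel \<alpha>) \<noteq> {}
    then Some (image_rel n K (diagram_rel \<alpha>)) else None)" for \<alpha> K
  have st: "image_rel n K (diagram_rel \<alpha>) \<in> insert {} (states n)" if "K \<in> states n" "\<alpha> \<in> brauer_elements n" for K \<alpha>
    using image_states[OF that(1) brauer_rel_diagram_rel[OF that(2)]] .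
  show ?thesis
  proof (rule embeds_partial_transformation[OF finite_states, where f = f])
    fix \<alpha> assume \<alpha>: "\<alpha> \<in> brauer_elements n"
    show "dom (f \<alpha>) \<subseteq> states n \<and> ran (f \<alpha>) \<subseteq> states n"
      using st[OF _ \<alpha>] by (auto simp: f_def dom_def ran_def split: if_splits)
  next
    fix \<alpha> \<beta> assume ab: "\<alpha> \<in> brauer_elements n" "\<beta> \<in> brauer_elements n"
    show "f (\<alpha> \<otimes>\<^bsub>brauer_monoid n\<^esub> \<beta>) = f \<beta> \<circ>\<^sub>m f \<alpha>"
    proof
      fix K
      show "f (\<alpha> \<otimes>\<^bsub>brauer_monoid n\<^esub> \<beta>) K = (f \<beta> \<circ>\<^sub>m f \<alpha>) K"
        using st[OF _ ab(1), of K]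
        by (auto simp: f_def map_comp_def image_diagram_mult[OF ab] image_rel_empty)
    qed
  next
    show "inj_on f (brauer_elements n)"
    proof (rule inj_onI)
      fix \<alpha> \<beta> assume ab: "\<alpha> \<in> brauer_elements n" "\<beta> \<in> brauer_elements n" and eq: "f \<alpha> = f \<beta>"
      show "\<alpha> = \<beta>"
      proof (rule image_diagram_faithful[OF n ab])
        fix K assume "K \<in> states n"
        then show "image_rel n K (diagram_rel \<alpha>) = image_rel n K (diagram_rel \<beta>)"
          using fun_cong[OF eq, of K] by (auto simp: f_def split: if_splits)
      qed
    qed
  qed
qed

text \<open>The empty set is kept as a sink and is the one additional point; by
  \<open>states_nonempty\<close> it is not yet a state.\<close>

lemma full_degree_upper:
  assumes n: "n \<ge> 3"
  shows "embeds (brauer_monoid n) (full_transformation_monoid (card (states n) + 1))"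
proof -
  have "embeds (brauer_monoid n) (full_transformation_monoid (card (insert {} (states n))))"
  proof (rule embeds_full_transformation[where f = "\<lambda>\<alpha> K. image_rel n K (diagram_rel \<alpha>)"])
    show "finite (insert {} (states n))" using finite_states by simp
  next
    fix \<alpha> K assume "\<alpha> \<in> brauer_elements n" "K \<in> insert {} (states n)"
    then show "image_rel n K (diagram_rel \<alpha>) \<in> insert {} (states n)"
      using image_states[OF _ brauer_rel_diagram_rel] image_rel_empty by blast
  next
    fix \<alpha> \<beta> assume "\<alpha> \<in> brauer_elements n" "\<beta> \<in> brauer_elements n"
    then show "\<alpha> \<otimes>\<^bsub>brauer_monoid n\<^esub> \<beta> \<in> brauer_elements n" by (simp add: diagram_mult_closed)
  next
    fix \<alpha> \<beta> K assume "\<alpha> \<in> brauer_elements n" "\<beta> \<in> brauer_elements n"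
    then show "image_rel n K (diagram_rel (\<alpha> \<otimes>\<^bsub>brauer_monoid n\<^esub> \<beta>)) =
        image_rel n (image_rel n K (diagram_rel \<alpha>)) (diagram_rel \<beta>)"
      by (simp add: image_diagram_mult)
  next
    fix \<alpha> \<beta> assume ab: "\<alpha> \<in> brauer_elements n" "\<beta> \<in> brauer_elements n"
      and "\<And>K. K \<in> insert {} (states n) \<Longrightarrow> image_rel n K (diagram_rel \<alpha>) = image_rel n K (diagram_rel \<beta>)"
    then show "\<alpha> = \<beta>" by (intro image_diagram_faithful[OF n ab]) blast
  qed
  then show ?thesis using finite_states states_nonempty by simp
qed

text \<open>The states carry a faithful partial action, so the lower bound applies to their number,
  which was only estimated from above.\<close>

lemma card_states_eq:
  assumes "n \<ge> 3"
  shows "card (states n) = degree_count n"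
  using partial_degree_lower[OF assms partial_degree_upper[OF assms]] card_states by (rule le_antisym[rotated])

lemma degree_count_pos:
  assumes "n \<ge> 3"
  shows "1 \<le> degree_count n"
proof -
  have "card (perfect n) \<noteq> 0" using finite_perfect perfect_exists by auto
  then show ?thesis by (simp add: degree_count_def)
qed

lemma partial_transformation_degree_brauer:
  assumes n: "n \<ge> 3"
  shows "partial_transformation_degree (brauer_monoid n) = degree_count n"
  unfolding partial_transformation_degree_def
  by (rule Least_equality)
    (use partial_degree_upper[OF n] card_states_eq[OF n] degree_count_pos[OF n] partial_degree_lower[OF n] in auto)

lemma transformation_degree_brauer:
  assumes n: "n \<ge> 3"
  shows "transformation_degree (brauer_monoid n) = degree_count n + 1"
  unfolding transformation_degree_def
proof (rule Least_equality)
  show "1 \<le> degree_count n + 1 \<and> embeds (brauer_monoid n) (full_transformation_monoid (degree_count n + 1))"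
    using full_degree_upper[OF n] card_states_eq[OF n] by simp
  fix m assume "1 \<le> m \<and> embeds (brauer_monoid n) (full_transformation_monoid m)"
  then show "degree_count n + 1 \<le> m" using full_degree_lower[OF n] by blast
qed

section \<open>Actions on right congruence classes\<close>

lemma rc_action_class:
  assumes \<sigma>: "right_congruence (brauer_monoid n) \<sigma>" and x: "x \<in> brauer_elements n" and a: "a \<in> brauer_elements n"
  shows "rc_action (brauer_monoid n) \<sigma> (\<sigma> `` {x}) a = \<sigma> `` {diagram_mult n x a}"
proof -
  have eq: "equiv (brauer_elements n) \<sigma>"
    and rc: "\<And>y y' s. (y, y') \<in> \<sigma> \<Longrightarrow> s \<in> brauer_elements n \<Longrightarrow> (diagram_mult n y s, diagram_mult n y' s) \<in> \<sigma>"
    using \<sigma> by (auto simp: right_congruence_def)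
  have "\<sigma> `` {diagram_mult n y a} = \<sigma> `` {diagram_mult n x a}" if "y \<in> \<sigma> `` {x}" for y
    using that rc[OF _ a, of x y] equiv_class_eq[OF eq] by fastforce
  moreover have "x \<in> \<sigma> `` {x}" by (rule equiv_class_self[OF eq x])
  ultimately show ?thesis unfolding rc_action_def mult_brauer_monoid by blast
qed

text \<open>A faithful action on classes embeds the monoid into full transformations of the
  classes.\<close>

lemma rc_degree_lower:
  assumes n: "n \<ge> 3" and \<sigma>: "right_congruence (brauer_monoid n) \<sigma>"
    and faithful: "faithful_action (brauer_monoid n) (brauer_elements n // \<sigma>) (rc_action (brauer_monoid n) \<sigma>)"
  shows "degree_count n + 1 \<le> card (brauer_elements n // \<sigma>)"
proof (rule full_degree_lower[OF n])
  have eq: "equiv (brauer_elements n) \<sigma>" using \<sigma> by (simp add: right_congruence_def)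
  show "embeds (brauer_monoid n) (full_transformation_monoid (card (brauer_elements n // \<sigma>)))"
  proof (rule embeds_full_transformation[where f = "\<lambda>a C. rc_action (brauer_monoid n) \<sigma> C a"])
    show "finite (brauer_elements n // \<sigma>)"
      by (rule finite_quotient[OF finite_brauer_elements]) (use eq in \<open>auto simp: equiv_def refl_on_def\<close>)
  next
    fix a C assume a: "a \<in> brauer_elements n" and "C \<in> brauer_elements n // \<sigma>"
    then obtain x where "x \<in> brauer_elements n" "C = \<sigma> `` {x}" by (auto elim: quotientE)
    then show "rc_action (brauer_monoid n) \<sigma> C a \<in> brauer_elements n // \<sigma>"
      using rc_action_class[OF \<sigma> _ a] diagram_mult_closed[OF _ a] by (auto intro: quotientI)
  next
    fix a b assume "a \<in> brauer_elements n" "b \<in> brauer_elements n"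
    then show "a \<otimes>\<^bsub>brauer_monoid n\<^esub> b \<in> brauer_elements n" by (simp add: diagram_mult_closed)
  next
    fix a b C assume a: "a \<in> brauer_elements n" and b: "b \<in> brauer_elements n" and "C \<in> brauer_elements n // \<sigma>"
    then obtain x where x: "x \<in> brauer_elements n" "C = \<sigma> `` {x}" by (auto elim: quotientE)
    show "rc_action (brauer_monoid n) \<sigma> C (a \<otimes>\<^bsub>brauer_monoid n\<^esub> b) =
        rc_action (brauer_monoid n) \<sigma> (rc_action (brauer_monoid n) \<sigma> C a) b"
      using x a b by (simp add: rc_action_class[OF \<sigma>] diagram_mult_closed diagram_mult_assoc)
  next
    fix a b assume "a \<in> brauer_elements n" "b \<in> brauer_elements n"
      and "\<And>C. C \<in> brauer_elements n // \<sigma> \<Longrightarrow> rc_action (brauer_monoid n) \<sigma> C a = rc_action (brauer_monoid n) \<sigma> C b"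
    then show "a = b" using faithful unfolding faithful_action_def by blast
  qed
qed

text \<open>For odd \<open>n\<close> a single point of \<^const>\<open>states4\<close> generates all of \<^const>\<open>states\<close>, so the kernel of
  its orbit map is a faithful right congruence.\<close>

lemma rc_degree_upper:
  assumes n: "n \<ge> 3" and "odd n"
  obtains \<sigma> where "right_congruence (brauer_monoid n) \<sigma>"
    "faithful_action (brauer_monoid n) (brauer_elements n // \<sigma>) (rc_action (brauer_monoid n) \<sigma>)"
    "card (brauer_elements n // \<sigma>) \<le> degree_count n + 1"
proof -
  obtain K0 where K0: "K0 \<in> states4 n" using states4_nonempty[OF n \<open>odd n\<close>] by blast
  define orb where "orb \<alpha> = image_rel n K0 (diagram_rel \<alpha>)" for \<alpha>
  define \<sigma> where "\<sigma> = {(\<alpha>, \<beta>). \<alpha> \<in> brauer_elements n \<and> \<beta> \<in> brauer_elements n \<and> orb \<alpha> = orb \<beta>}"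
  have eq: "equiv (brauer_elements n) \<sigma>"
    by (rule equivI) (auto simp: \<sigma>_def refl_on_def sym_def trans_def)
  have orb_mult: "orb (diagram_mult n \<alpha> \<beta>) = image_rel n (orb \<alpha>) (diagram_rel \<beta>)"
    if "\<alpha> \<in> brauer_elements n" "\<beta> \<in> brauer_elements n" for \<alpha> \<beta>
    unfolding orb_def by (rule image_diagram_mult[OF that])
  have rc: "right_congruence (brauer_monoid n) \<sigma>"
    unfolding right_congruence_def using eq orb_mult diagram_mult_closed by (auto simp: \<sigma>_def)
  have cls: "\<sigma> `` {\<alpha>} = {\<beta> \<in> brauer_elements n. orb \<beta> = orb \<alpha>}" if "\<alpha> \<in> brauer_elements n" for \<alpha>
    using that by (auto simp: \<sigma>_def)
  have "faithful_action (brauer_monoid n) (brauer_elements n // \<sigma>) (rc_action (brauer_monoid n) \<sigma>)"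
    unfolding faithful_action_def
  proof (intro ballI impI)
    fix a b assume a: "a \<in> brauer_elements n" and b: "b \<in> brauer_elements n" and "a \<noteq> b"
    then obtain K where K: "K \<in> states n" "image_rel n K (diagram_rel a) \<noteq> image_rel n K (diagram_rel b)"
      using image_diagram_faithful[OF n a b] by blast
    obtain R where R: "brauer n R" "image_rel n K0 R = K" using orbit_states[OF \<open>odd n\<close> K0 K(1)] by blast
    obtain c where c: "c \<in> brauer_elements n" "orb c = K"
      using diagram_of[OF R(1)] R(2) unfolding orb_def by metis
    have "orb (diagram_mult n c a) \<noteq> orb (diagram_mult n c b)"
      using K(2) orb_mult[OF c(1) a] orb_mult[OF c(1) b] c(2) by simp
    then have "\<sigma> `` {diagram_mult n c a} \<noteq> \<sigma> `` {diagram_mult n c b}"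
      using cls diagram_mult_closed[OF c(1)] a b by blast
    then show "\<exists>C\<in>brauer_elements n // \<sigma>. rc_action (brauer_monoid n) \<sigma> C a \<noteq> rc_action (brauer_monoid n) \<sigma> C b"
      using rc_action_class[OF rc c(1)] a b quotientI[OF c(1), of \<sigma>] by metis
  qed
  moreover have "card (brauer_elements n // \<sigma>) \<le> degree_count n + 1"
  proof -
    have fin: "finite (insert {} (states n))" using finite_states by simp
    \<comment> \<open>The classes are fibres of the orbit map of \<open>K0\<close>, whose values are
      states or the empty set.\<close>
    have "brauer_elements n // \<sigma> \<subseteq> (\<lambda>K. {\<beta> \<in> brauer_elements n. orb \<beta> = K}) ` insert {} (states n)"
    proof
      fix C assume "C \<in> brauer_elements n // \<sigma>"
      then obtain \<alpha> where \<alpha>: "\<alpha> \<in> brauer_elements n" "C = \<sigma> `` {\<alpha>}" by (auto elim: quotientE)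
      have "K0 \<in> states n" using K0 by (simp add: states_def)
      then have "orb \<alpha> \<in> insert {} (states n)"
        unfolding orb_def by (rule image_states[OF _ brauer_rel_diagram_rel[OF \<alpha>(1)]])
      then show "C \<in> (\<lambda>K. {\<beta> \<in> brauer_elements n. orb \<beta> = K}) ` insert {} (states n)"
        using \<alpha> cls by blast
    qed
    then have "card (brauer_elements n // \<sigma>) \<le> card (insert {} (states n))"
      using fin by (meson card_image_le card_mono finite_imageI le_trans)
    also have "\<dots> = degree_count n + 1"
      using finite_states states_nonempty card_states_eq[OF n] by simp
    finally show ?thesis .
  qed
  ultimately show ?thesis using rc that by blast
qed

lemma rc_degree_brauer:
  assumes n: "n \<ge> 3" and "odd n"
  shows "rc_degree (brauer_monoid n) = degree_count n + 1"
  unfolding rc_degree_def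
proof (rule Least_equality)
  obtain \<sigma> where \<sigma>: "right_congruence (brauer_monoid n) \<sigma>"
    "faithful_action (brauer_monoid n) (brauer_elements n // \<sigma>) (rc_action (brauer_monoid n) \<sigma>)"
    "card (brauer_elements n // \<sigma>) \<le> degree_count n + 1"
    using rc_degree_upper[OF assms] by blast
  have "degree_count n + 1 = card (brauer_elements n // \<sigma>)"
    using rc_degree_lower[OF n \<sigma>(1,2)] \<sigma>(3) by (rule le_antisym)
  then show "\<exists>\<sigma>. right_congruence (brauer_monoid n) \<sigma> \<and>
      faithful_action (brauer_monoid n) (brauer_elements n // \<sigma>) (rc_action (brauer_monoid n) \<sigma>) \<and>
      degree_count n + 1 = card (brauer_elements n // \<sigma>)"
    using \<sigma> by blast
next
  fix k assume "\<exists>\<sigma>. right_congruence (brauer_monoid n) \<sigma> \<and>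
      faithful_action (brauer_monoid n) (brauer_elements n // \<sigma>) (rc_action (brauer_monoid n) \<sigma>) \<and>
      k = card (brauer_elements n // \<sigma>)"
  then show "degree_count n + 1 \<le> k" using rc_degree_lower[OF n] by blast
qed

theorem theorem6p1:
  fixes n :: nat
  assumes "n \<ge> 3"
  shows "partial_transformation_degree (brauer_monoid n) =
           (if odd n
            then card (rank_projections n 1) + 3 * card (rank_projections n 3)
            else card (rank_projections n 0) + 2 * card (rank_projections n 2)
                   + 3 * card (rank_projections n 4))
       \<and> transformation_degree (brauer_monoid n) =
           1 + partial_transformation_degree (brauer_monoid n)
       \<and> (odd n \<longrightarrow> transformation_degree (brauer_monoid n) = rc_degree (brauer_monoid n))"
  using partial_transformation_degree_brauer[OF assms] transformation_degree_brauer[OF assms]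
    rc_degree_brauer[OF assms]
  by (simp add: degree_count_def card_rank_projections card_perfect)

end
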